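(* Let $G$ be a connected algebraic semisimple real Lie group with finite center, no compact factors, and with Kazhdan's property (T). Let $\{\Gamma_n\}$ be a sequence of infinite covolume Zariski dense discrete subgroups of $G$ which converges in the Chabauty topology to a Zariski dense discrete subgroup $\Gamma$ of $G$. Then $\Gamma$ also has infinite covolume in $G$.
   Context: A discrete subgroup $\Gamma<G$ has infinite covolume if $\Gamma\backslash G$ (equivalently $\Gamma\backslash G/K$, $K$ maximal compact) has infinite volume, i.e. $\Gamma$ is not a lattice. Chabauty topology: on the set $\mathrm{Sub}(G)$ of closed subgroups of $G$, a sequence $H_n$ converges to $H$ if for every $h\in H$ there is a sequence $h_n\in H_n$ with $h_n\to h$ and, moreover, the limit points of any sequence $g_n\in H_n$ belong to $H$. *)

theory Defs
  imports "HOL-Analysis.Analysis" "HOL-Algebra.Solvable_Groups"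
begin

section \<open>Linear real algebraic groups\<close>

definition GL :: "(real^'n^'n) monoid" where
  "GL = \<lparr>carrier = {A. invertible A}, mult = (**), one = mat 1\<rparr>"

abbreviation grp :: "(real^'n^'n) set \<Rightarrow> (real^'n^'n) monoid" where
  "grp G \<equiv> GL\<lparr>carrier := G\<rparr>"

lemma group_GL: "group (GL :: (real^'n^'n) monoid)"
proof (rule groupI)
  show "\<one>\<^bsub>GL\<^esub> \<in> carrier (GL :: (real^'n^'n) monoid)"
    by (simp add: GL_def invertible_def exI[of _ "mat 1"])
  show "x \<otimes>\<^bsub>GL\<^esub> y \<in> carrier GL"
    if "x \<in> carrier GL" "y \<in> carrier GL" for x y :: "real^'n^'n"
    using that by (simp add: GL_def invertible_mult)
  show "\<exists>B\<in>carrier GL. B \<otimes>\<^bsub>GL\<^esub> A = \<one>\<^bsub>GL\<^esub>"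
    if "A \<in> carrier GL" for A :: "real^'n^'n"
  proof -
    from that obtain B where "A ** B = mat 1" "B ** A = mat 1"
      unfolding GL_def invertible_def by auto
    then have "B \<in> carrier GL" "B \<otimes>\<^bsub>GL\<^esub> A = \<one>\<^bsub>GL\<^esub>"
      unfolding GL_def invertible_def by auto
    then show ?thesis by blast
  qed
qed (simp_all add: GL_def matrix_mul_assoc)

text \<open>
  Polynomial functions in the matrix entries suffice to cut out the Zariski closed subsets of
  \<open>GL\<close>: the other regular functions are quotients of these by powers of the determinant.
\<close>

definition zariski_closed_subgroup :: "(real^'n^'n) set \<Rightarrow> bool" where
  "zariski_closed_subgroup H \<longleftrightarrow> subgroup H GL \<and>
     (\<exists>P. (\<forall>p\<in>P. real_polynomial_function p) \<and> H = {A \<in> carrier GL. \<forall>p\<in>P. p A = 0})"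

text \<open>
  A connected real algebraic Lie group is the identity component, in the Lie group (Euclidean)
  topology, of the group of real points of a linear algebraic group defined over the reals. It is
  \<open>GL\<close>-closed, but it need not be Zariski closed (for instance the identity component
  of \<open>SO(2,1)\<close>).
\<close>

definition connected_algebraic_group :: "(real^'n^'n) set \<Rightarrow> bool" where
  "connected_algebraic_group G \<longleftrightarrow>
     (\<exists>H. zariski_closed_subgroup H \<and> G = connected_component_set H (mat 1))"

definition zariski_dense_in :: "(real^'n^'n) set \<Rightarrow> (real^'n^'n) set \<Rightarrow> bool" where
  "zariski_dense_in G D \<longleftrightarrow> D \<subseteq> G \<and>
     (\<forall>p. real_polynomial_function p \<longrightarrow> (\<forall>A\<in>D. p A = 0) \<longrightarrow> (\<forall>A\<in>G. p A = 0))"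

definition closed_subgroups :: "(real^'n^'n) set \<Rightarrow> (real^'n^'n) set set" where
  "closed_subgroups G = {H. subgroup H (grp G) \<and> closedin (top_of_set G) H}"

definition closed_connected_normal :: "(real^'n^'n) set \<Rightarrow> (real^'n^'n) set \<Rightarrow> bool" where
  "closed_connected_normal G N \<longleftrightarrow>
     N \<lhd> grp G \<and> closedin (top_of_set G) N \<and> connected N"

text \<open>Semisimplicity is triviality of the radical. The radical of a connected Lie group is its
  largest connected solvable normal subgroup, and it is closed.\<close>

definition semisimple_group :: "(real^'n^'n) set \<Rightarrow> bool" where
  "semisimple_group G \<longleftrightarrow>
     (\<forall>N. closed_connected_normal G N \<and> solvable (grp N) \<longrightarrow> N = {mat 1})"

definition group_center :: "(real^'n^'n) set \<Rightarrow> (real^'n^'n) set" where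
  "group_center G = {z \<in> G. \<forall>g\<in>G. z ** g = g ** z}"

text \<open>A connected semisimple group is the almost direct product of its simple factors, which
  are its minimal nontrivial closed connected normal subgroups.\<close>

definition simple_factor :: "(real^'n^'n) set \<Rightarrow> (real^'n^'n) set \<Rightarrow> bool" where
  "simple_factor G N \<longleftrightarrow> closed_connected_normal G N \<and> N \<noteq> {mat 1} \<and>
     (\<forall>M. closed_connected_normal G M \<and> M \<subseteq> N \<longrightarrow> M = {mat 1} \<or> M = N)"

definition no_compact_factors :: "(real^'n^'n) set \<Rightarrow> bool" where
  "no_compact_factors G \<longleftrightarrow> (\<forall>N. simple_factor G N \<longrightarrow> \<not> compact N)"


section \<open>Unitary representations and property (T)\<close>

text \<open>Complex Hilbert spaces are given by explicit carriers, because property (T) quantifies over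
  them inside a formula. The inner product is linear in its second argument.\<close>

record 'v hilbert =
  vecs :: "'v set"
  vadd :: "'v \<Rightarrow> 'v \<Rightarrow> 'v"
  vzero :: 'v
  vscale :: "complex \<Rightarrow> 'v \<Rightarrow> 'v"
  vinner :: "'v \<Rightarrow> 'v \<Rightarrow> complex"

definition vnorm :: "'v hilbert \<Rightarrow> 'v \<Rightarrow> real" where
  "vnorm V x = sqrt (Re (vinner V x x))"

definition vdist :: "'v hilbert \<Rightarrow> 'v \<Rightarrow> 'v \<Rightarrow> real" where
  "vdist V x y = vnorm V (vadd V x (vscale V (-1) y))"

definition complex_inner_product_space :: "'v hilbert \<Rightarrow> bool" where
  "complex_inner_product_space V \<longleftrightarrow>
     comm_group \<lparr>carrier = vecs V, mult = vadd V, one = vzero V\<rparr> \<and>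
     (\<forall>x\<in>vecs V. vscale V 1 x = x \<and> (\<forall>a. vscale V a x \<in> vecs V) \<and>
        (\<forall>a b. vscale V a (vscale V b x) = vscale V (a * b) x \<and>
               vscale V (a + b) x = vadd V (vscale V a x) (vscale V b x))) \<and>
     (\<forall>x\<in>vecs V. \<forall>y\<in>vecs V.
        (\<forall>a. vscale V a (vadd V x y) = vadd V (vscale V a x) (vscale V a y)) \<and>
        (\<forall>a. vinner V x (vscale V a y) = a * vinner V x y) \<and>
        vinner V y x = cnj (vinner V x y) \<and>
        (\<forall>z\<in>vecs V. vinner V x (vadd V y z) = vinner V x y + vinner V x z)) \<and>
     (\<forall>x\<in>vecs V. x \<noteq> vzero V \<longrightarrow> Re (vinner V x x) > 0)"

definition hilbert_space :: "'v hilbert \<Rightarrow> bool" where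
  "hilbert_space V \<longleftrightarrow> complex_inner_product_space V \<and>
     (\<forall>s. (\<forall>n::nat. s n \<in> vecs V) \<longrightarrow>
        (\<forall>e>0. \<exists>N. \<forall>m\<ge>N. \<forall>n\<ge>N. vdist V (s m) (s n) < e) \<longrightarrow>
        (\<exists>x\<in>vecs V. (\<lambda>n. vdist V (s n) x) \<longlonglongrightarrow> 0))"

definition unitary_operator :: "'v hilbert \<Rightarrow> ('v \<Rightarrow> 'v) \<Rightarrow> bool" where
  "unitary_operator V T \<longleftrightarrow> bij_betw T (vecs V) (vecs V) \<and>
     (\<forall>x\<in>vecs V. \<forall>a. T (vscale V a x) = vscale V a (T x)) \<and>
     (\<forall>x\<in>vecs V. \<forall>y\<in>vecs V. T (vadd V x y) = vadd V (T x) (T y) \<and>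
        vinner V (T x) (T y) = vinner V x y)"

definition unitary_rep ::
  "(real^'n^'n) set \<Rightarrow> 'v hilbert \<Rightarrow> (real^'n^'n \<Rightarrow> 'v \<Rightarrow> 'v) \<Rightarrow> bool" where
  "unitary_rep G V \<pi> \<longleftrightarrow>
     (\<forall>g\<in>G. unitary_operator V (\<pi> g)) \<and>
     (\<forall>g\<in>G. \<forall>h\<in>G. \<forall>x\<in>vecs V. \<pi> (g ** h) x = \<pi> g (\<pi> h x)) \<and>
     (\<forall>x\<in>vecs V. \<forall>g\<in>G. tendsto (\<lambda>h. vdist V (\<pi> h x) (\<pi> g x)) 0 (at g within G))"

text \<open>For compact \<open>Q\<close>, the pointwise strict bound is the same as
  \<open>sup\<^sub>q \<parallel>\<pi> q x - x\<parallel> < \<epsilon> \<parallel>x\<parallel>\<close>, by strong continuity.\<close>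

definition has_almost_invariant_vector ::
  "(real^'n^'n) set \<Rightarrow> real \<Rightarrow> 'v hilbert \<Rightarrow> (real^'n^'n \<Rightarrow> 'v \<Rightarrow> 'v) \<Rightarrow> bool" where
  "has_almost_invariant_vector Q \<epsilon> V \<pi> \<longleftrightarrow>
     (\<exists>x\<in>vecs V. x \<noteq> vzero V \<and> (\<forall>q\<in>Q. vdist V (\<pi> q x) x < \<epsilon> * vnorm V x))"

definition has_invariant_vector ::
  "(real^'n^'n) set \<Rightarrow> 'v hilbert \<Rightarrow> (real^'n^'n \<Rightarrow> 'v \<Rightarrow> 'v) \<Rightarrow> bool" where
  "has_invariant_vector G V \<pi> \<longleftrightarrow> (\<exists>x\<in>vecs V. x \<noteq> vzero V \<and> (\<forall>g\<in>G. \<pi> g x = x))"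

text \<open>
  A formula can only quantify over Hilbert spaces whose vectors live in one fixed type. The type
  below has cardinality greater than the continuum, so it contains a copy of every
  separable Hilbert space (and the usual spaces of classes of functions on the group literally).
  This is no restriction: the group is second countable, so the closed invariant subspace
  generated by a single vector of any unitary representation is separable, and hence a Kazhdan
  pair for the representations considered here is one for all unitary representations.
\<close>

definition property_T :: "(real^'n^'n) set \<Rightarrow> bool" where
  "property_T G \<longleftrightarrow>
     (\<exists>Q \<epsilon>. compact Q \<and> Q \<subseteq> G \<and> \<epsilon> > 0 \<and>
        (\<forall>(V :: ((real^'n^'n \<Rightarrow> complex) set) hilbert) \<pi>.
           hilbert_space V \<and> unitary_rep G V \<pi> \<and> has_almost_invariant_vector Q \<epsilon> V \<pi>
           \<longrightarrow> has_invariant_vector G V \<pi>))"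


section \<open>Discrete subgroups, covolume and Chabauty convergence\<close>

definition discrete_subgroup :: "(real^'n^'n) set \<Rightarrow> (real^'n^'n) set \<Rightarrow> bool" where
  "discrete_subgroup G D \<longleftrightarrow> subgroup D (grp G) \<and> discrete D"

text \<open>The space of cosets \<open>D g\<close>, with the quotient topology of the topology of \<open>G\<close>.\<close>

definition coset_topology :: "(real^'n^'n) set \<Rightarrow> (real^'n^'n) set \<Rightarrow> (real^'n^'n) set topology" where
  "coset_topology G D =
     topology (\<lambda>U. U \<subseteq> rcosets\<^bsub>grp G\<^esub> D \<and> openin (top_of_set G) (\<Union>U))"

lemma openin_coset_topology:
  assumes "subgroup G GL" "subgroup D (grp G)"
  shows "openin (coset_topology G D) U \<longleftrightarrow>
           U \<subseteq> rcosets\<^bsub>grp G\<^esub> D \<and> openin (top_of_set G) (\<Union>U)"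
proof -
  interpret group "grp G"
    using group.subgroup_imp_group[OF group_GL assms(1)] .
  have disj: "\<Union>(U \<inter> V) = \<Union>U \<inter> \<Union>V"
    if "U \<subseteq> rcosets\<^bsub>grp G\<^esub> D" "V \<subseteq> rcosets\<^bsub>grp G\<^esub> D" for U V
  proof (intro equalityI subsetI)
    fix x assume "x \<in> \<Union>U \<inter> \<Union>V"
    then obtain A B where AB: "A \<in> U" "B \<in> V" "x \<in> A" "x \<in> B" by blast
    then have "A \<in> rcosets\<^bsub>grp G\<^esub> D" "B \<in> rcosets\<^bsub>grp G\<^esub> D" using that by blast+
    then have "A \<noteq> B \<Longrightarrow> disjnt A B"
      using rcos_disjoint[OF assms(2)] by (metis pairwiseD)
    then have "A = B" using AB by (meson disjnt_iff)
    then show "x \<in> \<Union>(U \<inter> V)" using AB by blast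
  qed blast
  have "istopology (\<lambda>U. U \<subseteq> rcosets\<^bsub>grp G\<^esub> D \<and> openin (top_of_set G) (\<Union>U))"
    unfolding istopology_def
  proof (intro conjI allI impI)
    fix \<U> assume *: "\<forall>U\<in>\<U>. U \<subseteq> rcosets\<^bsub>grp G\<^esub> D \<and> openin (top_of_set G) (\<Union>U)"
    show "\<Union>\<U> \<subseteq> rcosets\<^bsub>grp G\<^esub> D" using * by blast
    have "openin (top_of_set G) (\<Union>(Union ` \<U>))"
      using * by (intro openin_Union) blast
    moreover have "\<Union>(Union ` \<U>) = \<Union>(\<Union>\<U>)" by blast
    ultimately show "openin (top_of_set G) (\<Union>(\<Union>\<U>))" by simp
  next
    fix U V
    assume U: "U \<subseteq> rcosets\<^bsub>grp G\<^esub> D \<and> openin (top_of_set G) (\<Union>U)"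
      and V: "V \<subseteq> rcosets\<^bsub>grp G\<^esub> D \<and> openin (top_of_set G) (\<Union>V)"
    show "U \<inter> V \<subseteq> rcosets\<^bsub>grp G\<^esub> D" using U by blast
    show "openin (top_of_set G) (\<Union>(U \<inter> V))"
      using U V disj[of U V] openin_Int[of "top_of_set G" "\<Union>U" "\<Union>V"] by simp
  qed
  then show ?thesis
    unfolding coset_topology_def by (simp only: topology_inverse')
qed

text \<open>
  The volume on the coset space: a nonzero Borel measure that is finite on compact sets and
  invariant under right translation by \<open>G\<close>. For discrete \<open>D\<close> and semisimple (hence unimodular)
  \<open>G\<close> it exists and is unique up to a positive factor, and up to such a factor it is the measure
  of a fundamental domain with respect to Haar measure.
\<close>

definition invariant_volume ::
  "(real^'n^'n) set \<Rightarrow> (real^'n^'n) set \<Rightarrow> (real^'n^'n) set measure \<Rightarrow> bool" where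
  "invariant_volume G D \<nu> \<longleftrightarrow>
     sets \<nu> = sigma_sets (rcosets\<^bsub>grp G\<^esub> D) {U. openin (coset_topology G D) U} \<and>
     emeasure \<nu> (space \<nu>) \<noteq> 0 \<and>
     (\<forall>C. compactin (coset_topology G D) C \<longrightarrow> emeasure \<nu> C < \<infinity>) \<and>
     (\<forall>g\<in>G. \<forall>A\<in>sets \<nu>. emeasure \<nu> ((\<lambda>c. c #>\<^bsub>grp G\<^esub> g) ` A) = emeasure \<nu> A)"

definition infinite_covolume :: "(real^'n^'n) set \<Rightarrow> (real^'n^'n) set \<Rightarrow> bool" where
  "infinite_covolume G D \<longleftrightarrow>
     (\<forall>\<nu>. invariant_volume G D \<nu> \<longrightarrow> emeasure \<nu> (space \<nu>) = \<infinity>)"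

text \<open>Limit points of a sequence are limits, in \<open>G\<close>, of its subsequences.\<close>

definition chabauty_converges ::
  "(real^'n^'n) set \<Rightarrow> (nat \<Rightarrow> (real^'n^'n) set) \<Rightarrow> (real^'n^'n) set \<Rightarrow> bool" where
  "chabauty_converges G H L \<longleftrightarrow>
     (\<forall>n. H n \<in> closed_subgroups G) \<and> L \<in> closed_subgroups G \<and>
     (\<forall>x\<in>L. \<exists>h. (\<forall>n. h n \<in> H n) \<and> h \<longlonglongrightarrow> x) \<and>
     (\<forall>h r x. (\<forall>n. h n \<in> H n) \<longrightarrow> strict_mono (r :: nat \<Rightarrow> nat) \<longrightarrow> x \<in> G \<longrightarrow>
        (h \<circ> r) \<longlonglongrightarrow> x \<longrightarrow> x \<in> L)"

end

(*
  Suppose the limit group \<Gamma> has a finite invariant volume on its coset space, of total mass c.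
  Counting points of cosets with respect to it gives a right Haar measure \<mu> on G, and finiteness
  of c forces \<mu> to be left invariant. Let K be a compact subset of a fundamental domain F of \<Gamma>
  with \<mu> K close to c, and W an open neighbourhood of F with \<mu> W close to c. Chabauty convergence
  and the absence of small subgroups imply that, for large n, K embeds in the space of cosets of
  \<Gamma>_n, and \<Gamma>_n W contains K and its translates by the inverses of a compact Kazhdan set. Hence
  the indicator function of the image of K is moved by at most 2 (\<mu> W - \<mu> K) in squared norm,
  i.e. it is almost invariant. Property (T) provides a nonzero invariant vector; it is a constant
  function, so the coset space of \<Gamma>_n has finite volume, a contradiction.
*)

theory Submission
  imports Defs
begin

section \<open>Matrix groups\<close>

text \<open>One and the same measure has to descend to the coset spaces of all groups in the
  sequence, which requires invariance under left translation by each of them. Full left invariance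
  is therefore extracted from the only finite volume at hand, that of the limit. The obstacle is
  that convergence is informative on compact sets only, while a fundamental domain may be unbounded.
  Hence just \<open>K\<close> and its translates are compared with \<open>W\<close>; of
  \<open>W\<close> only openness and measure matter. Near 1, which belongs to the limit, convergence
  excludes nothing: nontrivial elements might tend to 1. Squaring pushes such an element into a
  compact annulus around 1 that misses the limit group, and there convergence applies. The bound 2
  (\<mu> W - \<mu> K) arises because the image of \<open>K\<close> and its translate both have
  measure \<mu> K and both lie in the image of \<open>W\<close>. Since \<open>property_T\<close>
  fixes the type of vectors, a coset space is modelled by a fundamental domain, a set of matrices,
  with \<mu> restricted to it; a vector is an almost-everywhere class of functions of
  matrices.\<close>

lemma matrix_add_rdistrib: "(B + C) ** A = B ** A + C ** A" for A :: "real^'n^'m"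
  by (vector matrix_matrix_mult_def sum.distrib[symmetric] field_simps)

lemma bounded_bilinear_matrix_mult:
  "bounded_bilinear ((**) :: real^'n^'n \<Rightarrow> real^'n^'n \<Rightarrow> real^'n^'n)"
proof -
  have "bilinear ((**) :: real^'n^'n \<Rightarrow> real^'n^'n \<Rightarrow> real^'n^'n)"
    unfolding bilinear_def
    by (auto intro!: linearI simp: matrix_add_ldistrib matrix_add_rdistrib
        scalar_matrix_assoc matrix_scalar_ac)
  then show ?thesis by (simp add: bilinear_conv_bounded_bilinear)
qed

lemmas tendsto_matrix_mult [tendsto_intros] =
  bounded_bilinear.tendsto[OF bounded_bilinear_matrix_mult]
lemmas continuous_on_matrix_mult [continuous_intros] =
  bounded_bilinear.continuous_on[OF bounded_bilinear_matrix_mult]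

lemma borel_measurable_matrix_mult [measurable (raw)]:
  fixes f g :: "'a \<Rightarrow> real^'n^'n"
  assumes "f \<in> borel_measurable M" "g \<in> borel_measurable M"
  shows "(\<lambda>x. f x ** g x) \<in> borel_measurable M"
  using borel_measurable_continuous_Pair[OF assms, of "(**)"]
  by (simp add: continuous_intros case_prod_unfold)

lemma continuous_on_det:
  fixes f :: "'a::topological_space \<Rightarrow> real^'n^'n"
  assumes "continuous_on S f"
  shows "continuous_on S (\<lambda>x. det (f x))"
  unfolding det_def by (intro continuous_intros assms)

lemma open_invertible: "open {A :: real^'n^'n. invertible A}"
  unfolding invertible_det_nz
  by (intro open_Collect_neq continuous_on_det continuous_intros)

lemma matrix_inv_cancel:
  fixes A :: "real^'n^'n"
  assumes "invertible A"
  shows "matrix_inv A ** A = mat 1" "A ** matrix_inv A = mat 1"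
    "matrix_inv A ** (A ** X) = X" "A ** (matrix_inv A ** X) = X"
    "(X ** A) ** matrix_inv A = X" "(X ** matrix_inv A) ** A = X"
proof -
  have "A ** matrix_inv A = mat 1 \<and> matrix_inv A ** A = mat 1"
    unfolding matrix_inv_def by (rule someI_ex) (use assms in \<open>simp add: invertible_def\<close>)
  then show *: "matrix_inv A ** A = mat 1" "A ** matrix_inv A = mat 1" by auto
  show "matrix_inv A ** (A ** X) = X" "A ** (matrix_inv A ** X) = X"
    by (simp_all add: matrix_mul_assoc *)
  show "(X ** A) ** matrix_inv A = X" "(X ** matrix_inv A) ** A = X"
    by (simp_all add: matrix_mul_assoc[symmetric] *)
qed

lemma matrix_inv_eqI:
  fixes A B :: "real^'n^'n"
  assumes "A ** B = mat 1"
  shows "matrix_inv A = B"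
proof -
  have "invertible A" using assms invertible_right_inverse by blast
  then have "matrix_inv A ** (A ** B) = B" by (rule matrix_inv_cancel)
  then show ?thesis by (simp add: assms)
qed

text \<open>Column \<open>m\<close> of the inverse solves A x = e_m, so Cramer's rule applies column
  by column. The formula makes the continuity of inversion visible: the entries are quotients of
  determinants.\<close>

lemma matrix_inv_cramer:
  fixes A :: "real^'n^'n"
  assumes "invertible A"
  shows "matrix_inv A =
    (\<chi> k m. det (\<chi> i j. if j = k then (mat 1 :: real^'n^'n) $ i $ m else A $ i $ j) / det A)"
proof -
  have *: "column m (matrix_inv A) =
      (\<chi> k. det (\<chi> i j. if j = k then column m (mat 1 :: real^'n^'n) $ i else A $ i $ j) / det A)" for m
  proof (subst cramer[symmetric])
    show "det A \<noteq> 0" using assms by (simp add: invertible_det_nz)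
    have "A *v column m (matrix_inv A) = column m (A ** matrix_inv A)"
      by (simp add: vec_eq_iff column_def matrix_vector_mult_def matrix_matrix_mult_def)
    then show "A *v column m (matrix_inv A) = column m (mat 1)"
      by (simp add: matrix_inv_cancel[OF assms])
  qed
  have "matrix_inv A $ k $ m = column m (matrix_inv A) $ k" for k m by (simp add: column_def)
  moreover have "column m (mat 1 :: real^'n^'n) $ i = mat 1 $ i $ m" for i m by (simp add: column_def)
  ultimately show ?thesis by (simp add: vec_eq_iff * cong: if_cong)
qed

lemma continuous_on_matrix_inv:
  "continuous_on {A :: real^'n^'n. invertible A} matrix_inv"
proof -
  have "continuous_on {A :: real^'n^'n. invertible A} (\<lambda>A.
    (\<chi> k m. det (\<chi> i j. if j = k then (mat 1 :: real^'n^'n) $ i $ m else A $ i $ j) / det A))"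
  proof (intro continuous_on_vec_lambda continuous_on_divide continuous_on_det ballI)
    fix k m i j :: 'n
    show "continuous_on {A :: real^'n^'n. invertible A}
      (\<lambda>A. if j = k then (mat 1 :: real^'n^'n) $ i $ m else A $ i $ j)"
      by (cases "j = k") (auto intro!: continuous_intros)
  qed (auto simp: invertible_det_nz)
  then show ?thesis
    by (rule continuous_on_cong[THEN iffD1, rotated -1]) (auto simp: matrix_inv_cramer)
qed

lemma tendsto_matrix_inv [tendsto_intros]:
  fixes f :: "'a \<Rightarrow> real^'n^'n"
  assumes "(f \<longlongrightarrow> A) F" "invertible A"
  shows "((\<lambda>x. matrix_inv (f x)) \<longlongrightarrow> matrix_inv A) F"
proof -
  have "isCont matrix_inv A"
    using continuous_on_matrix_inv open_invertible assms(2)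
    using continuous_on_eq_continuous_at by blast
  then show ?thesis using assms(1) by (rule isCont_tendsto_compose)
qed

text \<open>\<open>matrix_inv\<close> picks its value with \<open>SOME\<close>. For a singular
  matrix the predicate is empty, so all singular matrices get the same value \<open>?c\<close>, and
  the function is Borel on the whole matrix space, not only on the open set of invertible
  matrices.\<close>

lemma borel_measurable_matrix_inv [measurable]:
  "(matrix_inv :: real^'n^'n \<Rightarrow> _) \<in> borel_measurable borel"
proof -
  let ?c = "SOME B :: real^'n^'n. False"
  have *: "matrix_inv A = (if invertible A then matrix_inv A else ?c)" for A :: "real^'n^'n"
  proof (cases "invertible A")
    case False
    then have "(\<lambda>B. A ** B = mat 1 \<and> B ** A = mat 1) = (\<lambda>_. False)"
      by (auto simp: invertible_def)
    then show ?thesis using False by (simp add: matrix_inv_def)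
  qed simp
  have "(\<lambda>A :: real^'n^'n. if invertible A then matrix_inv A else ?c) \<in> borel_measurable borel"
  proof (subst measurable_If_restrict_space_iff)
    show "{x \<in> space borel. invertible (x :: real^'n^'n)} \<in> sets borel"
      using borel_open[OF open_invertible] by simp
    show "matrix_inv \<in> restrict_space borel {A :: real^'n^'n. invertible A} \<rightarrow>\<^sub>M borel \<and>
      (\<lambda>A. ?c) \<in> restrict_space borel {A :: real^'n^'n. \<not> invertible A} \<rightarrow>\<^sub>M borel"
      by (intro conjI borel_measurable_continuous_on_restrict continuous_on_matrix_inv) simp
  qed
  then show ?thesis by (simp only: *[symmetric])
qed

text \<open>A nontrivial element close to \<open>1\<close> moves away from \<open>1\<close> under squaring, at a rate between
  \<open>3/2\<close> and \<open>5/2\<close>; so its orbit under squaring meets every annulus of ratio \<open>3\<close> around \<open>1\<close>.\<close>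

lemma no_small_subgroups:
  obtains r0 :: real where "r0 > 0"
    "\<And>r g (S :: (real^'n^'n) set). \<lbrakk>0 < r; r \<le> r0; \<And>h. h \<in> S \<Longrightarrow> h ** h \<in> S; g \<in> S; g \<noteq> mat 1;
       norm (g - mat 1) < r\<rbrakk> \<Longrightarrow> \<exists>h\<in>S. r \<le> norm (h - mat 1) \<and> norm (h - mat 1) \<le> 3 * r"
proof -
  have "\<exists>C>0. \<forall>(A :: real^'n^'n) (B :: real^'n^'n). norm (A ** B) \<le> norm A * norm B * C"
    by (rule bounded_bilinear.pos_bounded[OF bounded_bilinear_matrix_mult])
  then obtain C where C: "C > 0" "\<And>(A :: real^'n^'n) (B :: real^'n^'n). norm (A ** B) \<le> norm A * norm B * C"
    by auto
  \<comment> \<open>In (1 + X)^2 - 1 = 2 X + X^2 the quadratic term is at most half of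
    \<open>norm X\<close> when \<open>norm X\<close> is at most this radius; the linear term then
    dominates.\<close>
  define r0 where "r0 = 1 / (2 * C)"
  have sq: "3/2 * norm (h - mat 1) \<le> norm (h ** h - mat 1) \<and> norm (h ** h - mat 1) \<le> 3 * norm (h - mat 1)"
    if "norm (h - mat 1) \<le> r0" for h :: "real^'n^'n"
  proof -
    define X where "X = h - mat 1"
    have "h ** h = (X + mat 1) ** (X + mat 1)" by (simp add: X_def)
    also have "\<dots> = X ** X + X + X + mat 1"
      by (simp add: matrix_add_ldistrib matrix_add_rdistrib)
    finally have eq: "h ** h - mat 1 = 2 *\<^sub>R X + X ** X" by (simp add: scaleR_2)
    have "norm (X ** X) \<le> norm X * (norm X * C)" using C(2)[of X X] by simp
    also have "\<dots> \<le> norm X * (r0 * C)"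
      using that C(1) by (intro mult_left_mono mult_right_mono) (auto simp: X_def)
    also have "\<dots> = norm X / 2" using C(1) by (simp add: r0_def)
    finally have b: "norm (X ** X) \<le> norm X / 2" .
    have "norm (2 *\<^sub>R X + X ** X) \<le> 2 * norm X + norm (X ** X)"
      using norm_triangle_ineq[of "2 *\<^sub>R X" "X ** X"] by simp
    moreover have "2 * norm X - norm (X ** X) \<le> norm (2 *\<^sub>R X + X ** X)"
      using norm_triangle_ineq2[of "2 *\<^sub>R X" "- (X ** X)"] by simp
    ultimately show ?thesis
      unfolding eq X_def[symmetric] using b norm_ge_zero[of X] by argo
  qed
  show ?thesis
  proof (rule that[of r0])
    show "r0 > 0" using C by (simp add: r0_def)
    fix r g and S :: "(real^'n^'n) set"
    assume r: "0 < r" "r \<le> r0" and S: "\<And>h. h \<in> S \<Longrightarrow> h ** h \<in> S"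
      and g: "g \<in> S" "g \<noteq> mat 1" "norm (g - mat 1) < r"
    show "\<exists>h\<in>S. r \<le> norm (h - mat 1) \<and> norm (h - mat 1) \<le> 3 * r"
    proof (rule ccontr)
      assume no: "\<not> ?thesis"
      \<comment> \<open>From inside the ball of radius \<open>r\<close>, squaring lands within
        \<open>3 * r\<close>. If \<open>S\<close> misses the annulus, the square is back in the
        ball, so the orbit is trapped there although its distance from 1 grows
        geometrically.\<close>
      have step: "h ** h \<in> S \<and> norm (h ** h - mat 1) < r \<and> 3/2 * norm (h - mat 1) \<le> norm (h ** h - mat 1)"
        if "h \<in> S" "norm (h - mat 1) < r" for h
      proof -
        have "norm (h ** h - mat 1) \<le> 3 * r" using sq[of h] that r by auto
        then have "norm (h ** h - mat 1) < r" using no S[OF that(1)] by (meson not_le)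
        then show ?thesis using sq[of h] S[OF that(1)] that(2) r by auto
      qed
      have "\<exists>h\<in>S. norm (h - mat 1) < r \<and> (3/2)^k * norm (g - mat 1) \<le> norm (h - mat 1)" for k
      proof (induction k)
        case 0 then show ?case using g by auto
      next
        case (Suc k)
        then obtain h where h: "h \<in> S" "norm (h - mat 1) < r"
          "(3/2)^k * norm (g - mat 1) \<le> norm (h - mat 1)" by blast
        have "(3/2)^Suc k * norm (g - mat 1) \<le> norm (h ** h - mat 1)"
          using h(3) step[OF h(1,2)] by (simp add: mult.assoc)
        then show ?case using step[OF h(1,2)] by blast
      qed
      then have bd: "(3/2)^k * norm (g - mat 1) < r" for k by (meson le_less_trans)
      have "norm (g - mat 1) > 0" using g by simp
      moreover obtain k where "(3/2::real)^k > r / norm (g - mat 1)"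
        using real_arch_pow[of "3/2"] by auto
      ultimately show False using bd[of k] by (simp add: field_simps)
    qed
  qed
qed

section \<open>Closed linear groups and their exhaustion by compact sets\<close>

text \<open>Closedness is relative to the invertible matrices, because elements of the group may
  converge to a singular matrix; this is why \<open>limit_in\<close> asks for an invertible
  limit.\<close>

locale linear_group =
  fixes G :: "(real^'n^'n) set"
  assumes one_in [simp]: "mat 1 \<in> G"
    and mult_in [simp]: "g \<in> G \<Longrightarrow> h \<in> G \<Longrightarrow> g ** h \<in> G"
    and inv_in [simp]: "g \<in> G \<Longrightarrow> matrix_inv g \<in> G"
    and invertible: "g \<in> G \<Longrightarrow> invertible g"
    and closed_in_GL: "closedin (top_of_set {A. invertible A}) G"
begin

lemmas cancel [simp] = matrix_inv_cancel[OF invertible]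

lemma inv_inv [simp]: "g \<in> G \<Longrightarrow> matrix_inv (matrix_inv g) = g"
  by (rule matrix_inv_eqI) simp

lemma inv_mult: "g \<in> G \<Longrightarrow> h \<in> G \<Longrightarrow> matrix_inv (g ** h) = matrix_inv h ** matrix_inv g"
  by (rule matrix_inv_eqI) (metis cancel(2,5) matrix_mul_assoc)

lemma mult_in_iff:
  assumes "g \<in> G"
  shows "g ** x \<in> G \<longleftrightarrow> x \<in> G" "x ** g \<in> G \<longleftrightarrow> x \<in> G"
  using assms by (metis cancel(3) inv_in mult_in, metis cancel(5) inv_in mult_in)

lemma borel_G [measurable, simp]: "G \<in> sets borel"
proof -
  obtain C where "closed C" "G = {A. invertible A} \<inter> C"
    using closed_in_GL by (auto simp: closedin_closed)
  then show ?thesis using borel_open[OF open_invertible] borel_closed by auto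
qed

lemma limit_in:
  assumes "\<And>k :: nat. f k \<in> G" "f \<longlonglongrightarrow> A" "invertible A"
  shows "A \<in> G"
proof -
  obtain C where C: "closed C" "G = {A. invertible A} \<inter> C"
    using closed_in_GL by (auto simp: closedin_closed)
  then have "A \<in> C" using assms by (metis IntE closed_sequentially)
  then show ?thesis using C assms by auto
qed

text \<open>An exhaustion by compact sets. The bound on the inverse keeps limits away from the
  singular matrices.\<close>

definition bounded_part :: "nat \<Rightarrow> (real^'n^'n) set" where
  "bounded_part k = {A \<in> G. norm A \<le> real k \<and> norm (matrix_inv A) \<le> real k}"

lemma bounded_part_subset: "bounded_part k \<subseteq> G"
  by (auto simp: bounded_part_def)

lemma borel_bounded_part [measurable, simp]: "bounded_part k \<in> sets borel"
  unfolding bounded_part_def by measurable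

lemma Union_bounded_part: "(\<Union>k. bounded_part k) = G"
proof -
  have "A \<in> bounded_part (nat \<lceil>max (norm A) (norm (matrix_inv A))\<rceil>)" if "A \<in> G" for A
    using that real_nat_ceiling_ge[of "max (norm A) (norm (matrix_inv A))"]
    by (simp add: bounded_part_def)
  then show ?thesis using bounded_part_subset by blast
qed

lemma compact_bounded_part: "compact (bounded_part k)"
  unfolding compact_def
proof (intro allI impI)
  fix f :: "nat \<Rightarrow> real^'n^'n" assume f: "\<forall>i. f i \<in> bounded_part k"
  \<comment> \<open>Extracting from the pairs of a matrix and its inverse makes the inverses
    converge as well. Their limit \<open>B\<close> satisfies A ** B = 1, which shows that the limit
    \<open>A\<close> is invertible.\<close>
  have "seq_compact (cball (0 :: real^'n^'n) k \<times> cball (0 :: real^'n^'n) k)"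
    unfolding compact_eq_seq_compact_metric[symmetric] by (intro compact_Times compact_cball)
  moreover have "\<forall>i. (f i, matrix_inv (f i)) \<in> cball 0 k \<times> cball 0 k"
    using f by (simp add: bounded_part_def)
  ultimately obtain l r where "l \<in> cball 0 k \<times> cball 0 k" and r: "strict_mono r"
    and l: "((\<lambda>i. (f i, matrix_inv (f i))) \<circ> r) \<longlonglongrightarrow> l"
    by (rule seq_compactE)
  obtain A B where AB: "l = (A, B)" by (cases l)
  have A: "(f \<circ> r) \<longlonglongrightarrow> A" and B: "(\<lambda>i. matrix_inv (f (r i))) \<longlonglongrightarrow> B"
    using tendsto_fst[OF l] tendsto_snd[OF l] by (simp_all add: AB comp_def)
  have "(\<lambda>i. f (r i) ** matrix_inv (f (r i))) \<longlonglongrightarrow> A ** B"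
    using A B by (auto intro!: tendsto_intros simp: comp_def)
  moreover have "f (r i) ** matrix_inv (f (r i)) = mat 1" for i
    using f by (auto simp: bounded_part_def)
  ultimately have 1: "A ** B = mat 1" by (simp add: LIMSEQ_const_iff)
  then have inv: "invertible A" using invertible_right_inverse by blast
  have "A \<in> G" using f by (intro limit_in[OF _ A inv]) (simp add: bounded_part_def)
  then have "A \<in> bounded_part k"
    using \<open>l \<in> _\<close> by (auto simp: bounded_part_def AB matrix_inv_eqI[OF 1])
  then show "\<exists>l\<in>bounded_part k. \<exists>r. strict_mono r \<and> (f \<circ> r) \<longlonglongrightarrow> l"
    using A r by (intro bexI exI conjI)
qed

end

lemma group_inv_GL:
  fixes A :: "real^'n^'n"
  assumes "A \<in> carrier GL"
  shows "inv\<^bsub>GL\<^esub> A = matrix_inv A"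
proof (rule group.inv_equality[OF group_GL])
  have inv: "invertible A" using assms by (simp add: GL_def)
  show "matrix_inv A \<otimes>\<^bsub>GL\<^esub> A = \<one>\<^bsub>GL\<^esub>"
    by (simp add: GL_def matrix_inv_cancel[OF inv])
  have "invertible (matrix_inv A)"
    unfolding invertible_def using matrix_inv_cancel(1,2)[OF inv] by blast
  then show "matrix_inv A \<in> carrier GL" by (simp add: GL_def)
qed (fact assms)

lemma subgroup_GL_iff:
  "subgroup H GL \<longleftrightarrow> mat 1 \<in> H \<and> (\<forall>g\<in>H. \<forall>h\<in>H. g ** h \<in> H) \<and>
     (\<forall>g\<in>H. invertible g \<and> matrix_inv g \<in> H)" for H :: "(real^'n^'n) set"
proof
  assume H: "subgroup H GL"
  have sub: "H \<subseteq> carrier GL" using subgroup.subset[OF H] .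
  then show "mat 1 \<in> H \<and> (\<forall>g\<in>H. \<forall>h\<in>H. g ** h \<in> H) \<and> (\<forall>g\<in>H. invertible g \<and> matrix_inv g \<in> H)"
    using subgroup.one_closed[OF H] subgroup.m_closed[OF H] subgroup.m_inv_closed[OF H]
    by (auto simp: GL_def simp flip: group_inv_GL)
next
  assume H: "mat 1 \<in> H \<and> (\<forall>g\<in>H. \<forall>h\<in>H. g ** h \<in> H) \<and> (\<forall>g\<in>H. invertible g \<and> matrix_inv g \<in> H)"
  have "inv\<^bsub>GL\<^esub> g = matrix_inv g" if "g \<in> H" for g
    using that H by (intro group_inv_GL) (auto simp: GL_def)
  with H show "subgroup H GL"
    by (intro subgroup.intro) (auto simp: GL_def)
qed

text \<open>The identity component is the largest connected subset of \<open>H\<close> through 1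
  (\<open>max\<close>). Products and inverses of its elements form connected sets through 1 and
  hence stay inside. A component is closed in \<open>H\<close>, and \<open>H\<close> is closed among
  the invertible matrices as a zero set of polynomials.\<close>

lemma linear_group_connected_algebraic:
  fixes G :: "(real^'n^'n) set"
  assumes "connected_algebraic_group G"
  shows "linear_group G"
proof -
  obtain H P where H: "subgroup H GL" and P: "\<And>p. p \<in> P \<Longrightarrow> real_polynomial_function p"
    and HP: "H = {A \<in> carrier GL. \<forall>p\<in>P. p A = 0}" and G: "G = connected_component_set H (mat 1)"
    using assms unfolding connected_algebraic_group_def zariski_closed_subgroup_def by auto
  note H' = H[unfolded subgroup_GL_iff]
  have one: "mat 1 \<in> G" using H' by (simp add: G)
  have GH: "G \<subseteq> H" by (simp add: G connected_component_subset)
  have conn: "connected G" by (simp add: G)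
  have max: "T \<subseteq> G" if "connected T" "mat 1 \<in> T" "T \<subseteq> H" for T
    using connected_component_maximal[OF that(2,1,3)] by (simp add: G)
  have "(\<lambda>(g, h). g ** h) ` (G \<times> G) \<subseteq> G"
  proof (rule max)
    show "connected ((\<lambda>(g, h). g ** h) ` (G \<times> G))"
      by (intro connected_continuous_image connected_Times conn)
        (auto simp: case_prod_unfold intro!: continuous_intros)
    have "mat 1 ** mat 1 \<in> (\<lambda>(g, h). g ** h) ` (G \<times> G)" using one by force
    then show "mat 1 \<in> (\<lambda>(g, h). g ** h) ` (G \<times> G)" by simp
  qed (use GH H' in auto)
  moreover have "matrix_inv ` G \<subseteq> G"
  proof (rule max)
    show "connected (matrix_inv ` G)"
      using H' GH by (intro connected_continuous_image conn
          continuous_on_subset[OF continuous_on_matrix_inv]) auto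
    have "matrix_inv (mat 1 :: real^'n^'n) = mat 1" by (rule matrix_inv_eqI) simp
    then show "mat 1 \<in> matrix_inv ` G" using one by (metis image_eqI)
  qed (use GH H' in auto)
  moreover have "closedin (top_of_set {A. invertible A}) G"
  proof (rule closedin_trans)
    show "closedin (top_of_set H) G" by (simp add: G closedin_connected_component)
    have "closed {A. \<forall>p\<in>P. p A = 0}"
    proof -
      have "closed {A. p A = 0}" if "p \<in> P" for p
        using P[OF that]
        by (intro closed_Collect_eq continuous_at_imp_continuous_on ballI
            continuous_real_polymonial_function) auto
      then have "closed (\<Inter>p\<in>P. {A. p A = 0})" by (intro closed_INT) auto
      moreover have "(\<Inter>p\<in>P. {A. p A = 0}) = {A. \<forall>p\<in>P. p A = 0}" by auto
      ultimately show ?thesis by simp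
    qed
    then show "closedin (top_of_set {A. invertible A}) H"
      unfolding closedin_closed by (intro exI conjI) (auto simp: HP GL_def)
  qed
  ultimately show ?thesis
    using one GH H' by unfold_locales (auto simp: image_subset_iff)
qed

section \<open>Discrete subgroups and fundamental domains\<close>

text \<open>Sums over a discrete group are written as integrals over its \<open>count_space\<close>,
  which treats finite and infinite groups alike.\<close>

lemma emeasure_UN_le_count_space:
  assumes I: "countable I" and X: "\<And>i. i \<in> I \<Longrightarrow> X i \<in> sets M"
  shows "emeasure M (\<Union>i\<in>I. X i) \<le> (\<integral>\<^sup>+i. emeasure M (X i) \<partial>count_space I)"
proof (cases "finite I")
  case True
  then show ?thesis
    using emeasure_subadditive_finite[of I X M] X
    by (simp add: nn_integral_count_space_finite image_subset_iff)
next
  case False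
  have bij: "bij_betw (from_nat_into I) UNIV I"
    by (rule bij_betw_from_nat_into[OF I False])
  then have img: "from_nat_into I ` UNIV = I" by (simp add: bij_betw_def)
  have "emeasure M (\<Union>i. X (from_nat_into I i)) \<le> (\<Sum>i. emeasure M (X (from_nat_into I i)))"
    using img X by (intro emeasure_subadditive_countably) blast
  also have "\<dots> = (\<integral>\<^sup>+i. emeasure M (X i) \<partial>count_space I)"
    using nn_integral_bij_count_space[OF bij, of "\<lambda>i. emeasure M (X i)"]
    by (simp add: nn_integral_count_space_nat)
  also have "(\<Union>i. X (from_nat_into I i)) = (\<Union>i\<in>I. X i)"
    using img by (metis image_image)
  finally show ?thesis .
qed

locale discrete_linear_group = linear_group G for G :: "(real^'n^'n) set" +
  fixes D :: "(real^'n^'n) set"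
  assumes D_subset: "D \<subseteq> G"
    and D_one [simp]: "mat 1 \<in> D"
    and D_mult [simp]: "g \<in> D \<Longrightarrow> h \<in> D \<Longrightarrow> g ** h \<in> D"
    and D_inv [simp]: "g \<in> D \<Longrightarrow> matrix_inv g \<in> D"
    and D_discrete: "discrete D"
begin

lemma D_in [simp]: "g \<in> D \<Longrightarrow> g \<in> G"
  using D_subset by auto

text \<open>For \<open>P\<close> inside \<open>G\<close>: distinct points of \<open>P\<close> lie in
  distinct cosets, i.e. the projection to the coset space is injective on \<open>P\<close>.\<close>

definition small :: "(real^'n^'n) set \<Rightarrow> bool" where
  "small P \<longleftrightarrow> (\<forall>\<gamma>\<in>D. \<forall>x\<in>P. \<gamma> ** x \<in> P \<longrightarrow> \<gamma> = mat 1)"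

text \<open>The preimage in \<open>G\<close> of the image of \<open>B\<close> in the coset space;
  for \<open>B\<close> inside \<open>G\<close> this is the product set D B.\<close>

definition sat :: "(real^'n^'n) set \<Rightarrow> (real^'n^'n) set" where
  "sat B = {x \<in> G. \<exists>\<gamma>\<in>D. \<gamma> ** x \<in> B}"

definition fundamental :: "(real^'n^'n) set \<Rightarrow> bool" where
  "fundamental F \<longleftrightarrow> F \<in> sets borel \<and> F \<subseteq> G \<and> small F \<and> sat F = G"

lemma small_mono: "small P \<Longrightarrow> Q \<subseteq> P \<Longrightarrow> small Q"
  unfolding small_def by blast

lemma smallD: "small P \<Longrightarrow> \<gamma> \<in> D \<Longrightarrow> x \<in> P \<Longrightarrow> \<gamma> ** x \<in> P \<Longrightarrow> \<gamma> = mat 1"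
  unfolding small_def by blast

lemma sat_subset: "sat B \<subseteq> G"
  by (auto simp: sat_def)

lemma sat_mono: "A \<subseteq> B \<Longrightarrow> sat A \<subseteq> sat B"
  by (auto simp: sat_def)

lemma subset_sat: "B \<subseteq> G \<Longrightarrow> B \<subseteq> sat B"
  by (auto simp: sat_def intro!: bexI[of _ "mat 1"])

lemma sat_translate:
  assumes "\<gamma> \<in> D"
  shows "\<gamma> ** x \<in> sat B \<longleftrightarrow> x \<in> sat B"
proof
  assume "\<gamma> ** x \<in> sat B"
  then obtain \<delta> where "\<gamma> ** x \<in> G" "\<delta> \<in> D" "\<delta> ** (\<gamma> ** x) \<in> B" by (auto simp: sat_def)
  then show "x \<in> sat B"
    using assms mult_in_iff(1)[of \<gamma> x] by (auto simp: sat_def matrix_mul_assoc intro: bexI[of _ "\<delta> ** \<gamma>"])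
next
  assume "x \<in> sat B"
  then obtain \<delta> where x: "x \<in> G" "\<delta> \<in> D" "\<delta> ** x \<in> B" by (auto simp: sat_def)
  then have "(\<delta> ** matrix_inv \<gamma>) ** (\<gamma> ** x) \<in> B"
    using assms by (simp flip: matrix_mul_assoc)
  then show "\<gamma> ** x \<in> sat B" using x assms by (auto simp: sat_def intro!: bexI[of _ "\<delta> ** matrix_inv \<gamma>"])
qed

lemma sat_sat: "sat (sat B) = sat B"
proof
  show "sat (sat B) \<subseteq> sat B"
  proof
    fix x assume "x \<in> sat (sat B)"
    then obtain \<gamma> where "\<gamma> \<in> D" "\<gamma> ** x \<in> sat B" by (auto simp: sat_def)
    then show "x \<in> sat B" by (simp add: sat_translate)
  qed
  show "sat B \<subseteq> sat (sat B)" by (intro subset_sat sat_subset)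
qed

lemma ball_one:
  obtains r where "r > 0" "\<And>\<gamma>. \<gamma> \<in> D \<Longrightarrow> norm (\<gamma> - mat 1) < r \<Longrightarrow> \<gamma> = mat 1"
proof -
  have "mat 1 isolated_in D" using D_discrete D_one by (rule discreteD)
  then obtain e where "e > 0" "\<forall>y\<in>D. dist (mat 1) y < e \<longrightarrow> y = mat 1"
    unfolding isolated_in_dist_Ex_iff by blast
  then show ?thesis by (intro that[of e]) (auto simp: dist_norm norm_minus_commute)
qed

text \<open>Otherwise there would be points x_k and \<gamma>_k x_k tending to \<open>g\<close> with
  nontrivial \<gamma>_k. Then \<gamma>_k = (\<gamma>_k x_k) x_k^-1 tends to 1, against
  discreteness.\<close>

lemma small_neighbourhood:
  assumes g: "g \<in> G"
  obtains U where "open U" "g \<in> U" "small (U \<inter> G)"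
proof (rule ccontr)
  assume no: "\<not> thesis"
  have "\<exists>\<gamma> x. \<gamma> \<in> D \<and> \<gamma> \<noteq> mat 1 \<and> x \<in> ball g (inverse (real (Suc k))) \<inter> G \<and>
      \<gamma> ** x \<in> ball g (inverse (real (Suc k)))" for k
  proof -
    have "\<not> small (ball g (inverse (real (Suc k))) \<inter> G)"
      using no that[of "ball g (inverse (real (Suc k)))"] by auto
    then show ?thesis unfolding small_def by blast
  qed
  then obtain \<gamma> x where *: "\<And>k. \<gamma> k \<in> D" "\<And>k. \<gamma> k \<noteq> mat 1" "\<And>k. x k \<in> G"
    "\<And>k. dist g (x k) < inverse (real (Suc k))" "\<And>k. dist g (\<gamma> k ** x k) < inverse (real (Suc k))"
    unfolding mem_ball Int_iff by metis
  have lim: "y \<longlonglongrightarrow> g" if "\<And>k. dist g (y k) < inverse (real (Suc k))" for y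
  proof -
    have "(\<lambda>k. dist (y k) g) \<longlonglongrightarrow> 0"
      by (rule tendsto_sandwich[OF _ _ tendsto_const LIMSEQ_inverse_real_of_nat])
        (use that in \<open>simp_all add: dist_commute less_imp_le\<close>)
    then show ?thesis by (simp add: tendsto_dist_iff[of y])
  qed
  have "(\<lambda>k. (\<gamma> k ** x k) ** matrix_inv (x k)) \<longlonglongrightarrow> g ** matrix_inv g"
    by (rule tendsto_matrix_mult[OF lim[OF *(5)] tendsto_matrix_inv[OF lim[OF *(4)] invertible[OF g]]])
  moreover have "(\<gamma> k ** x k) ** matrix_inv (x k) = \<gamma> k" for k using *(3) by simp
  ultimately have "\<gamma> \<longlonglongrightarrow> mat 1" using g by simp
  obtain r where "r > 0" and "\<And>\<gamma>. \<gamma> \<in> D \<Longrightarrow> norm (\<gamma> - mat 1) < r \<Longrightarrow> \<gamma> = mat 1"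
    using ball_one by blast
  then have "\<gamma> k = mat 1" if "norm (\<gamma> k - mat 1) < r" for k using *(1) that by blast
  moreover obtain k where "norm (\<gamma> k - mat 1) < r"
    using LIMSEQ_D[OF \<open>\<gamma> \<longlonglongrightarrow> mat 1\<close> \<open>r > 0\<close>] by blast
  ultimately show False using *(2) by blast
qed

lemma small_cover:
  "\<exists>U :: nat \<Rightarrow> (real^'n^'n) set. (\<forall>i. open (U i) \<and> small (U i \<inter> G)) \<and> G \<subseteq> (\<Union>i. U i)"
proof -
  define \<U> where "\<U> = {U. open U \<and> small (U \<inter> G)}"
  have "\<And>S. S \<in> \<U> \<Longrightarrow> open S" by (auto simp: \<U>_def)
  then obtain \<V> where V: "\<V> \<subseteq> \<U>" "countable \<V>" "\<Union>\<V> = \<Union>\<U>" by (rule Lindelof)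
  have "G \<subseteq> \<Union>\<U>"
  proof
    fix g assume "g \<in> G"
    then obtain U where "open U" "g \<in> U" "small (U \<inter> G)" by (rule small_neighbourhood)
    then show "g \<in> \<Union>\<U>" by (auto simp: \<U>_def)
  qed
  then have ne: "\<V> \<noteq> {}" using V(3) one_in by (metis Union_empty empty_iff subsetD)
  then have r: "range (from_nat_into \<V>) = \<V>" using V by simp
  then have "from_nat_into \<V> i \<in> \<U>" for i using V by blast
  then show ?thesis
    using r V \<open>G \<subseteq> \<Union>\<U>\<close> by (intro exI[of _ "from_nat_into \<V>"]) (auto simp: \<U>_def)
qed

text \<open>For x and y in \<open>D\<close> the element y x^-1 of \<open>D\<close> moves x to y, so
  a small set contains at most one element of \<open>D\<close>; countably many small open sets cover
  \<open>G\<close>.\<close>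

lemma countable_D: "countable D"
proof -
  obtain U :: "nat \<Rightarrow> (real^'n^'n) set"
    where U: "\<And>i. open (U i)" "\<And>i. small (U i \<inter> G)" "G \<subseteq> (\<Union>i. U i)"
    using small_cover by blast
  have "countable (U i \<inter> D)" for i
  proof -
    have "x = y" if "x \<in> U i \<inter> D" "y \<in> U i \<inter> D" for x y
    proof -
      have "y ** matrix_inv x = mat 1"
        using that by (intro smallD[OF U(2), of _ x i]) auto
      then show ?thesis using that by (metis Int_iff D_in cancel(6) matrix_mul_lid)
    qed
    then have "U i \<inter> D \<subseteq> {SOME x. x \<in> U i \<inter> D}" by (metis singletonI someI subsetI)
    then have "finite (U i \<inter> D)" by (rule finite_subset) simp
    then show ?thesis by (rule countable_finite)
  qed
  then have "countable (\<Union>i. U i \<inter> D)" by (intro countable_UN) auto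
  moreover have "D \<subseteq> (\<Union>i. U i \<inter> D)" using U(3) D_subset by blast
  ultimately show ?thesis by (metis countable_subset)
qed

lemma borel_sat [measurable (raw)]:
  assumes [measurable]: "B \<in> sets borel"
  shows "sat B \<in> sets borel"
proof -
  have "sat B = (\<Union>\<gamma>\<in>D. {x \<in> space borel. x \<in> G \<and> \<gamma> ** x \<in> B})" by (auto simp: sat_def)
  also have "\<dots> \<in> sets borel" by (rule sets.countable_UN''[OF countable_D]) measurable
  finally show ?thesis .
qed

text \<open>A greedy choice along a countable cover by small sets: a coset is represented in the
  first \<open>U i\<close> that it meets and in no other, and smallness makes the representative
  unique.\<close>

lemma ex_fundamental: "\<exists>F. fundamental F"
proof -
  obtain U :: "nat \<Rightarrow> (real^'n^'n) set"
    where U: "\<And>i. open (U i)" "\<And>i. small (U i \<inter> G)" "G \<subseteq> (\<Union>i. U i)"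
    using small_cover by blast
  define F where "F = (\<Union>i. U i \<inter> G - (\<Union>j<i. sat (U j \<inter> G)))"
  have "F \<in> sets borel"
    unfolding F_def using U(1) by (intro sets.countable_UN sets.Diff sets.finite_UN borel_sat) auto
  moreover have "F \<subseteq> G" by (auto simp: F_def)
  moreover have "small F"
    unfolding small_def
  proof (intro ballI impI)
    fix \<gamma> x assume \<gamma>: "\<gamma> \<in> D" and x: "x \<in> F" "\<gamma> ** x \<in> F"
    then obtain i j where i: "x \<in> U i \<inter> G" "x \<notin> (\<Union>j<i. sat (U j \<inter> G))"
      and j: "\<gamma> ** x \<in> U j \<inter> G" "\<gamma> ** x \<notin> (\<Union>k<j. sat (U k \<inter> G))"
      by (auto simp: F_def)
    have "x \<in> sat (U i \<inter> G)" "\<gamma> ** x \<in> sat (U j \<inter> G)"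
      using i j subset_sat[of "U _ \<inter> G"] by blast+
    then have "\<not> i < j" "\<not> j < i" using i j sat_translate[OF \<gamma>] by auto
    then have "i = j" by simp
    then show "\<gamma> = mat 1" using smallD[OF U(2) \<gamma>] i j by blast
  qed
  moreover have "sat F = G"
  proof
    show "G \<subseteq> sat F"
    proof
      fix x assume x: "x \<in> G"
      define i where "i = (LEAST i. x \<in> sat (U i \<inter> G))"
      have "\<exists>i. x \<in> sat (U i \<inter> G)" using U(3) x subset_sat[of "U _ \<inter> G"] by blast
      then have i: "x \<in> sat (U i \<inter> G)" and least: "\<And>j. j < i \<Longrightarrow> x \<notin> sat (U j \<inter> G)"
        unfolding i_def by (auto intro: LeastI_ex dest: not_less_Least)
      from i obtain \<gamma> where \<gamma>: "\<gamma> \<in> D" "\<gamma> ** x \<in> U i \<inter> G" by (auto simp: sat_def)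
      then have "\<gamma> ** x \<in> F" using least unfolding F_def by (auto simp: sat_translate)
      then show "x \<in> sat F" using x \<gamma> by (auto simp: sat_def)
    qed
  qed (rule sat_subset)
  ultimately show ?thesis unfolding fundamental_def by blast
qed

text \<open>The set is F g^-1. Right translations commute with the left action of \<open>D\<close>
  and so permute the fundamental sets.\<close>

lemma fundamental_translate:
  assumes F: "fundamental F" and g: "g \<in> G"
  shows "fundamental {x \<in> G. x ** g \<in> F}"
proof -
  have [measurable]: "F \<in> sets borel" and sm: "small F" and sat: "sat F = G" "F \<subseteq> G"
    using F by (auto simp: fundamental_def)
  have "{x \<in> space borel. x \<in> G \<and> x ** g \<in> F} \<in> sets borel" by measurable
  moreover have "small {x \<in> G. x ** g \<in> F}"
    unfolding small_def using smallD[OF sm] by (auto simp add: matrix_mul_assoc)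
  moreover have "G \<subseteq> sat {x \<in> G. x ** g \<in> F}"
  proof
    fix x assume x: "x \<in> G"
    then have "x ** g \<in> sat F" using sat g by simp
    then obtain \<gamma> where "\<gamma> \<in> D" "\<gamma> ** (x ** g) \<in> F" by (auto simp: sat_def)
    then show "x \<in> sat {x \<in> G. x ** g \<in> F}"
      using x by (auto simp: sat_def matrix_mul_assoc)
  qed
  ultimately show ?thesis
    unfolding fundamental_def using sat_subset by auto
qed

end

section \<open>Haar measures and the measures they induce on cosets\<close>

text \<open>The measure is placed on all matrices, with the complement of \<open>G\<close> null, so
  that measurability means \<open>borel\<close> throughout. Invariance is phrased with preimages
  under translation, which are Borel because multiplication is.\<close>

locale right_haar = linear_group G for G :: "(real^'n^'n) set" +
  fixes \<mu> :: "(real^'n^'n) measure"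
  assumes sets_\<mu> [measurable_cong, simp]: "sets \<mu> = sets borel"
    and null_outside: "emeasure \<mu> (- G) = 0"
    and right_invariant: "g \<in> G \<Longrightarrow> B \<in> sets borel \<Longrightarrow> B \<subseteq> G \<Longrightarrow>
      emeasure \<mu> {x \<in> G. x ** g \<in> B} = emeasure \<mu> B"
    and finite_bounded: "emeasure \<mu> (bounded_part k) < \<infinity>"
    and nonzero: "emeasure \<mu> G \<noteq> 0"
begin

lemma space_\<mu> [simp]: "space \<mu> = UNIV"
  using sets_eq_imp_space_eq[OF sets_\<mu>] by simp

lemma AE_in: "AE x in \<mu>. x \<in> G"
  using null_outside by (intro AE_I[of _ _ "- G"]) auto

end

text \<open>Left invariance is required under \<open>D\<close> only. This is what counting points of
  cosets yields before unimodularity is known, and it lets \<open>\<mu>\<close> induce a measure on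
  the cosets.\<close>

locale haar_discrete = right_haar G \<mu> + discrete_linear_group G D
  for G :: "(real^'n^'n) set" and \<mu> and D +
  assumes left_D: "\<gamma> \<in> D \<Longrightarrow> B \<in> sets borel \<Longrightarrow> B \<subseteq> G \<Longrightarrow>
      emeasure \<mu> {x \<in> G. \<gamma> ** x \<in> B} = emeasure \<mu> B"
begin

text \<open>Unfolding: \<open>B\<close> is the disjoint union over \<gamma> of its parts in
  \<gamma>^-1 F, and left multiplication by \<gamma> moves such a part onto F \<inter> \<gamma> B
  without changing its measure.\<close>

lemma emeasure_fundamental_sat_aux:
  assumes F: "fundamental F" and B [measurable]: "B \<in> sets borel" and BG: "B \<subseteq> G"
  shows "emeasure \<mu> B = (\<integral>\<^sup>+\<gamma>. emeasure \<mu> {y \<in> F. matrix_inv \<gamma> ** y \<in> B} \<partial>count_space D)"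
proof -
  have F' [measurable]: "F \<in> sets borel" and sm: "small F" and sat: "sat F = G" "F \<subseteq> G"
    using F by (auto simp: fundamental_def)
  have m: "{x \<in> B. \<gamma> ** x \<in> F} \<in> sets borel" "{y \<in> F. matrix_inv \<gamma> ** y \<in> B} \<in> sets borel" for \<gamma>
  proof -
    have "{x \<in> space borel. x \<in> B \<and> \<gamma> ** x \<in> F} \<in> sets borel"
      "{x \<in> space borel. x \<in> F \<and> matrix_inv \<gamma> ** x \<in> B} \<in> sets borel" by measurable
    then show "{x \<in> B. \<gamma> ** x \<in> F} \<in> sets borel" "{y \<in> F. matrix_inv \<gamma> ** y \<in> B} \<in> sets borel" by auto
  qed
  have "B = (\<Union>\<gamma>\<in>D. {x \<in> B. \<gamma> ** x \<in> F})"
  proof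
    show "B \<subseteq> (\<Union>\<gamma>\<in>D. {x \<in> B. \<gamma> ** x \<in> F})"
      using BG sat by (auto simp: sat_def)
  qed auto
  moreover have "disjoint_family_on (\<lambda>\<gamma>. {x \<in> B. \<gamma> ** x \<in> F}) D"
    unfolding disjoint_family_on_def
  proof (intro ballI impI equals0I)
    fix \<gamma> \<delta> x assume *: "\<gamma> \<in> D" "\<delta> \<in> D" "\<gamma> \<noteq> \<delta>" "x \<in> {x \<in> B. \<gamma> ** x \<in> F} \<inter> {x \<in> B. \<delta> ** x \<in> F}"
    then have "(\<delta> ** matrix_inv \<gamma>) ** (\<gamma> ** x) \<in> F" by (simp flip: matrix_mul_assoc)
    then have "\<delta> ** matrix_inv \<gamma> = mat 1" using * by (intro smallD[OF sm, of _ "\<gamma> ** x"]) auto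
    then show False using * by (metis D_in cancel(6) matrix_mul_lid)
  qed
  ultimately have "emeasure \<mu> B = (\<integral>\<^sup>+\<gamma>. emeasure \<mu> {x \<in> B. \<gamma> ** x \<in> F} \<partial>count_space D)"
    using emeasure_UN_countable[of D "\<lambda>\<gamma>. {x \<in> B. \<gamma> ** x \<in> F}" \<mu>] countable_D m by simp
  also have "\<dots> = (\<integral>\<^sup>+\<gamma>. emeasure \<mu> {y \<in> F. matrix_inv \<gamma> ** y \<in> B} \<partial>count_space D)"
  proof (rule nn_integral_cong)
    fix \<gamma> assume "\<gamma> \<in> space (count_space D)"
    then have \<gamma>: "\<gamma> \<in> D" by simp
    have "{x \<in> B. \<gamma> ** x \<in> F} = {x \<in> G. \<gamma> ** x \<in> {y \<in> F. matrix_inv \<gamma> ** y \<in> B}}"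
      using \<gamma> BG by auto
    then show "emeasure \<mu> {x \<in> B. \<gamma> ** x \<in> F} = emeasure \<mu> {y \<in> F. matrix_inv \<gamma> ** y \<in> B}"
      using left_D[OF \<gamma> m(2), of \<gamma>] sat by auto
  qed
  finally show ?thesis .
qed

lemma fundamental_Int_sat:
  assumes "F \<subseteq> G"
  shows "F \<inter> sat B = (\<Union>\<gamma>\<in>D. {y \<in> F. matrix_inv \<gamma> ** y \<in> B})"
proof
  show "F \<inter> sat B \<subseteq> (\<Union>\<gamma>\<in>D. {y \<in> F. matrix_inv \<gamma> ** y \<in> B})"
  proof
    fix y assume "y \<in> F \<inter> sat B"
    then obtain \<gamma> where "\<gamma> \<in> D" "\<gamma> ** y \<in> B" "y \<in> F" by (auto simp: sat_def)
    then show "y \<in> (\<Union>\<gamma>\<in>D. {y \<in> F. matrix_inv \<gamma> ** y \<in> B})"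
      by (intro UN_I[of "matrix_inv \<gamma>"]) auto
  qed
qed (use assms in \<open>auto simp: sat_def\<close>)

text \<open>The sets F \<inter> \<gamma> B of the unfolding cover \<open>F \<inter> sat B\<close>;
  overlaps can only increase the sum.\<close>

lemma emeasure_fundamental_sat_le:
  assumes F: "fundamental F" and B [measurable]: "B \<in> sets borel" and BG: "B \<subseteq> G"
  shows "emeasure \<mu> (F \<inter> sat B) \<le> emeasure \<mu> B"
proof -
  have [measurable]: "F \<in> sets borel" and FG: "F \<subseteq> G"
    using F by (auto simp: fundamental_def)
  have "{x \<in> space borel. x \<in> F \<and> matrix_inv \<gamma> ** x \<in> B} \<in> sets borel" for \<gamma> by measurable
  then show ?thesis
    unfolding emeasure_fundamental_sat_aux[OF assms] fundamental_Int_sat[OF FG]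
    by (intro emeasure_UN_le_count_space countable_D) auto
qed

text \<open>Smallness of \<open>B\<close> makes its translates \<gamma> B disjoint, so the sum in
  the unfolding counts nothing twice.\<close>

lemma emeasure_fundamental_sat:
  assumes F: "fundamental F" and B [measurable]: "B \<in> sets borel" and BG: "B \<subseteq> G" and sm: "small B"
  shows "emeasure \<mu> (F \<inter> sat B) = emeasure \<mu> B"
proof -
  have [measurable]: "F \<in> sets borel" and FG: "F \<subseteq> G"
    using F by (auto simp: fundamental_def)
  have "{x \<in> space borel. x \<in> F \<and> matrix_inv \<gamma> ** x \<in> B} \<in> sets borel" for \<gamma> by measurable
  moreover have "disjoint_family_on (\<lambda>\<gamma>. {y \<in> F. matrix_inv \<gamma> ** y \<in> B}) D"
    unfolding disjoint_family_on_def
  proof (intro ballI impI equals0I)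
    fix \<gamma> \<delta> y
    assume *: "\<gamma> \<in> D" "\<delta> \<in> D" "\<gamma> \<noteq> \<delta>" "y \<in> {y \<in> F. matrix_inv \<gamma> ** y \<in> B} \<inter> {y \<in> F. matrix_inv \<delta> ** y \<in> B}"
    then have "(matrix_inv \<delta> ** \<gamma>) ** (matrix_inv \<gamma> ** y) \<in> B" by (simp flip: matrix_mul_assoc)
    then have "matrix_inv \<delta> ** \<gamma> = mat 1" using * by (intro smallD[OF sm, of _ "matrix_inv \<gamma> ** y"]) auto
    then show False using * by (metis D_in cancel(4) matrix_mul_rid)
  qed
  ultimately show ?thesis
    unfolding emeasure_fundamental_sat_aux[OF F B BG] fundamental_Int_sat[OF FG]
    by (intro emeasure_UN_countable countable_D) auto
qed

text \<open>The induced measure of a set of cosets does not depend on the fundamental set used to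
  compute it. The reason is that \<open>A\<close> is the saturation of the small set
  \<open>F' \<inter> A\<close>, whose measure can be computed in \<open>F\<close>.\<close>

lemma emeasure_fundamental_eq:
  assumes F: "fundamental F" and F': "fundamental F'" and A [measurable]: "A \<in> sets borel" and sat: "sat A = A"
  shows "emeasure \<mu> (F \<inter> A) = emeasure \<mu> (F' \<inter> A)"
proof -
  have [measurable]: "F' \<in> sets borel" and sm: "small F'" and FG: "F' \<subseteq> G" "sat F' = G"
    using F' by (auto simp: fundamental_def)
  have "A \<subseteq> sat (F' \<inter> A)"
  proof
    fix x assume x: "x \<in> A"
    then have "x \<in> sat F'" using FG sat sat_subset[of A] by auto
    then obtain \<gamma> where "\<gamma> \<in> D" "\<gamma> ** x \<in> F'" "x \<in> G" by (auto simp: sat_def)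
    moreover from this have "\<gamma> ** x \<in> A" using sat_translate[of \<gamma> x A] sat x by simp
    ultimately show "x \<in> sat (F' \<inter> A)" by (auto simp: sat_def)
  qed
  moreover have "sat (F' \<inter> A) \<subseteq> A" using sat_mono[of "F' \<inter> A" A] sat by auto
  ultimately have "sat (F' \<inter> A) = A" by simp
  then show ?thesis
    using emeasure_fundamental_sat[OF F, of "F' \<inter> A"] small_mono[OF sm] FG by auto
qed

text \<open>Right translation by \<open>g\<close> turns the set on the left into F g \<inter> A, and
  F g is another fundamental set. Thus the induced measure on cosets is invariant under right
  translation.\<close>

lemma emeasure_fundamental_translate:
  assumes F: "fundamental F" and A [measurable]: "A \<in> sets borel" and sat: "sat A = A" and g: "g \<in> G"
  shows "emeasure \<mu> (F \<inter> {x \<in> G. x ** g \<in> A}) = emeasure \<mu> (F \<inter> A)"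
proof -
  have [measurable]: "F \<in> sets borel" and FG: "F \<subseteq> G"
    using F by (auto simp: fundamental_def)
  have AG: "A \<subseteq> G" using sat sat_subset by metis
  have "{x \<in> space borel. x \<in> F \<and> x \<in> G \<and> x ** g \<in> A} \<in> sets borel" by measurable
  then have "F \<inter> {x \<in> G. x ** g \<in> A} \<in> sets borel" by (simp add: Int_def)
  then have "emeasure \<mu> (F \<inter> {x \<in> G. x ** g \<in> A}) =
      emeasure \<mu> {x \<in> G. x ** matrix_inv g \<in> F \<inter> {x \<in> G. x ** g \<in> A}}"
    using g FG by (subst right_invariant) auto
  also have "{x \<in> G. x ** matrix_inv g \<in> F \<inter> {x \<in> G. x ** g \<in> A}} = {x \<in> G. x ** matrix_inv g \<in> F} \<inter> A"
    using g AG by auto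
  also have "emeasure \<mu> \<dots> = emeasure \<mu> (F \<inter> A)"
    using g by (intro emeasure_fundamental_eq fundamental_translate F A sat) auto
  finally show ?thesis .
qed

end

section \<open>Unimodularity\<close>

context right_haar
begin

lemma sigma_finite_\<mu>: "sigma_finite_measure \<mu>"
proof
  show "\<exists>A. countable A \<and> A \<subseteq> sets \<mu> \<and> \<Union>A = space \<mu> \<and> (\<forall>a\<in>A. emeasure \<mu> a \<noteq> \<infinity>)"
  proof (intro exI[of _ "insert (- G) (range bounded_part)"] conjI ballI)
    show "\<Union>(insert (- G) (range bounded_part)) = space \<mu>"
      using Union_bounded_part by auto
    fix a assume "a \<in> insert (- G) (range bounded_part)"
    then show "emeasure \<mu> a \<noteq> \<infinity>"
      using null_outside finite_bounded by (auto simp: less_top)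
  qed (auto simp: borel_comp)
qed

lemma emeasure_Int_G: "B \<in> sets borel \<Longrightarrow> emeasure \<mu> (B \<inter> G) = emeasure \<mu> B"
  using AE_in by (intro emeasure_eq_AE) auto

lemma distr_eqI:
  assumes f [measurable]: "f \<in> borel_measurable borel" and fG: "\<And>x. x \<in> G \<Longrightarrow> f x \<in> G"
    and inv: "\<And>B. B \<in> sets borel \<Longrightarrow> B \<subseteq> G \<Longrightarrow> emeasure \<mu> {x \<in> G. f x \<in> B} = emeasure \<mu> B"
  shows "distr \<mu> borel f = \<mu>"
proof (rule measure_eqI)
  fix A assume "A \<in> sets (distr \<mu> borel f)"
  then have A [measurable]: "A \<in> sets borel" by simp
  have "emeasure (distr \<mu> borel f) A = emeasure \<mu> (f -` A \<inter> space \<mu>)"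
    by (rule emeasure_distr) simp_all
  also have "\<dots> = emeasure \<mu> (f -` A \<inter> space \<mu> \<inter> G)"
    by (rule emeasure_Int_G[symmetric]) (use measurable_sets[OF f A] in simp)
  also have "f -` A \<inter> space \<mu> \<inter> G = {x \<in> G. f x \<in> A \<inter> G}" using fG by auto
  also have "emeasure \<mu> \<dots> = emeasure \<mu> A"
    using inv[of "A \<inter> G"] emeasure_Int_G[OF A] A by simp
  finally show "emeasure (distr \<mu> borel f) A = emeasure \<mu> A" .
qed simp

lemma distr_right: "g \<in> G \<Longrightarrow> distr \<mu> borel (\<lambda>x. x ** g) = \<mu>"
  by (rule distr_eqI) (simp_all add: right_invariant)

lemma nn_integral_right:
  assumes "g \<in> G" "f \<in> borel_measurable borel"
  shows "(\<integral>\<^sup>+x. f (x ** g) \<partial>\<mu>) = (\<integral>\<^sup>+x. f x \<partial>\<mu>)"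
  using nn_integral_distr[of "\<lambda>x. x ** g" \<mu> borel f] assms by (simp add: distr_right)

text \<open>For \<open>z\<close> in \<open>G\<close> and \<open>B\<close> inside \<open>G\<close>
  this is \<mu> (z B). Classically it equals \<mu> B times a modular function of \<open>z\<close>,
  and unimodularity says that it is constant in \<open>z\<close>.\<close>

definition translate_measure :: "(real^'n^'n) set \<Rightarrow> real^'n^'n \<Rightarrow> ennreal" where
  "translate_measure B z = emeasure \<mu> {x \<in> G. matrix_inv z ** x \<in> B}"

lemma translate_measure_eq:
  assumes [measurable]: "B \<in> sets borel"
  shows "translate_measure B z = (\<integral>\<^sup>+x. indicator B (matrix_inv z ** x) \<partial>\<mu>)"
proof -
  have m: "{x \<in> space borel. matrix_inv z ** x \<in> B} \<in> sets borel" by measurable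
  have "translate_measure B z = emeasure \<mu> {x. matrix_inv z ** x \<in> B}"
    using emeasure_Int_G[of "{x. matrix_inv z ** x \<in> B}"] m
    by (simp add: translate_measure_def Int_def conj_commute)
  also have "\<dots> = (\<integral>\<^sup>+x. indicator {x. matrix_inv z ** x \<in> B} x \<partial>\<mu>)"
    using m by (simp add: nn_integral_indicator)
  finally show ?thesis by (simp add: indicator_def)
qed

lemma borel_measurable_translate_measure [measurable]:
  assumes [measurable]: "B \<in> sets borel"
  shows "translate_measure B \<in> borel_measurable borel"
proof -
  interpret sigma_finite_measure \<mu> by (rule sigma_finite_\<mu>)
  have "(\<lambda>z. \<integral>\<^sup>+x. indicator B (matrix_inv z ** x) \<partial>\<mu>) \<in> borel_measurable borel"
    by measurable
  moreover have "translate_measure B = (\<lambda>z. \<integral>\<^sup>+x. indicator B (matrix_inv z ** x) \<partial>\<mu>)"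
    by (rule ext) (rule translate_measure_eq[OF assms])
  ultimately show ?thesis by simp
qed

text \<open>The left-hand side is the double integral of 1_A(y^-1) 1_B(y x). Replacing y by y x^-1
  gives 1_A(x y^-1) 1_B(y), and integrating over x first separates the two factors. Both moves are
  right translations.\<close>

lemma nn_integral_translate_measure:
  assumes A [measurable]: "A \<in> sets borel" and B [measurable]: "B \<in> sets borel"
  shows "(\<integral>\<^sup>+y. indicator A (matrix_inv y) * translate_measure B (matrix_inv y) \<partial>\<mu>)
    = emeasure \<mu> A * emeasure \<mu> B"
proof -
  interpret sigma_finite_measure \<mu> by (rule sigma_finite_\<mu>)
  interpret pair_sigma_finite \<mu> \<mu> ..
  have "(\<integral>\<^sup>+y. indicator A (matrix_inv y) * translate_measure B (matrix_inv y) \<partial>\<mu>)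
      = (\<integral>\<^sup>+y. (\<integral>\<^sup>+x. indicator A (matrix_inv y) * indicator B (y ** x) \<partial>\<mu>) \<partial>\<mu>)"
  proof (rule nn_integral_cong_AE)
    show "AE y in \<mu>. indicator A (matrix_inv y) * translate_measure B (matrix_inv y) =
        (\<integral>\<^sup>+x. indicator A (matrix_inv y) * indicator B (y ** x) \<partial>\<mu>)"
      using AE_in by eventually_elim (simp add: translate_measure_eq nn_integral_cmult)
  qed
  also have "\<dots> = (\<integral>\<^sup>+x. (\<integral>\<^sup>+y. indicator A (matrix_inv y) * indicator B (y ** x) \<partial>\<mu>) \<partial>\<mu>)"
    by (rule Fubini') measurable
  also have "\<dots> = (\<integral>\<^sup>+x. (\<integral>\<^sup>+y. indicator A (x ** matrix_inv y) * indicator B y \<partial>\<mu>) \<partial>\<mu>)"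
  proof (rule nn_integral_cong_AE)
    show "AE x in \<mu>. (\<integral>\<^sup>+y. indicator A (matrix_inv y) * indicator B (y ** x) \<partial>\<mu>) =
        (\<integral>\<^sup>+y. (indicator A (x ** matrix_inv y) * indicator B y :: ennreal) \<partial>\<mu>)"
      using AE_in
    proof eventually_elim
      fix x assume x: "x \<in> G"
      have "(\<integral>\<^sup>+y. (indicator A (matrix_inv y) * indicator B (y ** x) :: ennreal) \<partial>\<mu>) =
          (\<integral>\<^sup>+y. indicator A (matrix_inv (y ** matrix_inv x)) * indicator B ((y ** matrix_inv x) ** x) \<partial>\<mu>)"
        using x by (intro nn_integral_right[symmetric]) auto
      also have "\<dots> = (\<integral>\<^sup>+y. indicator A (x ** matrix_inv y) * indicator B y \<partial>\<mu>)"
        using AE_in x by (intro nn_integral_cong_AE) (auto simp: inv_mult elim!: eventually_mono)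
      finally show "(\<integral>\<^sup>+y. indicator A (matrix_inv y) * indicator B (y ** x) \<partial>\<mu>) =
        (\<integral>\<^sup>+y. (indicator A (x ** matrix_inv y) * indicator B y :: ennreal) \<partial>\<mu>)" .
    qed
  qed
  also have "\<dots> = (\<integral>\<^sup>+y. (\<integral>\<^sup>+x. indicator A (x ** matrix_inv y) * indicator B y \<partial>\<mu>) \<partial>\<mu>)"
    by (rule Fubini') measurable
  also have "\<dots> = (\<integral>\<^sup>+y. emeasure \<mu> A * indicator B y \<partial>\<mu>)"
  proof (rule nn_integral_cong_AE)
    show "AE y in \<mu>. (\<integral>\<^sup>+x. indicator A (x ** matrix_inv y) * indicator B y \<partial>\<mu>) =
        emeasure \<mu> A * indicator B y"
      using AE_in
      by eventually_elim (simp add: nn_integral_multc nn_integral_right[of _ "indicator A"])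
  qed
  also have "\<dots> = emeasure \<mu> A * emeasure \<mu> B"
    by (simp add: nn_integral_cmult)
  finally show ?thesis .
qed

text \<open>If \<open>\<mu> (g B) > \<mu> B\<close> then the translates of \<open>B\<close> satisfy \<open>\<mu> (x g B) > \<mu> (x B)\<close> for almost all
  \<open>x\<close>, because averaging over \<open>x\<inverse> \<in> A\<close> multiplies both measures by \<open>\<mu> A\<close>.\<close>

lemma AE_translate_measure_less:
  assumes B [measurable]: "B \<in> sets borel" and g: "g \<in> G"
    and less: "emeasure \<mu> B < translate_measure B g"
  shows "AE x in \<mu>. translate_measure B x < translate_measure B (x ** g)"
proof -
  define B' where "B' = {x \<in> G. matrix_inv g ** x \<in> B}"
  have "{x \<in> space borel. x \<in> G \<and> matrix_inv g ** x \<in> B} \<in> sets borel" by measurable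
  then have [measurable]: "B' \<in> sets borel" by (simp add: B'_def)
  have tr: "translate_measure B' x = translate_measure B (x ** g)" if "x \<in> G" for x
  proof -
    have "{y \<in> G. matrix_inv x ** y \<in> B'} = {y \<in> G. matrix_inv (x ** g) ** y \<in> B}"
      using that g by (auto simp: B'_def inv_mult matrix_mul_assoc)
    then show ?thesis by (simp add: translate_measure_def)
  qed
  \<comment> \<open>The exceptional points, cut to finite measure so that a strict inequality
    survives multiplication by \<open>emeasure \<mu> (A k)\<close>. The exceptional set itself
    serves as the averaging set: unless it is null, averaging over it gives \<mu> (g B) \<le> \<mu>
    B.\<close>
  define A where "A k = {x \<in> bounded_part k. translate_measure B' x \<le> translate_measure B x}" for k
  have mA: "A k \<in> sets borel" for k
  proof -
    have "{x \<in> space borel. x \<in> bounded_part k \<and> translate_measure B' x \<le> translate_measure B x} \<in> sets borel"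
      by measurable
    then show ?thesis by (simp add: A_def)
  qed
  have "emeasure \<mu> (A k) = 0" for k
  proof (rule ccontr)
    assume pos: "emeasure \<mu> (A k) \<noteq> 0"
    note [measurable] = mA
    have "emeasure \<mu> (A k) \<le> emeasure \<mu> (bounded_part k)"
      by (rule emeasure_mono) (auto simp: A_def)
    then have fin: "emeasure \<mu> (A k) < \<infinity>" using finite_bounded[of k] by order
    have "emeasure \<mu> (A k) * emeasure \<mu> B' \<le> emeasure \<mu> (A k) * emeasure \<mu> B"
      unfolding nn_integral_translate_measure[OF mA \<open>B' \<in> sets borel\<close>, symmetric]
        nn_integral_translate_measure[OF mA \<open>B \<in> sets borel\<close>, symmetric]
      by (rule nn_integral_mono) (auto simp: A_def indicator_def)
    moreover have "emeasure \<mu> B < emeasure \<mu> B'"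
      using less by (simp add: B'_def translate_measure_def)
    ultimately show False
      using pos fin ennreal_mult_strict_left_mono[of "emeasure \<mu> B" "emeasure \<mu> B'" "emeasure \<mu> (A k)"]
      by (auto simp: zero_less_iff_neq_zero)
  qed
  then have "AE x in \<mu>. x \<notin> A k" for k
    using mA by (intro AE_not_in null_setsI) auto
  then have "AE x in \<mu>. \<forall>k. x \<notin> A k" by (simp add: AE_all_countable)
  with AE_in show ?thesis
  proof eventually_elim
    fix x assume x: "x \<in> G" "\<forall>k. x \<notin> A k"
    then obtain k where "x \<in> bounded_part k" using Union_bounded_part by blast
    then show "translate_measure B x < translate_measure B (x ** g)"
      using x tr[of x] by (auto simp: A_def not_le)
  qed
qed

end

text \<open>Unfolding \<open>G\<close> itself bounds its measure by a sum of measures of subsets of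
  \<open>F\<close>, so a null \<open>F\<close> would make \<open>G\<close> null.\<close>

lemma (in haar_discrete) fundamental_nonnull:
  assumes F: "fundamental F"
  shows "emeasure \<mu> F \<noteq> 0"
proof
  assume 0: "emeasure \<mu> F = 0"
  have F': "F \<in> sets \<mu>" using F by (simp add: fundamental_def)
  have "emeasure \<mu> {y \<in> F. matrix_inv \<gamma> ** y \<in> G} \<le> emeasure \<mu> F" for \<gamma>
    by (rule emeasure_mono) (use F' in auto)
  then have "emeasure \<mu> {y \<in> F. matrix_inv \<gamma> ** y \<in> G} = 0" for \<gamma>
    by (simp add: 0)
  then have "emeasure \<mu> G = 0" using emeasure_fundamental_sat_aux[OF F, of G] by simp
  then show False using nonzero by simp
qed

text \<open>Otherwise \<open>x \<mapsto> \<mu> (x B)\<close>, a function on the finite measure space of cosets, would strictly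
  increase almost everywhere under the measure preserving translation by \<open>g\<close>.\<close>

lemma (in haar_discrete) translate_measure_le:
  assumes F: "fundamental F" and fin: "emeasure \<mu> F < \<infinity>"
    and B [measurable]: "B \<in> sets borel" and BG: "B \<subseteq> G" and g: "g \<in> G"
  shows "translate_measure B g \<le> emeasure \<mu> B"
proof (rule ccontr)
  assume "\<not> translate_measure B g \<le> emeasure \<mu> B"
  then have less: "AE x in \<mu>. translate_measure B x < translate_measure B (x ** g)"
    by (intro AE_translate_measure_less B g) simp
  have F' [measurable]: "F \<in> sets borel" and FG: "F \<subseteq> G" using F by (auto simp: fundamental_def)
  have tr: "translate_measure B (\<gamma> ** x) = translate_measure B x" if "\<gamma> \<in> D" "x \<in> G" for \<gamma> x
  proof -
    have "{y \<in> space borel. y \<in> G \<and> matrix_inv x ** y \<in> B} \<in> sets borel" by measurable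
    then have "emeasure \<mu> {y \<in> G. matrix_inv \<gamma> ** y \<in> {y \<in> G. matrix_inv x ** y \<in> B}} = translate_measure B x"
      unfolding translate_measure_def using that by (intro left_D) auto
    moreover have "{y \<in> G. matrix_inv \<gamma> ** y \<in> {y \<in> G. matrix_inv x ** y \<in> B}} =
        {y \<in> G. matrix_inv (\<gamma> ** x) ** y \<in> B}"
      using that by (auto simp: inv_mult matrix_mul_assoc)
    ultimately show ?thesis by (simp add: translate_measure_def)
  qed
  \<comment> \<open>Superlevel sets at rational heights. By \<open>tr\<close> the set
    \<open>A r\<close> is a union of cosets, so its translate \<open>A' r\<close> has the same
    finite measure inside \<open>F\<close>; as \<open>A r\<close> is almost contained in
    \<open>A' r\<close>, they differ there by a null set. A strict increase at x puts x into
    \<open>A' r - A r\<close> for a rational \<open>r\<close> between the two values.\<close>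
  define A where "A r = {x \<in> G. ennreal (real_of_rat r) < translate_measure B x}" for r
  define A' where "A' r = {x \<in> G. x ** g \<in> A r}" for r
  have A: "A r \<in> sets borel" "A' r \<in> sets borel" for r
  proof -
    have "{x \<in> space borel. x \<in> G \<and> ennreal (real_of_rat r) < translate_measure B x} \<in> sets borel"
      by measurable
    then show [measurable]: "A r \<in> sets borel" by (simp add: A_def)
    have "{x \<in> space borel. x \<in> G \<and> x ** g \<in> A r} \<in> sets borel" by measurable
    then show "A' r \<in> sets borel" by (simp add: A'_def)
  qed
  have "emeasure \<mu> (F \<inter> A' r - F \<inter> A r) = 0" for r
  proof -
    have "sat (A r) = A r"
    proof
      show "sat (A r) \<subseteq> A r" using tr by (auto simp: sat_def A_def)
    qed (rule subset_sat, simp add: A_def)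
    then have eq: "emeasure \<mu> (F \<inter> A' r) = emeasure \<mu> (F \<inter> A r)"
      unfolding A'_def using A g by (intro emeasure_fundamental_translate F)
    have "AE x in \<mu>. x \<in> F \<inter> A r \<longrightarrow> x \<in> F \<inter> A' r"
      using less by eventually_elim (use g in \<open>auto simp: A_def A'_def\<close>)
    then have "emeasure \<mu> (F \<inter> A r \<inter> A' r) = emeasure \<mu> (F \<inter> A r)"
      using A F' by (intro emeasure_eq_AE) auto
    moreover have "emeasure \<mu> (F \<inter> A r \<inter> A' r) < \<infinity>"
    proof (rule le_less_trans)
      show "emeasure \<mu> (F \<inter> A r \<inter> A' r) \<le> emeasure \<mu> F" by (rule emeasure_mono) (use F' in auto)
    qed (fact fin)
    ultimately have "emeasure \<mu> (F \<inter> A' r - F \<inter> A r \<inter> A' r) = 0"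
      using eq A F' emeasure_Diff[of \<mu> "F \<inter> A r \<inter> A' r" "F \<inter> A' r"] by (auto simp: less_top)
    moreover have "F \<inter> A' r - F \<inter> A r \<inter> A' r = F \<inter> A' r - F \<inter> A r" by auto
    ultimately show ?thesis by simp
  qed
  then have "F \<inter> A' r - F \<inter> A r \<in> null_sets \<mu>" for r
    using A F' by (auto intro: null_setsI)
  then have "AE x in \<mu>. \<forall>r. x \<notin> F \<inter> A' r - F \<inter> A r"
    unfolding AE_all_countable by (intro allI AE_not_in)
  with less have "AE x in \<mu>. x \<notin> F"
  proof eventually_elim
    fix x assume x: "translate_measure B x < translate_measure B (x ** g)" "\<forall>r. x \<notin> F \<inter> A' r - F \<inter> A r"
    then obtain r where "translate_measure B x < ennreal (real_of_rat r)"
        "ennreal (real_of_rat r) < translate_measure B (x ** g)"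
      using ennreal_rat_dense[OF x(1)] by blast
    then have "x \<in> G \<Longrightarrow> x \<in> A' r - A r" using g by (auto simp: A_def A'_def)
    then show "x \<notin> F" using x(2) FG by blast
  qed
  then have "emeasure \<mu> F = 0" using emeasure_eq_0_AE[of "\<lambda>x. x \<in> F" \<mu>] by simp
  then show False using fundamental_nonnull[OF F] by simp
qed

text \<open>The inequality just proved is applied to g^-1 and \<open>B\<close>, and then to
  \<open>g\<close> and the set g^-1 B.\<close>

lemma (in haar_discrete) left_invariant_if_finite_covolume:
  assumes F: "fundamental F" and fin: "emeasure \<mu> F < \<infinity>"
    and B [measurable]: "B \<in> sets borel" and BG: "B \<subseteq> G" and g: "g \<in> G"
  shows "emeasure \<mu> {x \<in> G. g ** x \<in> B} = emeasure \<mu> B"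
proof (rule antisym)
  show "emeasure \<mu> {x \<in> G. g ** x \<in> B} \<le> emeasure \<mu> B"
    using translate_measure_le[OF F fin B BG inv_in[OF g]] g by (simp add: translate_measure_def)
  have "{x \<in> space borel. x \<in> G \<and> g ** x \<in> B} \<in> sets borel" by measurable
  then have m: "{x \<in> G. g ** x \<in> B} \<in> sets borel" by simp
  have "{x \<in> G. matrix_inv g ** x \<in> {x \<in> G. g ** x \<in> B}} = B" using g BG by auto
  then show "emeasure \<mu> B \<le> emeasure \<mu> {x \<in> G. g ** x \<in> B}"
    using translate_measure_le[OF F fin m _ g] by (simp add: translate_measure_def)
qed

section \<open>Ergodicity of translations on the group itself\<close>

locale bi_haar = right_haar G \<mu> for G :: "(real^'n^'n) set" and \<mu> +
  assumes left_invariant: "g \<in> G \<Longrightarrow> B \<in> sets borel \<Longrightarrow> B \<subseteq> G \<Longrightarrow>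
      emeasure \<mu> {x \<in> G. g ** x \<in> B} = emeasure \<mu> B"
begin

lemma distr_left: "g \<in> G \<Longrightarrow> distr \<mu> borel (\<lambda>x. g ** x) = \<mu>"
  by (rule distr_eqI) (simp_all add: left_invariant)

text \<open>The exceptional null set depends on \<open>g\<close>. Fubini exchanges the quantifiers
  and yields a single x in \<open>G\<close> with s (x g) = s x for almost all g; left invariance of
  the measure turns almost all g into almost all points x g.\<close>

lemma AE_const_if_right_invariant:
  fixes s :: "real^'n^'n \<Rightarrow> 'b::{second_countable_topology, t2_space}"
  assumes s [measurable]: "s \<in> borel_measurable borel"
    and inv: "\<And>g. g \<in> G \<Longrightarrow> AE x in \<mu>. s (x ** g) = s x"
  shows "\<exists>c. AE x in \<mu>. s x = c"
proof -
  interpret sigma_finite_measure \<mu> by (rule sigma_finite_\<mu>)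
  interpret pair_sigma_finite \<mu> \<mu> ..
  have "AE g in \<mu>. AE x in \<mu>. s (x ** g) = s x"
    using AE_in by eventually_elim (rule inv)
  then have "AE x in \<mu>. AE g in \<mu>. s (x ** g) = s x"
    by (subst AE_commute) measurable
  with AE_in have ae: "AE x in \<mu>. x \<in> G \<and> (AE g in \<mu>. s (x ** g) = s x)" by simp
  have "\<exists>x. x \<in> G \<and> (AE g in \<mu>. s (x ** g) = s x)"
  proof (rule ccontr)
    assume "\<not> ?thesis"
    then have "AE x in \<mu>. x \<notin> G" using ae by (auto elim: eventually_mono)
    then have "emeasure \<mu> G = 0" using emeasure_eq_0_AE[of "\<lambda>x. x \<in> G" \<mu>] by simp
    then show False using nonzero by simp
  qed
  then obtain x where x: "x \<in> G" "AE g in \<mu>. s (x ** g) = s x" by blast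
  have "AE g in distr \<mu> borel (\<lambda>y. x ** y). s g = s x"
    by (subst AE_distr_iff) (use x in measurable)
  then show ?thesis unfolding distr_left[OF x(1)] by (rule exI)
qed

end

section \<open>The Hilbert space of square integrable functions\<close>

lemma borel_measurable_cnj [measurable (raw)]:
  assumes "f \<in> borel_measurable M"
  shows "(\<lambda>x. cnj (f x)) \<in> borel_measurable M"
  using measurable_compose[OF assms borel_measurable_continuous_onI[of cnj]]
  by (simp add: continuous_intros)

definition sq_integrable :: "'a measure \<Rightarrow> ('a \<Rightarrow> complex) \<Rightarrow> bool" where
  "sq_integrable M f \<longleftrightarrow> f \<in> borel_measurable M \<and> integrable M (\<lambda>x. (cmod (f x))\<^sup>2)"

text \<open>A vector is a whole class, of type \<open>('a \<Rightarrow> complex) set\<close>. With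
  matrices for \<open>'a\<close> this is the type of vectors over which \<open>property_T\<close>
  quantifies.\<close>

definition ae_class :: "'a measure \<Rightarrow> ('a \<Rightarrow> complex) \<Rightarrow> ('a \<Rightarrow> complex) set" where
  "ae_class M f = {g \<in> borel_measurable M. AE x in M. g x = f x}"

definition ae_rep :: "('a \<Rightarrow> complex) set \<Rightarrow> 'a \<Rightarrow> complex" where
  "ae_rep X = (SOME f. f \<in> X)"

definition l2 :: "'a measure \<Rightarrow> ('a \<Rightarrow> complex) set hilbert" where
  "l2 M = \<lparr>vecs = ae_class M ` Collect (sq_integrable M),
    vadd = (\<lambda>X Y. ae_class M (\<lambda>x. ae_rep X x + ae_rep Y x)),
    vzero = ae_class M (\<lambda>_. 0),
    vscale = (\<lambda>a X. ae_class M (\<lambda>x. a * ae_rep X x)),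
    vinner = (\<lambda>X Y. \<integral>x. cnj (ae_rep X x) * ae_rep Y x \<partial>M)\<rparr>"

lemma sq_integrable_measurable [measurable_dest]:
  "sq_integrable M f \<Longrightarrow> f \<in> borel_measurable M"
  by (simp add: sq_integrable_def)

lemma sq_integrable_zero: "sq_integrable M (\<lambda>_. 0)"
  by (simp add: sq_integrable_def)

lemma cmod_add_sq_le: "(cmod (a + b))\<^sup>2 \<le> 2 * (cmod a)\<^sup>2 + 2 * (cmod b)\<^sup>2"
proof -
  have "(cmod (a + b))\<^sup>2 \<le> (cmod a + cmod b)\<^sup>2" by (intro power_mono norm_triangle_ineq) simp
  also have "\<dots> \<le> 2 * (cmod a)\<^sup>2 + 2 * (cmod b)\<^sup>2"
    using sum_squares_bound[of "cmod a" "cmod b"] by (simp add: power2_sum)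
  finally show ?thesis .
qed

lemma sq_integrable_add:
  assumes f: "sq_integrable M f" and g: "sq_integrable M g"
  shows "sq_integrable M (\<lambda>x. f x + g x)"
  unfolding sq_integrable_def
proof (intro conjI)
  note [measurable] = sq_integrable_measurable[OF f] sq_integrable_measurable[OF g]
  show "(\<lambda>x. f x + g x) \<in> borel_measurable M" by measurable
  have "integrable M (\<lambda>x. 2 * (cmod (f x))\<^sup>2 + 2 * (cmod (g x))\<^sup>2)"
    using f g by (auto simp: sq_integrable_def)
  then show "integrable M (\<lambda>x. (cmod (f x + g x))\<^sup>2)"
    by (rule Bochner_Integration.integrable_bound) (auto intro!: AE_I2 order_trans[OF cmod_add_sq_le])
qed

lemma sq_integrable_scale:
  "sq_integrable M f \<Longrightarrow> sq_integrable M (\<lambda>x. a * f x)"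
  by (auto simp: sq_integrable_def norm_mult power_mult_distrib)

lemma sq_integrable_diff:
  assumes "sq_integrable M f" "sq_integrable M g"
  shows "sq_integrable M (\<lambda>x. f x - g x)"
  using sq_integrable_add[OF assms(1) sq_integrable_scale[OF assms(2), of "-1"]] by simp

lemma integrable_cnj_mult:
  assumes f: "sq_integrable M f" and g: "sq_integrable M g"
  shows "integrable M (\<lambda>x. cnj (f x) * g x)"
proof -
  note [measurable] = sq_integrable_measurable[OF f] sq_integrable_measurable[OF g]
  have "integrable M (\<lambda>x. (cmod (f x))\<^sup>2 + (cmod (g x))\<^sup>2)"
    using f g by (auto simp: sq_integrable_def)
  then show ?thesis
  proof (rule Bochner_Integration.integrable_bound)
    have "cmod (f x) * cmod (g x) \<le> (cmod (f x))\<^sup>2 + (cmod (g x))\<^sup>2" for x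
    proof -
      have "0 \<le> cmod (f x) * cmod (g x)" by simp
      then show ?thesis using sum_squares_bound[of "cmod (f x)" "cmod (g x)"] by linarith
    qed
    then show "AE x in M. norm (cnj (f x) * g x) \<le> norm ((cmod (f x))\<^sup>2 + (cmod (g x))\<^sup>2)"
      by (simp add: norm_mult)
  qed measurable
qed

lemma sq_integrable_cong_AE:
  assumes "sq_integrable M f" "g \<in> borel_measurable M" "AE x in M. g x = f x"
  shows "sq_integrable M g"
proof -
  note [measurable] = sq_integrable_measurable[OF assms(1)] assms(2)
  have "integrable M (\<lambda>x. (cmod (g x))\<^sup>2) \<longleftrightarrow> integrable M (\<lambda>x. (cmod (f x))\<^sup>2)"
    using assms(3) by (intro integrable_cong_AE) (auto elim: eventually_mono)
  then show ?thesis using assms by (simp add: sq_integrable_def)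
qed

lemma ae_class_eq_iff:
  assumes "f \<in> borel_measurable M" "g \<in> borel_measurable M"
  shows "ae_class M f = ae_class M g \<longleftrightarrow> (AE x in M. f x = g x)"
proof
  assume "ae_class M f = ae_class M g"
  moreover have "f \<in> ae_class M f" using assms by (simp add: ae_class_def)
  ultimately show "AE x in M. f x = g x" by (simp add: ae_class_def)
next
  assume eq: "AE x in M. f x = g x"
  have "(AE x in M. h x = f x) \<longleftrightarrow> (AE x in M. h x = g x)" for h
  proof
    assume "AE x in M. h x = f x" then show "AE x in M. h x = g x" using eq by eventually_elim simp
  next
    assume "AE x in M. h x = g x" then show "AE x in M. h x = f x" using eq by eventually_elim simp
  qed
  then show "ae_class M f = ae_class M g" by (simp add: ae_class_def)
qed

lemma ae_rep_class:
  assumes "sq_integrable M f"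
  shows "sq_integrable M (ae_rep (ae_class M f))" "AE x in M. ae_rep (ae_class M f) x = f x"
proof -
  have "f \<in> ae_class M f" using assms by (simp add: ae_class_def sq_integrable_def)
  then have *: "ae_rep (ae_class M f) \<in> ae_class M f" 
    unfolding ae_rep_def by (rule someI[where P = "\<lambda>h. h \<in> ae_class M f"])
  then show "AE x in M. ae_rep (ae_class M f) x = f x" by (simp add: ae_class_def)
  then show "sq_integrable M (ae_rep (ae_class M f))"
    using * by (intro sq_integrable_cong_AE[OF assms]) (simp_all add: ae_class_def)
qed

lemma l2_vecsE:
  assumes "X \<in> vecs (l2 M)"
  obtains f where "X = ae_class M f" "sq_integrable M f"
  using assms by (auto simp: l2_def)

lemma l2_vecsI: "sq_integrable M f \<Longrightarrow> ae_class M f \<in> vecs (l2 M)"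
  by (simp add: l2_def)

lemma vadd_l2:
  assumes "sq_integrable M f" "sq_integrable M g"
  shows "vadd (l2 M) (ae_class M f) (ae_class M g) = ae_class M (\<lambda>x. f x + g x)"
proof -
  note r = ae_rep_class[OF assms(1)] ae_rep_class[OF assms(2)]
  have "AE x in M. ae_rep (ae_class M f) x + ae_rep (ae_class M g) x = f x + g x"
    using r(2) r(4) by eventually_elim simp
  then show ?thesis
    using sq_integrable_add[OF r(1,3)] sq_integrable_add[OF assms]
    by (simp add: l2_def ae_class_eq_iff sq_integrable_measurable)
qed

lemma vscale_l2:
  assumes "sq_integrable M f"
  shows "vscale (l2 M) a (ae_class M f) = ae_class M (\<lambda>x. a * f x)"
proof -
  note r = ae_rep_class[OF assms]
  have "AE x in M. a * ae_rep (ae_class M f) x = a * f x"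
    using r(2) by eventually_elim simp
  then show ?thesis
    using sq_integrable_scale[OF r(1)] sq_integrable_scale[OF assms]
    by (simp add: l2_def ae_class_eq_iff sq_integrable_measurable)
qed

lemma vinner_l2:
  assumes "sq_integrable M f" "sq_integrable M g"
  shows "vinner (l2 M) (ae_class M f) (ae_class M g) = (\<integral>x. cnj (f x) * g x \<partial>M)"
proof -
  note r = ae_rep_class[OF assms(1)] ae_rep_class[OF assms(2)]
  note [measurable] = r(1,3)[THEN sq_integrable_measurable] assms[THEN sq_integrable_measurable]
  have "AE x in M. cnj (ae_rep (ae_class M f) x) * ae_rep (ae_class M g) x = cnj (f x) * g x"
    using r(2) r(4) by eventually_elim simp
  then have "(\<integral>x. cnj (ae_rep (ae_class M f) x) * ae_rep (ae_class M g) x \<partial>M) = (\<integral>x. cnj (f x) * g x \<partial>M)"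
    by (intro integral_cong_AE) measurable
  then show ?thesis by (simp add: l2_def)
qed

lemma vzero_l2: "vzero (l2 M) = ae_class M (\<lambda>_. 0)"
  by (simp add: l2_def)

lemma vinner_self_l2:
  assumes "sq_integrable M f"
  shows "Re (vinner (l2 M) (ae_class M f) (ae_class M f)) = (\<integral>x. (cmod (f x))\<^sup>2 \<partial>M)"
proof -
  have "Re (\<integral>x. cnj (f x) * f x \<partial>M) = (\<integral>x. Re (cnj (f x) * f x) \<partial>M)"
    by (rule integral_Re[OF integrable_cnj_mult[OF assms assms], symmetric])
  also have "\<dots> = (\<integral>x. (cmod (f x))\<^sup>2 \<partial>M)"
    by (simp add: cmod_def power2_eq_square)
  finally show ?thesis by (simp add: vinner_l2 assms)
qed

lemma vnorm_l2: "sq_integrable M f \<Longrightarrow> (vnorm (l2 M) (ae_class M f))\<^sup>2 = (\<integral>x. (cmod (f x))\<^sup>2 \<partial>M)"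
  by (simp add: vnorm_def vinner_self_l2 integral_nonneg_AE)

lemma vnorm_l2_nonneg: "sq_integrable M f \<Longrightarrow> 0 \<le> vnorm (l2 M) (ae_class M f)"
  by (simp add: vnorm_def vinner_self_l2 integral_nonneg_AE)

lemma vdist_l2_eq:
  assumes "sq_integrable M f" "sq_integrable M g"
  shows "vdist (l2 M) (ae_class M f) (ae_class M g) = vnorm (l2 M) (ae_class M (\<lambda>x. f x - g x))"
  using vadd_l2[OF assms(1) sq_integrable_scale[OF assms(2), of "-1"]] assms
  by (simp add: vdist_def vscale_l2)

lemma vdist_l2:
  assumes "sq_integrable M f" "sq_integrable M g"
  shows "(vdist (l2 M) (ae_class M f) (ae_class M g))\<^sup>2 = (\<integral>x. (cmod (f x - g x))\<^sup>2 \<partial>M)"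
    "0 \<le> vdist (l2 M) (ae_class M f) (ae_class M g)"
  using vdist_l2_eq[OF assms] sq_integrable_diff[OF assms] by (simp_all add: vnorm_l2 vnorm_l2_nonneg)

lemma vdist_l2_nonneg: "X \<in> vecs (l2 M) \<Longrightarrow> Y \<in> vecs (l2 M) \<Longrightarrow> 0 \<le> vdist (l2 M) X Y"
  by (metis l2_vecsE vdist_l2(2))

text \<open>This form, with the factor 2, follows pointwise from |a + b|^2 \<le> 2 |a|^2 + 2 |b|^2,
  and the loss is harmless in arguments about limits.\<close>

lemma vdist_l2_sq_triangle:
  assumes "X \<in> vecs (l2 M)" "Y \<in> vecs (l2 M)" "Z \<in> vecs (l2 M)"
  shows "(vdist (l2 M) X Z)\<^sup>2 \<le> 2 * (vdist (l2 M) X Y)\<^sup>2 + 2 * (vdist (l2 M) Y Z)\<^sup>2"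
proof -
  obtain f g h where *: "X = ae_class M f" "Y = ae_class M g" "Z = ae_class M h"
    "sq_integrable M f" "sq_integrable M g" "sq_integrable M h"
    using assms by (metis l2_vecsE)
  have i: "integrable M (\<lambda>x. (cmod (f x - h x))\<^sup>2)" "integrable M (\<lambda>x. (cmod (f x - g x))\<^sup>2)"
    "integrable M (\<lambda>x. (cmod (g x - h x))\<^sup>2)"
    using *(4-6) sq_integrable_diff by (auto simp: sq_integrable_def)
  have "(\<integral>x. (cmod (f x - h x))\<^sup>2 \<partial>M) \<le> (\<integral>x. 2 * (cmod (f x - g x))\<^sup>2 + 2 * (cmod (g x - h x))\<^sup>2 \<partial>M)"
  proof (rule integral_mono)
    show "(cmod (f x - h x))\<^sup>2 \<le> 2 * (cmod (f x - g x))\<^sup>2 + 2 * (cmod (g x - h x))\<^sup>2" for x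
      using cmod_add_sq_le[of "f x - g x" "g x - h x"] by simp
  qed (use i in auto)
  then show ?thesis using i by (simp add: * vdist_l2)
qed

lemma complex_inner_product_space_l2: "complex_inner_product_space (l2 M)"
proof -
  have c0: "comm_group \<lparr>carrier = vecs (l2 M), mult = vadd (l2 M), one = vzero (l2 M)\<rparr>"
  proof (rule comm_groupI; clarsimp elim!: l2_vecsE)
    fix f assume f: "sq_integrable M f"
    show "\<exists>Y\<in>vecs (l2 M). vadd (l2 M) Y (ae_class M f) = vzero (l2 M)"
      using f sq_integrable_scale[OF f, of "-1"]
      by (intro bexI[of _ "ae_class M (\<lambda>x. -1 * f x)"] l2_vecsI) (simp_all add: vadd_l2 vzero_l2)
    show "vadd (l2 M) (vzero (l2 M)) (ae_class M f) = ae_class M f"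
      using f by (simp add: vzero_l2 vadd_l2 sq_integrable_zero)
  next
    show "vzero (l2 M) \<in> vecs (l2 M)" by (simp add: vzero_l2 l2_vecsI sq_integrable_zero)
  qed (simp_all add: vadd_l2 l2_vecsI sq_integrable_add add_ac)
  have c1: "Re (vinner (l2 M) X X) > 0" if "X \<in> vecs (l2 M)" "X \<noteq> vzero (l2 M)" for X
  proof -
    from that obtain f where f: "X = ae_class M f" "sq_integrable M f" by (elim l2_vecsE)
    have "Re (vinner (l2 M) X X) = (\<integral>x. (cmod (f x))\<^sup>2 \<partial>M)"
      by (simp add: f vinner_self_l2)
    moreover have "(\<integral>x. (cmod (f x))\<^sup>2 \<partial>M) \<noteq> 0"
    proof
      assume "(\<integral>x. (cmod (f x))\<^sup>2 \<partial>M) = 0"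
      then have "AE x in M. f x = 0"
        using f integral_nonneg_eq_0_iff_AE[of M "\<lambda>x. (cmod (f x))\<^sup>2"] by (simp add: sq_integrable_def)
      then show False using that f by (simp add: vzero_l2 ae_class_eq_iff sq_integrable_measurable)
    qed
    moreover have "(\<integral>x. (cmod (f x))\<^sup>2 \<partial>M) \<ge> 0" by (simp add: integral_nonneg_AE)
    ultimately show ?thesis by linarith
  qed
  have c2: "vinner (l2 M) Y X = cnj (vinner (l2 M) X Y)"
    if "X \<in> vecs (l2 M)" "Y \<in> vecs (l2 M)" for X Y
  proof -
    obtain f where f: "X = ae_class M f" "sq_integrable M f" using \<open>X \<in> vecs (l2 M)\<close> by (rule l2_vecsE)
    obtain g where g: "Y = ae_class M g" "sq_integrable M g" using \<open>Y \<in> vecs (l2 M)\<close> by (rule l2_vecsE)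
    have "(\<integral>x. cnj (g x) * f x \<partial>M) = (\<integral>x. cnj (cnj (f x) * g x) \<partial>M)"
      by (simp add: mult.commute)
    also have "\<dots> = cnj (\<integral>x. cnj (f x) * g x \<partial>M)" by (rule Bochner_Integration.integral_cnj)
    finally show ?thesis using f g by (simp only: vinner_l2)
  qed
  have c3: "vinner (l2 M) X (vadd (l2 M) Y Z) = vinner (l2 M) X Y + vinner (l2 M) X Z"
    if "X \<in> vecs (l2 M)" "Y \<in> vecs (l2 M)" "Z \<in> vecs (l2 M)" for X Y Z
  proof -
    obtain f where f: "X = ae_class M f" "sq_integrable M f" using \<open>X \<in> vecs (l2 M)\<close> by (rule l2_vecsE)
    obtain g where g: "Y = ae_class M g" "sq_integrable M g" using \<open>Y \<in> vecs (l2 M)\<close> by (rule l2_vecsE)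
    obtain h where h: "Z = ae_class M h" "sq_integrable M h" using \<open>Z \<in> vecs (l2 M)\<close> by (rule l2_vecsE)
    show ?thesis
      by (simp add: f g h vinner_l2 vadd_l2 sq_integrable_add distrib_left integrable_cnj_mult)
  qed
  have c4: "vinner (l2 M) X (vscale (l2 M) a Y) = a * vinner (l2 M) X Y"
    if "X \<in> vecs (l2 M)" "Y \<in> vecs (l2 M)" for a X Y
  proof -
    obtain f where f: "X = ae_class M f" "sq_integrable M f" using \<open>X \<in> vecs (l2 M)\<close> by (rule l2_vecsE)
    obtain g where g: "Y = ae_class M g" "sq_integrable M g" using \<open>Y \<in> vecs (l2 M)\<close> by (rule l2_vecsE)
    show ?thesis
      by (simp add: f g vinner_l2 vscale_l2 sq_integrable_scale mult.left_commute[of _ a] integrable_cnj_mult)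
  qed
  have c5: "vscale (l2 M) 1 X = X \<and> (\<forall>a. vscale (l2 M) a X \<in> vecs (l2 M)) \<and>
        (\<forall>a b. vscale (l2 M) a (vscale (l2 M) b X) = vscale (l2 M) (a * b) X \<and>
               vscale (l2 M) (a + b) X = vadd (l2 M) (vscale (l2 M) a X) (vscale (l2 M) b X))"
    if "X \<in> vecs (l2 M)" for X
  proof -
    obtain f where f: "X = ae_class M f" "sq_integrable M f" using \<open>X \<in> vecs (l2 M)\<close> by (rule l2_vecsE)
    show ?thesis
      by (simp add: f vscale_l2 vadd_l2 l2_vecsI sq_integrable_scale mult.assoc distrib_right)
  qed
  have c6: "vscale (l2 M) a (vadd (l2 M) X Y) = vadd (l2 M) (vscale (l2 M) a X) (vscale (l2 M) a Y)"
    if "X \<in> vecs (l2 M)" "Y \<in> vecs (l2 M)" for a X Y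
  proof -
    obtain f where f: "X = ae_class M f" "sq_integrable M f" using \<open>X \<in> vecs (l2 M)\<close> by (rule l2_vecsE)
    obtain g where g: "Y = ae_class M g" "sq_integrable M g" using \<open>Y \<in> vecs (l2 M)\<close> by (rule l2_vecsE)
    show ?thesis
      by (simp add: f g vscale_l2 vadd_l2 sq_integrable_scale sq_integrable_add distrib_left)
  qed
  show ?thesis
    unfolding complex_inner_product_space_def
    using c0 c1 c2 c3 c4 c6 c5[THEN conjunct1] c5[THEN conjunct2, THEN conjunct1, rule_format]
      c5[THEN conjunct2, THEN conjunct2, rule_format, THEN conjunct1]
      c5[THEN conjunct2, THEN conjunct2, rule_format, THEN conjunct2]
    by (intro conjI ballI allI impI)
qed

lemma nn_integral_sq_integrable:
  assumes "sq_integrable M f"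
  shows "(\<integral>\<^sup>+x. ennreal ((cmod (f x))\<^sup>2) \<partial>M) = ennreal (\<integral>x. (cmod (f x))\<^sup>2 \<partial>M)"
  using assms by (intro nn_integral_eq_integral) (auto simp: sq_integrable_def)

text \<open>The weights \<open>2\<^sup>j\<close> turn summability of \<open>\<integral> |g\<^sub>j|\<^sup>2\<close> into that of \<open>\<integral> |g\<^sub>j|\<close> without
  Minkowski's inequality: \<open>t \<le> 2\<^sup>-\<^sup>j + 2\<^sup>j t\<^sup>2\<close>.\<close>

lemma AE_summable_if_sq_small:
  fixes g :: "nat \<Rightarrow> 'a \<Rightarrow> complex"
  assumes g: "\<And>j. sq_integrable M (g j)" and small: "\<And>j. (\<integral>x. (cmod (g j x))\<^sup>2 \<partial>M) \<le> (1/8)^j"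
  shows "AE x in M. summable (\<lambda>j. g j x)"
proof -
  note [measurable] = g[THEN sq_integrable_measurable]
  have "(\<integral>\<^sup>+x. (\<Sum>j. ennreal (2^j * (cmod (g j x))\<^sup>2)) \<partial>M) = (\<Sum>j. \<integral>\<^sup>+x. ennreal (2^j * (cmod (g j x))\<^sup>2) \<partial>M)"
    by (rule nn_integral_suminf) measurable
  also have "\<dots> \<le> (\<Sum>j. ennreal ((1/4)^j))"
  proof (rule suminf_le)
    fix j
    have "(\<integral>\<^sup>+x. ennreal (2^j * (cmod (g j x))\<^sup>2) \<partial>M) = ennreal (2^j) * (\<integral>\<^sup>+x. ennreal ((cmod (g j x))\<^sup>2) \<partial>M)"
      by (subst nn_integral_cmult[symmetric]) (simp_all add: ennreal_mult)
    also have "\<dots> = ennreal (2^j * (\<integral>x. (cmod (g j x))\<^sup>2 \<partial>M))"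
      by (simp add: nn_integral_sq_integrable g ennreal_mult integral_nonneg_AE)
    also have "2^j * (\<integral>x. (cmod (g j x))\<^sup>2 \<partial>M) \<le> 2^j * (1/8)^j" by (intro mult_left_mono small) simp
    also have "2^j * (1/8 :: real)^j = (1/4)^j" by (simp flip: power_mult_distrib)
    finally show "(\<integral>\<^sup>+x. ennreal (2^j * (cmod (g j x))\<^sup>2) \<partial>M) \<le> ennreal ((1/4)^j)"
      by (simp add: ennreal_leI)
  qed auto
  also have "\<dots> = ennreal (\<Sum>j. (1/4)^j)" by (intro suminf_ennreal2 summable_geometric) auto
  finally have "(\<integral>\<^sup>+x. (\<Sum>j. ennreal (2^j * (cmod (g j x))\<^sup>2)) \<partial>M) \<noteq> \<infinity>" by (auto simp: top_unique)
  then have "AE x in M. (\<Sum>j. ennreal (2^j * (cmod (g j x))\<^sup>2)) \<noteq> \<infinity>"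
    by (intro nn_integral_noteq_infinite) measurable
  then show ?thesis
  proof eventually_elim
    fix x assume "(\<Sum>j. ennreal (2^j * (cmod (g j x))\<^sup>2)) \<noteq> \<infinity>"
    then have "summable (\<lambda>j. 2^j * (cmod (g j x))\<^sup>2)"
      by (intro summable_suminf_not_top) auto
    then have s: "summable (\<lambda>j. (1/2)^j + 2^j * (cmod (g j x))\<^sup>2)"
      by (intro summable_add summable_geometric) auto
    show "summable (\<lambda>j. g j x)"
    proof (rule summable_norm_cancel, rule summable_comparison_test'[OF s])
      fix j :: nat
      define t where "t = cmod (g j x)"
      define c where "c = (2::real)^j"
      have "c > 0" "t \<ge> 0" by (auto simp: c_def t_def)
      have "t \<le> 1 / c + c * t\<^sup>2"
      proof -
        have "2 * (t * c) * 1 \<le> (t * c)\<^sup>2 + 1\<^sup>2" by (rule sum_squares_bound)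
        then have "t * c \<le> 1 + (t * c)\<^sup>2" using \<open>c > 0\<close> \<open>t \<ge> 0\<close> by (smt (verit) mult_nonneg_nonneg power_one)
        then show ?thesis using \<open>c > 0\<close> by (simp add: field_simps power2_eq_square)
      qed
      then show "norm (norm (g j x)) \<le> (1/2)^j + 2^j * (cmod (g j x))\<^sup>2"
        by (simp add: c_def t_def power_divide)
    qed
  qed
qed

text \<open>Riesz-Fischer: a subsequence with rapidly decreasing increments converges almost
  everywhere, and Fatou's lemma carries the Cauchy estimate over to its limit.\<close>

lemma l2_complete_function:
  fixes f :: "nat \<Rightarrow> 'a \<Rightarrow> complex"
  assumes f: "\<And>n. sq_integrable M (f n)"
    and cauchy: "\<And>e. e > 0 \<Longrightarrow> \<exists>N. \<forall>m\<ge>N. \<forall>n\<ge>N. (\<integral>x. (cmod (f m x - f n x))\<^sup>2 \<partial>M) < e"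
  shows "\<exists>h. sq_integrable M h \<and> (\<lambda>n. \<integral>x. (cmod (f n x - h x))\<^sup>2 \<partial>M) \<longlonglongrightarrow> 0"
proof -
  note [measurable] = f[THEN sq_integrable_measurable]
  have "\<forall>j. \<exists>N. \<forall>m\<ge>N. \<forall>n\<ge>N. (\<integral>x. (cmod (f m x - f n x))\<^sup>2 \<partial>M) < (1/8)^j"
    by (intro allI cauchy) simp
  then obtain N where N: "\<And>j m n. m \<ge> N j \<Longrightarrow> n \<ge> N j \<Longrightarrow> (\<integral>x. (cmod (f m x - f n x))\<^sup>2 \<partial>M) < (1/8)^j"
    by metis
  \<comment> \<open>The indices must be monotone, beyond \<open>N j\<close>, and unbounded. Summing
    the earlier \<open>N i\<close> gives the first two properties and the summand \<open>j\<close>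
    the third.\<close>
  define k where "k j = (\<Sum>i\<le>j. N i) + j" for j
  have kN: "N j \<le> k j" and kSuc: "k j \<le> k (Suc j)" and kj: "j \<le> k j" for j
    using member_le_sum[of j "{..j}" N] by (auto simp: k_def)
  define g where "g j x = f (k (Suc j)) x - f (k j) x" for j x
  have "AE x in M. summable (\<lambda>j. g j x)"
  proof (rule AE_summable_if_sq_small)
    show "sq_integrable M (g j)" for j
      unfolding g_def by (intro sq_integrable_diff f)
    show "(\<integral>x. (cmod (g j x))\<^sup>2 \<partial>M) \<le> (1/8)^j" for j
      unfolding g_def using N[of j "k (Suc j)" "k j"] kN[of j] kSuc[of j] by (auto intro: less_imp_le)
  qed
  then have conv: "AE x in M. convergent (\<lambda>j. f (k j) x)"
  proof eventually_elim
    fix x assume "summable (\<lambda>j. g j x)"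
    then have "convergent (\<lambda>n. \<Sum>j<n. g j x)" by (simp add: summable_iff_convergent)
    moreover have "(\<Sum>j<n. g j x) = f (k n) x - f (k 0) x" for n
      unfolding g_def by (rule sum_lessThan_telescope)
    ultimately have "convergent (\<lambda>n. f (k n) x - f (k 0) x)" by simp
    then have "convergent (\<lambda>n. (f (k n) x - f (k 0) x) + f (k 0) x)"
      by (intro convergent_add convergent_const)
    then show "convergent (\<lambda>j. f (k j) x)" by simp
  qed
  define h where "h x = lim (\<lambda>j. f (k j) x)" for x
  have [measurable]: "h \<in> borel_measurable M"
    unfolding h_def by (rule borel_measurable_lim_metric) measurable
  have bound: "(\<integral>\<^sup>+x. ennreal ((cmod (f m x - h x))\<^sup>2) \<partial>M) \<le> ennreal e"
    if e: "\<And>m n. m \<ge> N' \<Longrightarrow> n \<ge> N' \<Longrightarrow> (\<integral>x. (cmod (f m x - f n x))\<^sup>2 \<partial>M) < e" and m: "m \<ge> N'" for e N' m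
  proof -
    have "AE x in M. ennreal ((cmod (f m x - h x))\<^sup>2) = liminf (\<lambda>j. ennreal ((cmod (f m x - f (k j) x))\<^sup>2))"
      using conv
    proof eventually_elim
      fix x assume "convergent (\<lambda>j. f (k j) x)"
      then have "(\<lambda>j. f (k j) x) \<longlonglongrightarrow> h x" by (simp add: h_def convergent_LIMSEQ_iff)
      then have "(\<lambda>j. ennreal ((cmod (f m x - f (k j) x))\<^sup>2)) \<longlonglongrightarrow> ennreal ((cmod (f m x - h x))\<^sup>2)"
        by (intro tendsto_intros)
      then show "ennreal ((cmod (f m x - h x))\<^sup>2) = liminf (\<lambda>j. ennreal ((cmod (f m x - f (k j) x))\<^sup>2))"
        by (intro lim_imp_Liminf[symmetric]) simp_all
    qed
    then have "(\<integral>\<^sup>+x. ennreal ((cmod (f m x - h x))\<^sup>2) \<partial>M) =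
        (\<integral>\<^sup>+x. liminf (\<lambda>j. ennreal ((cmod (f m x - f (k j) x))\<^sup>2)) \<partial>M)"
      by (rule nn_integral_cong_AE)
    also have "\<dots> \<le> liminf (\<lambda>j. \<integral>\<^sup>+x. ennreal ((cmod (f m x - f (k j) x))\<^sup>2) \<partial>M)"
      by (rule nn_integral_liminf) measurable
    also have "\<dots> \<le> ennreal e"
    proof (rule Liminf_le)
      show "\<forall>\<^sub>F j in sequentially. (\<integral>\<^sup>+x. ennreal ((cmod (f m x - f (k j) x))\<^sup>2) \<partial>M) \<le> ennreal e"
        using eventually_ge_at_top[of N']
      proof eventually_elim
        fix j assume "N' \<le> j"
        then have "(\<integral>x. (cmod (f m x - f (k j) x))\<^sup>2 \<partial>M) < e" using e m kj[of j] by simp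
        then show "(\<integral>\<^sup>+x. ennreal ((cmod (f m x - f (k j) x))\<^sup>2) \<partial>M) \<le> ennreal e"
          by (simp add: nn_integral_sq_integrable sq_integrable_diff f ennreal_leI)
      qed
    qed simp
    finally show ?thesis .
  qed
  \<comment> \<open>Square integrability of \<open>h\<close> is obtained from its finite distance to
    one member of the sequence.\<close>
  have diff: "sq_integrable M (\<lambda>x. f (N 0) x - h x)"
    unfolding sq_integrable_def
  proof (intro conjI integrableI_nonneg)
    show "(\<integral>\<^sup>+x. ennreal ((cmod (f (N 0) x - h x))\<^sup>2) \<partial>M) < \<infinity>"
      using bound[of "N 0" "(1/8)^0" "N 0"] N[of 0]
      by (auto intro: le_less_trans)
  qed auto
  then have h: "sq_integrable M h" using sq_integrable_diff[OF f[of "N 0"] diff] by simp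
  have "(\<lambda>n. \<integral>x. (cmod (f n x - h x))\<^sup>2 \<partial>M) \<longlonglongrightarrow> 0"
  proof (rule LIMSEQ_I)
    fix r :: real assume "r > 0"
    then obtain N' where N': "\<forall>m\<ge>N'. \<forall>n\<ge>N'. (\<integral>x. (cmod (f m x - f n x))\<^sup>2 \<partial>M) < r / 2"
      using cauchy[of "r/2"] by auto
    have "norm ((\<integral>x. (cmod (f m x - h x))\<^sup>2 \<partial>M) - 0) < r" if "m \<ge> N'" for m
    proof -
      have "ennreal (\<integral>x. (cmod (f m x - h x))\<^sup>2 \<partial>M) \<le> ennreal (r / 2)"
        using bound[of N' "r/2" m] N' that
        by (simp add: nn_integral_sq_integrable sq_integrable_diff f h)
      then show ?thesis using \<open>r > 0\<close> by (simp add: ennreal_le_iff integral_nonneg_AE)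
    qed
    then show "\<exists>no. \<forall>n\<ge>no. norm ((\<integral>x. (cmod (f n x - h x))\<^sup>2 \<partial>M) - 0) < r" by blast
  qed
  with h show ?thesis by blast
qed

lemma hilbert_space_l2: "hilbert_space (l2 M)"
  unfolding hilbert_space_def
proof (intro conjI allI impI complex_inner_product_space_l2)
  fix s :: "nat \<Rightarrow> ('a \<Rightarrow> complex) set"
  assume s: "\<forall>n. s n \<in> vecs (l2 M)" and cauchy: "\<forall>e>0. \<exists>N. \<forall>m\<ge>N. \<forall>n\<ge>N. vdist (l2 M) (s m) (s n) < e"
  have "\<forall>n. \<exists>f. s n = ae_class M f \<and> sq_integrable M f" using s by (metis l2_vecsE)
  then obtain f where f: "\<And>n. s n = ae_class M (f n)" "\<And>n. sq_integrable M (f n)" by metis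
  have "\<exists>N. \<forall>m\<ge>N. \<forall>n\<ge>N. (\<integral>x. (cmod (f m x - f n x))\<^sup>2 \<partial>M) < e" if "e > 0" for e
  proof -
    from that obtain N where N: "\<forall>m\<ge>N. \<forall>n\<ge>N. vdist (l2 M) (s m) (s n) < sqrt e" using cauchy by (meson real_sqrt_gt_zero)
    have "(\<integral>x. (cmod (f m x - f n x))\<^sup>2 \<partial>M) < e" if "m \<ge> N" "n \<ge> N" for m n
    proof -
      have "(vdist (l2 M) (s m) (s n))\<^sup>2 < (sqrt e)\<^sup>2"
        using N that s by (intro power_strict_mono vdist_l2_nonneg) auto
      then show ?thesis using \<open>e > 0\<close> by (simp add: f vdist_l2)
    qed
    then show ?thesis by blast
  qed
  from l2_complete_function[OF f(2) this]
  obtain h where h: "sq_integrable M h" "(\<lambda>n. \<integral>x. (cmod (f n x - h x))\<^sup>2 \<partial>M) \<longlonglongrightarrow> 0"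
    by auto
  have "(\<lambda>n. sqrt ((vdist (l2 M) (s n) (ae_class M h))\<^sup>2)) \<longlonglongrightarrow> sqrt 0"
    using h by (intro tendsto_real_sqrt) (simp add: f vdist_l2)
  moreover have "sqrt ((vdist (l2 M) (s n) (ae_class M h))\<^sup>2) = vdist (l2 M) (s n) (ae_class M h)" for n
    using s h by (simp add: vdist_l2_nonneg l2_vecsI)
  ultimately show "\<exists>x\<in>vecs (l2 M). (\<lambda>n. vdist (l2 M) (s n) x) \<longlonglongrightarrow> 0"
    using h by (intro bexI[of _ "ae_class M h"] l2_vecsI) simp_all
qed

section \<open>Koopman representations\<close>

lemma hilbert_subspace:
  assumes V: "hilbert_space V" and W: "W \<subseteq> vecs V" and zero: "vzero V \<in> W"
    and add: "\<And>x y. x \<in> W \<Longrightarrow> y \<in> W \<Longrightarrow> vadd V x y \<in> W"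
    and scale: "\<And>a x. x \<in> W \<Longrightarrow> vscale V a x \<in> W"
    and closed: "\<And>s x. (\<And>n :: nat. s n \<in> W) \<Longrightarrow> x \<in> vecs V \<Longrightarrow> (\<lambda>n. vdist V (s n) x) \<longlonglongrightarrow> 0 \<Longrightarrow> x \<in> W"
  shows "hilbert_space (V\<lparr>vecs := W\<rparr>)"
proof -
  let ?W = "\<lparr>carrier = W, mult = vadd V, one = vzero V\<rparr>"
  let ?H = "\<lparr>carrier = vecs V, mult = vadd V, one = vzero V\<rparr>"
  have ip: "complex_inner_product_space V" using V by (simp add: hilbert_space_def)
  then have grp: "comm_group ?H" by (simp add: complex_inner_product_space_def)
  interpret H: comm_group ?H by (rule grp)
  have sc: "vscale V 1 x = x" "vscale V a x \<in> vecs V"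
    "vscale V (a + b) x = vadd V (vscale V a x) (vscale V b x)" if "x \<in> vecs V" for x a b
    using ip that by (auto simp: complex_inner_product_space_def)
  \<comment> \<open>The rule 0 x = 0 is not among the axioms of the space; it follows from 0 x + 0 x
    = 0 x by cancellation. It makes (-1) x the additive inverse, so \<open>W\<close> is closed under
    inverses.\<close>
  have neg: "vadd V (vscale V (-1) x) x = vzero V" if x: "x \<in> vecs V" for x
  proof -
    have "vadd V (vscale V 0 x) (vscale V 0 x) = vscale V 0 x"
      using sc(3)[OF x, of 0 0] by simp
    then have "vscale V 0 x = vzero V"
      using H.r_cancel_one[of "vscale V 0 x" "vscale V 0 x"] sc(2)[OF x] by simp
    then show ?thesis using sc(3)[OF x, of "-1" 1] sc(1)[OF x] by simp
  qed
  have "comm_group ?W"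
  proof (rule comm_groupI)
    fix x y z
    assume "x \<in> carrier ?W" "y \<in> carrier ?W"
      "z \<in> carrier ?W"
    then have *: "x \<in> carrier ?H" "y \<in> carrier ?H" "z \<in> carrier ?H" using W by auto
    show "x \<otimes>\<^bsub>?W\<^esub> y \<otimes>\<^bsub>?W\<^esub> z =
      x \<otimes>\<^bsub>?W\<^esub> (y \<otimes>\<^bsub>?W\<^esub> z)"
      using H.m_assoc[OF *] by simp
  next
    fix x y
    assume "x \<in> carrier ?W" "y \<in> carrier ?W"
    then have *: "x \<in> carrier ?H" "y \<in> carrier ?H" using W by auto
    show "x \<otimes>\<^bsub>?W\<^esub> y = y \<otimes>\<^bsub>?W\<^esub> x"
      using H.m_comm[OF *] by simp
  next
    fix x
    assume x: "x \<in> carrier ?W"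
    then have *: "x \<in> carrier ?H" using W by auto
    show "\<one>\<^bsub>?W\<^esub> \<otimes>\<^bsub>?W\<^esub> x = x"
      using H.l_one[OF *] by simp
    show "\<exists>y\<in>carrier ?W.
        y \<otimes>\<^bsub>?W\<^esub> x = \<one>\<^bsub>?W\<^esub>"
      using x * neg[of x] scale[of x "-1"] by (intro bexI[of _ "vscale V (-1) x"]) auto
  qed (use add zero in auto)
  then have "complex_inner_product_space (V\<lparr>vecs := W\<rparr>)"
  proof -
    note c = ip[unfolded complex_inner_product_space_def, THEN conjunct2]
    note c2 = c[THEN conjunct2, THEN conjunct1, THEN bspec, THEN bspec]
    have s: "vscale V 1 x = x" "vscale V a (vscale V b x) = vscale V (a * b) x"
      "vscale V (a + b) x = vadd V (vscale V a x) (vscale V b x)" if "x \<in> W" for x a b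
      using c[THEN conjunct1, THEN bspec, of x] that W by auto
    have t: "vscale V a (vadd V x y) = vadd V (vscale V a x) (vscale V a y)"
      "vinner V x (vscale V a y) = a * vinner V x y" "vinner V y x = cnj (vinner V x y)"
      if "x \<in> W" "y \<in> W" for x y a
      using c2[OF subsetD[OF W that(1)] subsetD[OF W that(2)]] by auto
    have u: "vinner V x (vadd V y z) = vinner V x y + vinner V x z" if "x \<in> W" "y \<in> W" "z \<in> W" for x y z
      using c2[OF subsetD[OF W that(1)] subsetD[OF W that(2)]] subsetD[OF W that(3)] by auto
    have p: "Re (vinner V x x) > 0" if "x \<in> W" "x \<noteq> vzero V" for x
      using c[THEN conjunct2, THEN conjunct2, THEN bspec, of x] that W by auto
    assume cg: "comm_group \<lparr>carrier = W, mult = vadd V, one = vzero V\<rparr>"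
    have eqs: "vecs (V\<lparr>vecs := W\<rparr>) = W" "vadd (V\<lparr>vecs := W\<rparr>) = vadd V"
      "vzero (V\<lparr>vecs := W\<rparr>) = vzero V" "vscale (V\<lparr>vecs := W\<rparr>) = vscale V"
      "vinner (V\<lparr>vecs := W\<rparr>) = vinner V" by simp_all
    show ?thesis
      unfolding complex_inner_product_space_def eqs
      by (intro conjI ballI allI impI cg s scale t u p)
  qed
  moreover have "vdist (V\<lparr>vecs := W\<rparr>) = vdist V"
    by (simp add: vdist_def vnorm_def fun_eq_iff)
  ultimately show ?thesis
    unfolding hilbert_space_def
  proof (intro conjI allI impI)
    fix s :: "nat \<Rightarrow> 'a"
    assume d: "vdist (V\<lparr>vecs := W\<rparr>) = vdist V" and s: "\<forall>n. s n \<in> vecs (V\<lparr>vecs := W\<rparr>)"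
      and cauchy: "\<forall>e>0. \<exists>N. \<forall>m\<ge>N. \<forall>n\<ge>N. vdist (V\<lparr>vecs := W\<rparr>) (s m) (s n) < e"
    have "\<forall>n. s n \<in> vecs V" using s W by auto
    then obtain x where x: "x \<in> vecs V" "(\<lambda>n. vdist V (s n) x) \<longlonglongrightarrow> 0"
      using V cauchy unfolding d hilbert_space_def by blast
    then have "x \<in> W" using s closed[of s x] by simp
    then show "\<exists>x\<in>vecs (V\<lparr>vecs := W\<rparr>). (\<lambda>n. vdist (V\<lparr>vecs := W\<rparr>) (s n) x) \<longlonglongrightarrow> 0"
      using x d by auto
  qed
qed

text \<open>The composition law is that of a right action, so that composing functions with
  \<open>\<tau> g\<close> gives a left representation. The laws are asked almost everywhere because
  the intended space is a fundamental domain inside the space of all matrices, with a measure for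
  which the rest is null.\<close>

locale measure_preserving_action = linear_group G for G :: "(real^'n^'n) set" +
  fixes M :: "'a measure" and \<tau> :: "real^'n^'n \<Rightarrow> 'a \<Rightarrow> 'a"
  assumes \<tau>_measurable [measurable]: "g \<in> G \<Longrightarrow> \<tau> g \<in> measurable M M"
    and \<tau>_preserving: "g \<in> G \<Longrightarrow> distr M M (\<tau> g) = M"
    and \<tau>_mult: "g \<in> G \<Longrightarrow> h \<in> G \<Longrightarrow> AE x in M. \<tau> h (\<tau> g x) = \<tau> (g ** h) x"
    and \<tau>_one: "AE x in M. \<tau> (mat 1) x = x"
begin

definition koopman :: "real^'n^'n \<Rightarrow> ('a \<Rightarrow> complex) set \<Rightarrow> ('a \<Rightarrow> complex) set" where
  "koopman g X = ae_class M (\<lambda>x. ae_rep X (\<tau> g x))"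

definition koopman_dist2 :: "('a \<Rightarrow> complex) set \<Rightarrow> real^'n^'n \<Rightarrow> real^'n^'n \<Rightarrow> real" where
  "koopman_dist2 X h g = (vdist (l2 M) (koopman h X) (koopman g X))\<^sup>2"

text \<open>The vectors with continuous orbit map. Continuity of all orbit maps would call for a
  density argument; with this subspace it has to be checked only for the one function to which
  property (T) is applied.\<close>

definition continuous_vectors :: "('a \<Rightarrow> complex) set set" where
  "continuous_vectors =
    {X \<in> vecs (l2 M). \<forall>g\<in>G. ((\<lambda>h. koopman_dist2 X h g) \<longlongrightarrow> 0) (at g within G)}"

lemma AE_comp: "g \<in> G \<Longrightarrow> AE x in M. P x \<Longrightarrow> AE x in M. P (\<tau> g x)"
  using AE_distrD[OF \<tau>_measurable] \<tau>_preserving by metis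

lemma sq_integrable_comp:
  assumes "g \<in> G" "sq_integrable M f"
  shows "sq_integrable M (\<lambda>x. f (\<tau> g x))"
proof -
  note [measurable] = sq_integrable_measurable[OF assms(2)] \<tau>_measurable[OF assms(1)]
  have "integrable (distr M M (\<tau> g)) (\<lambda>x. (cmod (f x))\<^sup>2)"
    using assms by (simp add: \<tau>_preserving sq_integrable_def)
  then have "integrable M (\<lambda>x. (cmod (f (\<tau> g x)))\<^sup>2)"
    by (subst (asm) integrable_distr_eq) measurable
  then show ?thesis by (simp add: sq_integrable_def)
qed

lemma integral_comp:
  fixes f :: "'a \<Rightarrow> 'b::{banach, second_countable_topology}"
  assumes g: "g \<in> G" and f: "f \<in> borel_measurable M"
  shows "(\<integral>x. f (\<tau> g x) \<partial>M) = (\<integral>x. f x \<partial>M)"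
  using integral_distr[OF \<tau>_measurable[OF g] f] \<tau>_preserving[OF g] by simp

lemma koopman_class:
  assumes g: "g \<in> G" and f: "sq_integrable M f"
  shows "koopman g (ae_class M f) = ae_class M (\<lambda>x. f (\<tau> g x))"
  unfolding koopman_def
  by (subst ae_class_eq_iff)
    (use AE_comp[OF g ae_rep_class(2)[OF f]] sq_integrable_comp[OF g f]
      sq_integrable_comp[OF g ae_rep_class(1)[OF f]] in \<open>simp_all add: sq_integrable_measurable\<close>)

lemma koopman_vecs: "g \<in> G \<Longrightarrow> X \<in> vecs (l2 M) \<Longrightarrow> koopman g X \<in> vecs (l2 M)"
  by (metis koopman_class l2_vecsE l2_vecsI sq_integrable_comp)

lemma koopman_mult:
  assumes g: "g \<in> G" and h: "h \<in> G" and X: "X \<in> vecs (l2 M)"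
  shows "koopman (g ** h) X = koopman g (koopman h X)"
proof -
  obtain f where f: "X = ae_class M f" "sq_integrable M f" using X by (rule l2_vecsE)
  have "koopman g (koopman h X) = ae_class M (\<lambda>x. f (\<tau> h (\<tau> g x)))"
    using f g h by (simp add: koopman_class sq_integrable_comp)
  also have "\<dots> = ae_class M (\<lambda>x. f (\<tau> (g ** h) x))"
  proof (subst ae_class_eq_iff)
    show "AE x in M. f (\<tau> h (\<tau> g x)) = f (\<tau> (g ** h) x)"
      using \<tau>_mult[OF g h] by eventually_elim simp
    show "(\<lambda>x. f (\<tau> h (\<tau> g x))) \<in> borel_measurable M" "(\<lambda>x. f (\<tau> (g ** h) x)) \<in> borel_measurable M"
      using f g h sq_integrable_comp[OF g sq_integrable_comp[OF h f(2)]]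
        sq_integrable_comp[of "g ** h" f] by (simp_all add: sq_integrable_measurable)
  qed
  finally show ?thesis using f g h by (simp add: koopman_class)
qed

lemma koopman_one:
  assumes X: "X \<in> vecs (l2 M)"
  shows "koopman (mat 1) X = X"
proof -
  obtain f where f: "X = ae_class M f" "sq_integrable M f" using X by (rule l2_vecsE)
  have "AE x in M. f (\<tau> (mat 1) x) = f x" using \<tau>_one by eventually_elim simp
  then show ?thesis
    using f sq_integrable_comp[of "mat 1" f]
    by (simp add: koopman_class ae_class_eq_iff sq_integrable_measurable)
qed

lemma koopman_vadd:
  assumes g: "g \<in> G" and X: "X \<in> vecs (l2 M)" and Y: "Y \<in> vecs (l2 M)"
  shows "koopman g (vadd (l2 M) X Y) = vadd (l2 M) (koopman g X) (koopman g Y)"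
proof -
  obtain f where f: "X = ae_class M f" "sq_integrable M f" using X by (rule l2_vecsE)
  obtain h where h: "Y = ae_class M h" "sq_integrable M h" using Y by (rule l2_vecsE)
  show ?thesis using f h g by (simp add: vadd_l2 koopman_class sq_integrable_add sq_integrable_comp)
qed

lemma koopman_vscale:
  assumes g: "g \<in> G" and X: "X \<in> vecs (l2 M)"
  shows "koopman g (vscale (l2 M) a X) = vscale (l2 M) a (koopman g X)"
proof -
  obtain f where f: "X = ae_class M f" "sq_integrable M f" using X by (rule l2_vecsE)
  show ?thesis using f g by (simp add: vscale_l2 koopman_class sq_integrable_scale sq_integrable_comp)
qed

lemma koopman_vinner:
  assumes g: "g \<in> G" and X: "X \<in> vecs (l2 M)" and Y: "Y \<in> vecs (l2 M)"
  shows "vinner (l2 M) (koopman g X) (koopman g Y) = vinner (l2 M) X Y"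
proof -
  obtain f where f: "X = ae_class M f" "sq_integrable M f" using X by (rule l2_vecsE)
  obtain h where h: "Y = ae_class M h" "sq_integrable M h" using Y by (rule l2_vecsE)
  show ?thesis
    using f h g integral_comp[OF g, of "\<lambda>x. cnj (f x) * h x"]
    by (simp add: vinner_l2 koopman_class sq_integrable_comp integrable_cnj_mult borel_measurable_integrable)
qed

lemma koopman_vdist:
  assumes g: "g \<in> G" and X: "X \<in> vecs (l2 M)" and Y: "Y \<in> vecs (l2 M)"
  shows "(vdist (l2 M) (koopman g X) (koopman g Y))\<^sup>2 = (vdist (l2 M) X Y)\<^sup>2"
proof -
  obtain f where f: "X = ae_class M f" "sq_integrable M f" using X by (rule l2_vecsE)
  obtain h where h: "Y = ae_class M h" "sq_integrable M h" using Y by (rule l2_vecsE)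
  have "(\<lambda>x. (cmod (f x - h x))\<^sup>2) \<in> borel_measurable M"
    using f h by (intro borel_measurable_integrable) (use sq_integrable_diff[OF f(2) h(2)] in \<open>simp add: sq_integrable_def\<close>)
  then show ?thesis
    using f h g integral_comp[OF g, of "\<lambda>x. (cmod (f x - h x))\<^sup>2"]
    by (simp add: vdist_l2 koopman_class sq_integrable_comp)
qed

lemma koopman_dist2_nonneg: "0 \<le> koopman_dist2 X h g"
  by (simp add: koopman_dist2_def)

lemma koopman_dist2_vadd:
  assumes X: "X \<in> vecs (l2 M)" and Y: "Y \<in> vecs (l2 M)" and g: "g \<in> G" and h: "h \<in> G"
  shows "koopman_dist2 (vadd (l2 M) X Y) h g \<le> 2 * koopman_dist2 X h g + 2 * koopman_dist2 Y h g"
proof -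
  obtain u where u: "X = ae_class M u" "sq_integrable M u" using X by (rule l2_vecsE)
  obtain v where v: "Y = ae_class M v" "sq_integrable M v" using Y by (rule l2_vecsE)
  note s = sq_integrable_comp[OF g u(2)] sq_integrable_comp[OF h u(2)]
    sq_integrable_comp[OF g v(2)] sq_integrable_comp[OF h v(2)]
  have i: "integrable M (\<lambda>x. (cmod (u (\<tau> h x) - u (\<tau> g x)))\<^sup>2)"
    "integrable M (\<lambda>x. (cmod (v (\<tau> h x) - v (\<tau> g x)))\<^sup>2)"
    "integrable M (\<lambda>x. (cmod (u (\<tau> h x) + v (\<tau> h x) - (u (\<tau> g x) + v (\<tau> g x))))\<^sup>2)"
    using sq_integrable_diff[OF s(2,1)] sq_integrable_diff[OF s(4,3)]
      sq_integrable_diff[OF sq_integrable_add[OF s(2,4)] sq_integrable_add[OF s(1,3)]]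
    by (simp_all add: sq_integrable_def)
  have "(\<integral>x. (cmod (u (\<tau> h x) + v (\<tau> h x) - (u (\<tau> g x) + v (\<tau> g x))))\<^sup>2 \<partial>M) \<le>
      (\<integral>x. 2 * (cmod (u (\<tau> h x) - u (\<tau> g x)))\<^sup>2 + 2 * (cmod (v (\<tau> h x) - v (\<tau> g x)))\<^sup>2 \<partial>M)"
  proof (rule integral_mono)
    fix x
    show "(cmod (u (\<tau> h x) + v (\<tau> h x) - (u (\<tau> g x) + v (\<tau> g x))))\<^sup>2 \<le>
      2 * (cmod (u (\<tau> h x) - u (\<tau> g x)))\<^sup>2 + 2 * (cmod (v (\<tau> h x) - v (\<tau> g x)))\<^sup>2"
      using cmod_add_sq_le[of "u (\<tau> h x) - u (\<tau> g x)" "v (\<tau> h x) - v (\<tau> g x)"]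
      by (simp add: algebra_simps)
  qed (use i in auto)
  then show ?thesis
    using i s u v g h
    by (simp add: koopman_dist2_def vadd_l2 koopman_class sq_integrable_add vdist_l2)
qed

lemma koopman_dist2_vscale:
  assumes X: "X \<in> vecs (l2 M)" and g: "g \<in> G" and h: "h \<in> G"
  shows "koopman_dist2 (vscale (l2 M) a X) h g = (cmod a)\<^sup>2 * koopman_dist2 X h g"
proof -
  obtain u where u: "X = ae_class M u" "sq_integrable M u" using X by (rule l2_vecsE)
  note s = sq_integrable_comp[OF g u(2)] sq_integrable_comp[OF h u(2)]
  have "(cmod (a * u (\<tau> h x) - a * u (\<tau> g x)))\<^sup>2 = (cmod a)\<^sup>2 * (cmod (u (\<tau> h x) - u (\<tau> g x)))\<^sup>2" for x
    by (simp add: norm_mult power_mult_distrib flip: right_diff_distrib)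
  then show ?thesis
    using s u g h by (simp add: koopman_dist2_def vscale_l2 koopman_class sq_integrable_scale vdist_l2)
qed

lemma tendsto_zero_if_eventually_le:
  fixes f b :: "'c \<Rightarrow> real"
  assumes "(b \<longlongrightarrow> 0) F" "\<forall>\<^sub>F x in F. f x \<le> b x" "\<And>x. 0 \<le> f x"
  shows "(f \<longlongrightarrow> 0) F"
  by (rule tendsto_sandwich[OF always_eventually assms(2) tendsto_const assms(1)]) (simp add: assms(3))

lemma eventually_in_within: "\<forall>\<^sub>F h in at g within G. h \<in> G"
  by (simp add: eventually_at_filter)

lemma continuous_vectors_subset: "continuous_vectors \<subseteq> vecs (l2 M)"
  by (auto simp: continuous_vectors_def)

lemma continuous_vectors_zero: "vzero (l2 M) \<in> continuous_vectors"
proof -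
  have "koopman_dist2 (vzero (l2 M)) h g = 0" if "h \<in> G" "g \<in> G" for h g
    using that by (simp add: koopman_dist2_def vzero_l2 koopman_class sq_integrable_zero vdist_l2)
  then have "((\<lambda>h. koopman_dist2 (vzero (l2 M)) h g) \<longlongrightarrow> 0) (at g within G)" if "g \<in> G" for g
    using that by (intro tendsto_eventually eventually_mono[OF eventually_in_within]) auto
  then show ?thesis by (simp add: continuous_vectors_def vzero_l2 l2_vecsI sq_integrable_zero)
qed

lemma continuous_vectors_vadd:
  assumes X: "X \<in> continuous_vectors" and Y: "Y \<in> continuous_vectors"
  shows "vadd (l2 M) X Y \<in> continuous_vectors"
proof -
  have v: "X \<in> vecs (l2 M)" "Y \<in> vecs (l2 M)" using X Y by (auto simp: continuous_vectors_def)
  have "((\<lambda>h. koopman_dist2 (vadd (l2 M) X Y) h g) \<longlongrightarrow> 0) (at g within G)" if g: "g \<in> G" for g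
  proof (rule tendsto_zero_if_eventually_le)
    show "((\<lambda>h. 2 * koopman_dist2 X h g + 2 * koopman_dist2 Y h g) \<longlongrightarrow> 0) (at g within G)"
      using X Y g by (auto simp: continuous_vectors_def intro!: tendsto_eq_intros)
    show "\<forall>\<^sub>F h in at g within G. koopman_dist2 (vadd (l2 M) X Y) h g \<le> 2 * koopman_dist2 X h g + 2 * koopman_dist2 Y h g"
      using eventually_in_within by (rule eventually_mono) (rule koopman_dist2_vadd[OF v g])
  qed (rule koopman_dist2_nonneg)
  moreover have "vadd (l2 M) X Y \<in> vecs (l2 M)"
    using v by (metis l2_vecsE l2_vecsI sq_integrable_add vadd_l2)
  ultimately show ?thesis by (simp add: continuous_vectors_def)
qed

lemma continuous_vectors_vscale:
  assumes X: "X \<in> continuous_vectors"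
  shows "vscale (l2 M) a X \<in> continuous_vectors"
proof -
  have v: "X \<in> vecs (l2 M)" using X by (auto simp: continuous_vectors_def)
  have "((\<lambda>h. koopman_dist2 (vscale (l2 M) a X) h g) \<longlongrightarrow> 0) (at g within G)" if g: "g \<in> G" for g
  proof (rule tendsto_zero_if_eventually_le)
    show "((\<lambda>h. (cmod a)\<^sup>2 * koopman_dist2 X h g) \<longlongrightarrow> 0) (at g within G)"
      using X g by (auto simp: continuous_vectors_def intro!: tendsto_eq_intros)
    show "\<forall>\<^sub>F h in at g within G. koopman_dist2 (vscale (l2 M) a X) h g \<le> (cmod a)\<^sup>2 * koopman_dist2 X h g"
      using eventually_in_within by (rule eventually_mono) (simp add: koopman_dist2_vscale[OF v g])
  qed (rule koopman_dist2_nonneg)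
  moreover have "vscale (l2 M) a X \<in> vecs (l2 M)"
    using v by (metis l2_vecsE l2_vecsI sq_integrable_scale vscale_l2)
  ultimately show ?thesis by (simp add: continuous_vectors_def)
qed

text \<open>Translating the vector by \<open>k\<close> shifts the parameter of its orbit map:
  continuity of the orbit map of \<open>X\<close> at g k gives that of the translated vector at
  g.\<close>

lemma continuous_vectors_koopman:
  assumes X: "X \<in> continuous_vectors" and k: "k \<in> G"
  shows "koopman k X \<in> continuous_vectors"
proof -
  have v: "X \<in> vecs (l2 M)" using X by (auto simp: continuous_vectors_def)
  have "((\<lambda>h. koopman_dist2 (koopman k X) h g) \<longlongrightarrow> 0) (at g within G)" if g: "g \<in> G" for g
  proof (rule tendsto_zero_if_eventually_le)
    have "filterlim (\<lambda>h. h ** k) (at (g ** k) within G) (at g within G)"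
      unfolding filterlim_at
    proof (intro conjI tendsto_intros)
      have "\<forall>\<^sub>F h in at g within G. h \<in> G \<and> h \<noteq> g" by (simp add: eventually_at_filter)
      then show "\<forall>\<^sub>F h in at g within G. h ** k \<in> G \<and> h ** k \<noteq> g ** k"
        by (rule eventually_mono) (use k in \<open>metis cancel(5) mult_in\<close>)
    qed
    moreover have "((\<lambda>h. koopman_dist2 X h (g ** k)) \<longlongrightarrow> 0) (at (g ** k) within G)"
      using X g k by (simp add: continuous_vectors_def)
    ultimately show "((\<lambda>h. koopman_dist2 X (h ** k) (g ** k)) \<longlongrightarrow> 0) (at g within G)"
      by (rule filterlim_compose[rotated])
    show "\<forall>\<^sub>F h in at g within G. koopman_dist2 (koopman k X) h g \<le> koopman_dist2 X (h ** k) (g ** k)"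
      using eventually_in_within
      by (rule eventually_mono) (use v g k in \<open>simp add: koopman_dist2_def koopman_mult\<close>)
  qed (rule koopman_dist2_nonneg)
  then show ?thesis using koopman_vecs[OF k v] by (simp add: continuous_vectors_def)
qed

lemma continuous_vectors_closed:
  assumes s: "\<And>n :: nat. s n \<in> continuous_vectors" and X: "X \<in> vecs (l2 M)"
    and lim: "(\<lambda>n. vdist (l2 M) (s n) X) \<longlonglongrightarrow> 0"
  shows "X \<in> continuous_vectors"
proof -
  have v: "s n \<in> vecs (l2 M)" for n using s by (auto simp: continuous_vectors_def)
  have "((\<lambda>h. koopman_dist2 X h g) \<longlongrightarrow> 0) (at g within G)" if g: "g \<in> G" for g
  proof (rule order_tendstoI)
    fix e :: real assume "e > 0"
    \<comment> \<open>The fractions of \<open>e\<close> used below match two applications of the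
      squared triangle inequality: 2 (e/12) + 4 (e/8) + 4 (e/12) = e.\<close>
    have "(\<lambda>n. (vdist (l2 M) (s n) X)\<^sup>2) \<longlonglongrightarrow> 0\<^sup>2" by (intro tendsto_intros lim)
    then have "\<forall>\<^sub>F n in sequentially. (vdist (l2 M) (s n) X)\<^sup>2 < e / 12"
      by (rule order_tendstoD) (use \<open>e > 0\<close> in simp)
    then obtain n where n: "(vdist (l2 M) (s n) X)\<^sup>2 < e / 12"
      by (auto simp: eventually_sequentially)
    have n': "(vdist (l2 M) X (s n))\<^sup>2 < e / 12"
    proof -
      obtain f where f: "X = ae_class M f" "sq_integrable M f" using X by (rule l2_vecsE)
      obtain u where u: "s n = ae_class M u" "sq_integrable M u" using v by (rule l2_vecsE)
      show ?thesis using n f u by (simp add: vdist_l2 norm_minus_commute)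
    qed
    have "((\<lambda>h. koopman_dist2 (s n) h g) \<longlongrightarrow> 0) (at g within G)"
      using s g by (simp add: continuous_vectors_def)
    then have "\<forall>\<^sub>F h in at g within G. koopman_dist2 (s n) h g < e / 8"
      by (rule order_tendstoD) (use \<open>e > 0\<close> in simp)
    with eventually_in_within show "\<forall>\<^sub>F h in at g within G. koopman_dist2 X h g < e"
    proof eventually_elim
      fix h assume h: "h \<in> G" and d: "koopman_dist2 (s n) h g < e / 8"
      have "koopman_dist2 X h g \<le> 2 * (vdist (l2 M) (koopman h X) (koopman h (s n)))\<^sup>2
          + 2 * (vdist (l2 M) (koopman h (s n)) (koopman g X))\<^sup>2"
        unfolding koopman_dist2_def using g h v X by (intro vdist_l2_sq_triangle koopman_vecs)
      moreover have "(vdist (l2 M) (koopman h (s n)) (koopman g X))\<^sup>2 \<le> 2 * koopman_dist2 (s n) h g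
          + 2 * (vdist (l2 M) (koopman g (s n)) (koopman g X))\<^sup>2"
        unfolding koopman_dist2_def using g h v X by (intro vdist_l2_sq_triangle koopman_vecs)
      ultimately show "koopman_dist2 X h g < e"
        using n n' d koopman_vdist[OF h X v, of n] koopman_vdist[OF g v X, of n] by linarith
    qed
  next
    fix e :: real assume "e < 0"
    then show "\<forall>\<^sub>F h in at g within G. e < koopman_dist2 X h g"
      by (intro always_eventually allI less_le_trans[OF _ koopman_dist2_nonneg])
  qed
  then show ?thesis using X by (simp add: continuous_vectors_def)
qed

text \<open>Restricting to the continuous vectors makes strong continuity hold by definition.\<close>

definition continuous_part :: "('a \<Rightarrow> complex) set hilbert" where
  "continuous_part = (l2 M)\<lparr>vecs := continuous_vectors\<rparr>"

lemma hilbert_space_continuous_part: "hilbert_space continuous_part"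
  unfolding continuous_part_def
  by (rule hilbert_subspace[OF hilbert_space_l2 continuous_vectors_subset continuous_vectors_zero
        continuous_vectors_vadd continuous_vectors_vscale continuous_vectors_closed])

lemma vdist_continuous_part: "vdist continuous_part = vdist (l2 M)"
  and vnorm_continuous_part: "vnorm continuous_part = vnorm (l2 M)"
  by (simp_all add: continuous_part_def vdist_def vnorm_def fun_eq_iff)

lemma unitary_rep_koopman: "unitary_rep G continuous_part koopman"
  unfolding unitary_rep_def
proof (intro conjI ballI)
  note sub = continuous_vectors_subset[THEN subsetD]
  fix g assume g: "g \<in> G"
  show "unitary_operator continuous_part (koopman g)"
    unfolding unitary_operator_def
  proof (intro conjI ballI allI)
    have inv: "koopman (matrix_inv g) (koopman g X) = X" "koopman g (koopman (matrix_inv g) X) = X"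
      if "X \<in> vecs (l2 M)" for X
      using that g by (simp_all add: koopman_one flip: koopman_mult)
    show "bij_betw (koopman g) (vecs continuous_part) (vecs continuous_part)"
      by (rule bij_betwI[where g = "koopman (matrix_inv g)"])
        (use g inv sub in \<open>auto simp: continuous_part_def continuous_vectors_koopman\<close>)
  qed (use g sub in \<open>auto simp: continuous_part_def koopman_vadd koopman_vscale koopman_vinner\<close>)
next
  fix g h X assume "g \<in> G" "h \<in> G" "X \<in> vecs continuous_part"
  then show "koopman (g ** h) X = koopman g (koopman h X)"
    using continuous_vectors_subset by (intro koopman_mult) (auto simp: continuous_part_def)
next
  fix X g assume X: "X \<in> vecs continuous_part" and g: "g \<in> G"
  then have "((\<lambda>h. sqrt (koopman_dist2 X h g)) \<longlongrightarrow> sqrt 0) (at g within G)"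
    by (intro tendsto_real_sqrt) (simp add: continuous_part_def continuous_vectors_def)
  moreover have "\<forall>\<^sub>F h in at g within G. sqrt (koopman_dist2 X h g) = vdist continuous_part (koopman h X) (koopman g X)"
    using eventually_in_within
  proof (rule eventually_mono)
    fix h assume h: "h \<in> G"
    have "X \<in> vecs (l2 M)" using X continuous_vectors_subset by (auto simp: continuous_part_def)
    then show "sqrt (koopman_dist2 X h g) = vdist continuous_part (koopman h X) (koopman g X)"
      using g h by (simp add: koopman_dist2_def vdist_continuous_part vdist_l2_nonneg koopman_vecs)
  qed
  ultimately show "((\<lambda>h. vdist continuous_part (koopman h X) (koopman g X)) \<longlongrightarrow> 0) (at g within G)"
    by (simp add: filterlim_cong)
qed

text \<open>The passage from representations back to functions: the hypotheses on \<open>f\<close>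
  make its class a continuous, almost invariant vector, and the conclusion mentions functions and
  measures only.\<close>

lemma invariant_function:
  assumes T: "hilbert_space continuous_part \<Longrightarrow> unitary_rep G continuous_part koopman \<Longrightarrow>
      has_almost_invariant_vector Q \<epsilon> continuous_part koopman \<Longrightarrow> has_invariant_vector G continuous_part koopman"
    and f: "sq_integrable M f" and pos: "(\<integral>x. (cmod (f x))\<^sup>2 \<partial>M) > 0"
    and cont: "\<And>g. g \<in> G \<Longrightarrow> ((\<lambda>h. \<integral>x. (cmod (f (\<tau> h x) - f (\<tau> g x)))\<^sup>2 \<partial>M) \<longlongrightarrow> 0) (at g within G)"
    and Q: "Q \<subseteq> G" and \<epsilon>: "\<epsilon> > 0"
    and almost: "\<And>q. q \<in> Q \<Longrightarrow> (\<integral>x. (cmod (f (\<tau> q x) - f x))\<^sup>2 \<partial>M) < \<epsilon>\<^sup>2 * (\<integral>x. (cmod (f x))\<^sup>2 \<partial>M)"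
  shows "\<exists>s. sq_integrable M s \<and> \<not> (AE x in M. s x = 0) \<and> (\<forall>g\<in>G. AE x in M. s (\<tau> g x) = s x)"
proof -
  define X where "X = ae_class M f"
  have X: "X \<in> continuous_vectors"
  proof -
    have "((\<lambda>h. koopman_dist2 X h g) \<longlongrightarrow> 0) (at g within G)" if g: "g \<in> G" for g
    proof (rule tendsto_zero_if_eventually_le[OF cont[OF g]])
      show "\<forall>\<^sub>F h in at g within G. koopman_dist2 X h g \<le> (\<integral>x. (cmod (f (\<tau> h x) - f (\<tau> g x)))\<^sup>2 \<partial>M)"
        using eventually_in_within
        by (rule eventually_mono) (use f g in \<open>simp add: koopman_dist2_def X_def koopman_class vdist_l2 sq_integrable_comp\<close>)
    qed (rule koopman_dist2_nonneg)
    then show ?thesis by (simp add: continuous_vectors_def X_def l2_vecsI f)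
  qed
  have "has_almost_invariant_vector Q \<epsilon> continuous_part koopman"
    unfolding has_almost_invariant_vector_def vdist_continuous_part vnorm_continuous_part
  proof (intro bexI[of _ X] conjI ballI)
    show "X \<in> vecs continuous_part" using X by (simp add: continuous_part_def)
    show "X \<noteq> vzero continuous_part"
    proof
      assume "X = vzero continuous_part"
      then have "AE x in M. f x = 0"
        using f by (simp add: X_def continuous_part_def vzero_l2 ae_class_eq_iff sq_integrable_measurable)
      then have "AE x in M. (cmod (f x))\<^sup>2 = 0" by eventually_elim simp
      then have "(\<integral>x. (cmod (f x))\<^sup>2 \<partial>M) = 0" by (rule integral_eq_zero_AE)
      then show False using pos by simp
    qed
    fix q assume q: "q \<in> Q"
    then have qG: "q \<in> G" using Q by auto
    have "(vdist (l2 M) (koopman q X) X)\<^sup>2 < (\<epsilon> * vnorm (l2 M) X)\<^sup>2"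
      using almost[OF q] f qG by (simp add: X_def koopman_class vdist_l2 vnorm_l2 sq_integrable_comp power_mult_distrib)
    then show "vdist (l2 M) (koopman q X) X < \<epsilon> * vnorm (l2 M) X"
      by (rule power2_less_imp_less) (use \<epsilon> f in \<open>simp add: X_def vnorm_l2_nonneg\<close>)
  qed
  then have "has_invariant_vector G continuous_part koopman"
    by (intro T hilbert_space_continuous_part unitary_rep_koopman)
  then obtain Y where Y: "Y \<in> continuous_vectors" "Y \<noteq> vzero (l2 M)" "\<And>g. g \<in> G \<Longrightarrow> koopman g Y = Y"
    by (auto simp: has_invariant_vector_def continuous_part_def)
  obtain s where s: "Y = ae_class M s" "sq_integrable M s"
    using Y(1) continuous_vectors_subset by (auto elim: l2_vecsE)
  have "\<not> (AE x in M. s x = 0)"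
    using Y(2) s by (simp add: vzero_l2 ae_class_eq_iff sq_integrable_measurable)
  moreover have "AE x in M. s (\<tau> g x) = s x" if "g \<in> G" for g
    using Y(3)[OF that] s that sq_integrable_comp[OF that s(2)]
    by (simp add: koopman_class ae_class_eq_iff sq_integrable_measurable)
  ultimately show ?thesis using s by blast
qed

end

section \<open>Invariant volumes on coset spaces\<close>

lemma discrete_linear_groupI:
  fixes G :: "(real^'n^'n) set"
  assumes G: "linear_group G" and D: "discrete_subgroup G D"
  shows "discrete_linear_group G D"
proof -
  interpret linear_group G by (rule G)
  have sub: "subgroup G GL" by (simp add: subgroup_GL_iff invertible)
  have D': "subgroup D (grp G)" "discrete D" using D by (auto simp: discrete_subgroup_def)
  have "subgroup D GL"
    using group.incl_subgroup[OF group_GL sub D'(1)] .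
  then show ?thesis
    using D' subgroup.subset[OF D'(1)]
    by unfold_locales (auto simp: subgroup_GL_iff)
qed

context discrete_linear_group
begin

lemma subgroup_G: "subgroup G GL"
  by (simp add: subgroup_GL_iff invertible)

lemma subgroup_D: "subgroup D (grp G)"
proof (rule group.group_incl_imp_subgroup)
  show "group (grp G)" using group.subgroup_imp_group[OF group_GL subgroup_G] .
  show "D \<subseteq> carrier (grp G)" using D_subset by simp
  have "subgroup D GL" by (auto simp: subgroup_GL_iff invertible)
  then show "group (grp G\<lparr>carrier := D\<rparr>)"
    using group.subgroup_imp_group[OF group_GL] by simp
qed

definition orb :: "real^'n^'n \<Rightarrow> (real^'n^'n) set" where
  "orb x = (\<lambda>\<gamma>. \<gamma> ** x) ` D"

definition cosets :: "(real^'n^'n) set set" where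
  "cosets = rcosets\<^bsub>grp G\<^esub> D"

definition coset_sets :: "(real^'n^'n) set set set" where
  "coset_sets = sigma_sets cosets {U. openin (coset_topology G D) U}"

lemma cosets_eq: "cosets = orb ` G"
  by (auto simp: cosets_def RCOSETS_def r_coset_def orb_def GL_def)

lemma in_orb_self: "x \<in> orb x"
  unfolding orb_def by (rule image_eqI[of _ _ "mat 1"]) auto

lemma orb_eq:
  assumes x: "x \<in> G" and y: "y \<in> orb x"
  shows "orb y = orb x"
proof -
  obtain \<gamma> where \<gamma>: "\<gamma> \<in> D" "y = \<gamma> ** x" using y by (auto simp: orb_def)
  have "orb y \<subseteq> orb x" using \<gamma> by (auto simp: orb_def matrix_mul_assoc)
  moreover have "\<delta> ** x \<in> orb y" if "\<delta> \<in> D" for \<delta>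
    unfolding orb_def using \<gamma> that
    by (intro image_eqI[of _ _ "\<delta> ** matrix_inv \<gamma>"]) (auto simp flip: matrix_mul_assoc)
  then have "orb x \<subseteq> orb y" by (auto simp: orb_def)
  ultimately show ?thesis by blast
qed

lemma orb_subset: "x \<in> G \<Longrightarrow> orb x \<subseteq> G"
  by (auto simp: orb_def)

lemma in_coset_eq: "c \<in> cosets \<Longrightarrow> x \<in> c \<Longrightarrow> orb x = c \<and> x \<in> G"
  unfolding cosets_eq by (metis imageE orb_eq orb_subset subsetD)

lemma coset_translate: "c \<in> cosets \<Longrightarrow> x \<in> c \<Longrightarrow> \<gamma> \<in> D \<Longrightarrow> \<gamma> ** x \<in> c"
  by (metis imageI in_coset_eq orb_def)

lemma Union_cosets_iff:
  assumes "A \<subseteq> cosets" "x \<in> G"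
  shows "x \<in> \<Union>A \<longleftrightarrow> orb x \<in> A"
proof
  assume "x \<in> \<Union>A"
  then obtain c where "c \<in> A" "x \<in> c" by blast
  then show "orb x \<in> A" using in_coset_eq[of c x] assms by auto
qed (use in_orb_self in blast)

lemma Union_cosets_subset: "A \<subseteq> cosets \<Longrightarrow> \<Union>A \<subseteq> G"
  using in_coset_eq by (meson Sup_least subsetD subsetI)

lemma Union_orb_image:
  assumes "S \<subseteq> G"
  shows "\<Union>(orb ` S) = sat S"
proof
  show "\<Union>(orb ` S) \<subseteq> sat S"
  proof
    fix x assume "x \<in> \<Union>(orb ` S)"
    then obtain s \<gamma> where "s \<in> S" "\<gamma> \<in> D" "x = \<gamma> ** s" by (auto simp: orb_def)
    then show "x \<in> sat S" using assms unfolding sat_def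
      by (auto intro!: bexI[of _ "matrix_inv \<gamma>"])
  qed
  show "sat S \<subseteq> \<Union>(orb ` S)"
  proof
    fix x assume "x \<in> sat S"
    then obtain \<gamma> where "\<gamma> \<in> D" "\<gamma> ** x \<in> S" "x \<in> G" by (auto simp: sat_def)
    moreover from this have "x \<in> orb (\<gamma> ** x)"
      unfolding orb_def by (intro image_eqI[of _ _ "matrix_inv \<gamma>"]) auto
    ultimately show "x \<in> \<Union>(orb ` S)" by blast
  qed
qed

lemma sat_Union: "A \<subseteq> cosets \<Longrightarrow> sat (\<Union>A) = \<Union>A"
proof
  assume A: "A \<subseteq> cosets"
  show "sat (\<Union>A) \<subseteq> \<Union>A"
  proof
    fix x assume "x \<in> sat (\<Union>A)"
    then obtain \<gamma> c where *: "x \<in> G" "\<gamma> \<in> D" "c \<in> A" "\<gamma> ** x \<in> c" by (auto simp: sat_def)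
    then have "x \<in> c" using A coset_translate[of c "\<gamma> ** x" "matrix_inv \<gamma>"] by auto
    then show "x \<in> \<Union>A" using *(3) by blast
  qed
  show "\<Union>A \<subseteq> sat (\<Union>A)" by (intro subset_sat Union_cosets_subset A)
qed

lemma orb_image_Union: "A \<subseteq> cosets \<Longrightarrow> orb ` \<Union>A = A"
proof
  assume A: "A \<subseteq> cosets"
  show "orb ` \<Union>A \<subseteq> A" using Union_cosets_iff[OF A] Union_cosets_subset[OF A] by auto
  show "A \<subseteq> orb ` \<Union>A"
  proof
    fix c assume c: "c \<in> A"
    then obtain x where "x \<in> G" "c = orb x" using A by (auto simp: cosets_eq)
    then show "c \<in> orb ` \<Union>A" using c in_orb_self by blast
  qed
qed

lemma openin_cosets:
  "openin (coset_topology G D) U \<longleftrightarrow> U \<subseteq> cosets \<and> openin (top_of_set G) (\<Union>U)"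
  by (simp add: openin_coset_topology subgroup_G subgroup_D cosets_def)

lemma sigma_algebra_coset_sets: "sigma_algebra cosets coset_sets"
  unfolding coset_sets_def by (rule sigma_algebra_sigma_sets) (auto simp: openin_cosets)

lemma coset_setsD:
  assumes "A \<in> coset_sets"
  shows "A \<subseteq> cosets" "\<Union>A \<in> sets borel"
proof -
  have "A \<subseteq> cosets \<and> \<Union>A \<in> sets borel"
    using assms unfolding coset_sets_def
  proof (induction rule: sigma_sets.induct)
    case (Basic a)
    then obtain T where "open T" "\<Union>a = G \<inter> T" "a \<subseteq> cosets"
      by (auto simp: openin_cosets openin_open)
    then show ?case using borel_open[of T] by auto
  next
    case (Compl a)
    have "\<Union>(cosets - a) = G - \<Union>a"
    proof (intro equalityI subsetI)
      fix x assume x: "x \<in> \<Union>(cosets - a)"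
      then have "x \<in> G" using Union_cosets_subset[of "cosets - a"] by blast
      then show "x \<in> G - \<Union>a"
        using x Union_cosets_iff[of "cosets - a" x] Union_cosets_iff[of a x] Compl.IH by auto
    next
      fix x assume x: "x \<in> G - \<Union>a"
      then show "x \<in> \<Union>(cosets - a)"
        using Union_cosets_iff[of "cosets - a" x] Union_cosets_iff[of a x] Compl.IH
        by (auto simp: cosets_eq)
    qed
    then show ?case using Compl.IH by auto
  next
    case (Union a)
    then have "\<Union>(\<Union>i. a i) = (\<Union>i. \<Union>(a i))" by blast
    moreover have "(\<Union>i. \<Union>(a i)) \<in> sets borel" using Union.IH by (intro sets.countable_UN) auto
    moreover have "(\<Union>i. a i) \<subseteq> cosets" using Union.IH by blast
    ultimately show ?case by simp
  qed auto
  then show "A \<subseteq> cosets" "\<Union>A \<in> sets borel" by auto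
qed

lemma orb_inj_on_small:
  assumes "small P" "P \<subseteq> G"
  shows "inj_on orb P"
proof (rule inj_onI)
  fix x y assume *: "x \<in> P" "y \<in> P" "orb x = orb y"
  then have "y \<in> orb x" using in_orb_self by simp
  then obtain \<gamma> where \<gamma>: "\<gamma> \<in> D" "y = \<gamma> ** x" by (auto simp: orb_def)
  then have "\<gamma> = mat 1" using * assms by (intro smallD[of P _ x]) auto
  then show "x = y" using \<gamma> by simp
qed

text \<open>On a small set \<open>orb\<close> is injective, so images commute with complements, and
  induction over the Borel sets works inside each \<open>U i\<close>. An open subset of
  \<open>G\<close> has an open image because its saturation is a union of translates. Countably many
  \<open>U i\<close> cover \<open>G\<close>.\<close>

lemma orb_image_in_coset_sets:
  assumes E: "E \<in> sets borel" and EG: "E \<subseteq> G"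
  shows "orb ` E \<in> coset_sets"
proof -
  interpret sigma_algebra cosets coset_sets by (rule sigma_algebra_coset_sets)
  obtain U :: "nat \<Rightarrow> (real^'n^'n) set"
    where U: "\<And>i. open (U i)" "\<And>i. small (U i \<inter> G)" "G \<subseteq> (\<Union>i. U i)"
    using small_cover by blast
  have op: "orb ` (S \<inter> G) \<in> coset_sets" if "open S" for S
  proof -
    have "sat (S \<inter> G) = G \<inter> (\<Union>\<gamma>\<in>D. (\<lambda>x. \<gamma> ** x) -` S)" by (auto simp: sat_def)
    moreover have "open (\<Union>\<gamma>\<in>D. (\<lambda>x. \<gamma> ** x) -` S)"
      by (intro open_UN ballI open_vimage that continuous_intros)
    ultimately have "openin (top_of_set G) (\<Union>(orb ` (S \<inter> G)))"
      by (auto simp: Union_orb_image openin_open)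
    then have "openin (coset_topology G D) (orb ` (S \<inter> G))"
      by (auto simp: openin_cosets cosets_eq)
    then show ?thesis unfolding coset_sets_def by (intro sigma_sets.Basic) simp
  qed
  have *: "orb ` (B \<inter> (U i \<inter> G)) \<in> coset_sets" if "B \<in> sets borel" for B i
  proof -
    from that have "B \<in> sigma_sets UNIV {S. open S}" by (simp add: borel_def)
    then show ?thesis
    proof (induction rule: sigma_sets.induct)
      case (Basic a)
      then show ?case using op[of "a \<inter> U i"] U(1)[of i] by (simp add: open_Int Int_assoc)
    next
      case (Compl a)
      have "orb ` ((UNIV - a) \<inter> (U i \<inter> G)) = orb ` (U i \<inter> G) - orb ` (a \<inter> (U i \<inter> G))"
        using inj_on_image_set_diff[OF orb_inj_on_small[OF U(2)[of i]], of "U i \<inter> G" "a \<inter> (U i \<inter> G)"]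
        by (auto simp: Diff_Int)
      then show ?case using Compl.IH op[OF U(1)] by (simp add: Diff)
    next
      case (Union a)
      have "orb ` ((\<Union>j. a j) \<inter> (U i \<inter> G)) = (\<Union>j. orb ` (a j \<inter> (U i \<inter> G)))" by blast
      also have "\<dots> \<in> coset_sets" using Union.IH by (intro countable_UN) auto
      finally show ?case .
    qed simp
  qed
  have "E = (\<Union>i. E \<inter> (U i \<inter> G))" using EG U(3) by auto
  then have "orb ` E = (\<Union>i. orb ` (E \<inter> (U i \<inter> G)))" by (metis image_UN)
  also have "\<dots> \<in> coset_sets" using *[OF E] by (intro countable_UN) auto
  finally show ?thesis .
qed

text \<open>The Borel sets of the quotient topology coincide with the quotient of the Borel sets.
  For the direction from right to left, \<open>A\<close> is recovered as the image under
  \<open>orb\<close> of its union.\<close>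

lemma coset_sets_iff: "A \<in> coset_sets \<longleftrightarrow> A \<subseteq> cosets \<and> \<Union>A \<in> sets borel"
  using coset_setsD orb_image_in_coset_sets[of "\<Union>A"] orb_image_Union[of A] Union_cosets_subset[of A]
  by metis

lemma r_coset_eq: "c #>\<^bsub>grp G\<^esub> g = (\<lambda>x. x ** g) ` c"
  by (auto simp: r_coset_def GL_def)

lemma translate_coset: "x \<in> G \<Longrightarrow> (\<lambda>x. x ** g) ` orb x = orb (x ** g)"
  by (auto simp: orb_def image_image matrix_mul_assoc)

lemma translate_in_cosets: "c \<in> cosets \<Longrightarrow> g \<in> G \<Longrightarrow> (\<lambda>x. x ** g) ` c \<in> cosets"
  by (auto simp: cosets_eq translate_coset)

lemma translate_cosets_inverse:
  assumes "c \<in> cosets" "g \<in> G"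
  shows "(\<lambda>x. x ** matrix_inv g) ` (\<lambda>x. x ** g) ` c = c" "(\<lambda>x. x ** g) ` (\<lambda>x. x ** matrix_inv g) ` c = c"
  using assms by (simp_all add: image_image)

lemma Union_translate_cosets:
  assumes A: "A \<subseteq> cosets" and g: "g \<in> G"
  shows "\<Union>((\<lambda>c. (\<lambda>x. x ** g) ` c) ` A) = {x \<in> G. x ** matrix_inv g \<in> \<Union>A}"
proof
  show "\<Union>((\<lambda>c. (\<lambda>x. x ** g) ` c) ` A) \<subseteq> {x \<in> G. x ** matrix_inv g \<in> \<Union>A}"
    using A g Union_cosets_subset[OF A] by auto
  show "{x \<in> G. x ** matrix_inv g \<in> \<Union>A} \<subseteq> \<Union>((\<lambda>c. (\<lambda>x. x ** g) ` c) ` A)"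
  proof
    fix x assume "x \<in> {x \<in> G. x ** matrix_inv g \<in> \<Union>A}"
    then obtain c where "c \<in> A" "x ** matrix_inv g \<in> c" by auto
    moreover from this have "x \<in> (\<lambda>x. x ** g) ` c" using g by (intro image_eqI[of _ _ "x ** matrix_inv g"]) auto
    ultimately show "x \<in> \<Union>((\<lambda>c. (\<lambda>x. x ** g) ` c) ` A)" by blast
  qed
qed

lemma translate_coset_sets:
  assumes A: "A \<in> coset_sets" and g: "g \<in> G"
  shows "(\<lambda>c. (\<lambda>x. x ** g) ` c) ` A \<in> coset_sets"
proof -
  note [measurable] = coset_setsD(2)[OF A]
  have "{x \<in> space borel. x \<in> G \<and> x ** matrix_inv g \<in> \<Union>A} \<in> sets borel" by measurable
  then show ?thesis
    unfolding coset_sets_iff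
    using Union_translate_cosets[OF coset_setsD(1)[OF A] g] translate_in_cosets[OF _ g] coset_setsD(1)[OF A]
    by auto
qed

end

section \<open>The Haar measure defined by a finite invariant volume, and the converse\<close>

locale finite_covolume = discrete_linear_group G D
  for G :: "(real^'n^'n) set" and D +
  fixes \<nu> :: "(real^'n^'n) set measure"
  assumes volume: "invariant_volume G D \<nu>" and finite: "emeasure \<nu> (space \<nu>) < \<infinity>"
begin

definition orbit_count :: "(real^'n^'n) set \<Rightarrow> (real^'n^'n) set \<Rightarrow> ennreal" where
  "orbit_count E c = emeasure (count_space UNIV) (E \<inter> c)"

text \<open>Weil's integration formula read as a definition: the volume on the coset space combined
  with counting measure along each coset.\<close>

definition haar :: "(real^'n^'n) measure" where
  "haar = measure_of UNIV (sets borel) (\<lambda>E. \<integral>\<^sup>+c. orbit_count E c \<partial>\<nu>)"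

lemma sets_\<nu>: "sets \<nu> = coset_sets"
  using volume by (simp add: invariant_volume_def coset_sets_def cosets_def)

lemma space_\<nu>: "space \<nu> = cosets"
proof -
  interpret sigma_algebra cosets coset_sets by (rule sigma_algebra_coset_sets)
  show ?thesis
    using sets.top[of \<nu>] sets.sets_into_space[of cosets \<nu>] top coset_setsD(1)[of "space \<nu>"]
    unfolding sets_\<nu> by auto
qed

lemma emeasure_\<nu>_translate:
  assumes "g \<in> G" "A \<in> coset_sets"
  shows "emeasure \<nu> ((\<lambda>c. (\<lambda>x. x ** g) ` c) ` A) = emeasure \<nu> A"
proof -
  have "sets \<nu> = coset_sets" by (rule sets_\<nu>)
  then show ?thesis
    using volume assms unfolding invariant_volume_def r_coset_eq by blast
qed

lemma orbit_count_le_1: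
  assumes P: "small P" and c: "c \<in> cosets"
  shows "orbit_count (E \<inter> P) c = indicator (orb ` (E \<inter> P \<inter> G)) c"
proof (cases "E \<inter> P \<inter> c = {}")
  case True
  then have "c \<notin> orb ` (E \<inter> P \<inter> G)" using in_orb_self by auto
  then show ?thesis using True by (simp add: orbit_count_def)
next
  case False
  then obtain x where x: "x \<in> E" "x \<in> P" "x \<in> c" by auto
  have "y = x" if y: "y \<in> P" "y \<in> c" for y
  proof -
    have "y \<in> orb x" using in_coset_eq[OF c] x y by blast
    then obtain \<gamma> where \<gamma>: "\<gamma> \<in> D" "y = \<gamma> ** x" by (auto simp: orb_def)
    then have "\<gamma> = mat 1" using smallD[OF P, of \<gamma> x] x y by simp
    then show "y = x" using \<gamma> by simp
  qed
  then have "E \<inter> P \<inter> c = {x}" using x by blast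
  moreover have "c \<in> orb ` (E \<inter> P \<inter> G)" using in_coset_eq[OF c x(3)] x by blast
  ultimately show ?thesis by (simp add: orbit_count_def)
qed

lemma orbit_count_UN:
  assumes "disjoint_family E"
  shows "orbit_count (\<Union>i :: nat. E i) c = (\<Sum>i. orbit_count (E i) c)"
proof -
  have "disjoint_family (\<lambda>i. E i \<inter> c)" using assms by (auto simp: disjoint_family_on_def)
  then have "(\<Sum>i. emeasure (count_space UNIV) (E i \<inter> c)) = emeasure (count_space UNIV) (\<Union>i. E i \<inter> c)"
    by (intro suminf_emeasure) auto
  then show ?thesis by (simp add: orbit_count_def)
qed

text \<open>Cut into countably many disjoint small pieces, \<open>E\<close> meets a coset at most
  once per piece, so the count is a sum of indicators of measurable sets of cosets.\<close>

lemma measurable_orbit_count: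
  assumes E [measurable]: "E \<in> sets borel"
  shows "orbit_count E \<in> borel_measurable \<nu>"
proof -
  obtain U :: "nat \<Rightarrow> (real^'n^'n) set"
    where U: "\<And>i. open (U i)" "\<And>i. small (U i \<inter> G)" "G \<subseteq> (\<Union>i. U i)"
    using small_cover by blast
  define P where "P = disjointed (\<lambda>i. U i \<inter> G)"
  have P: "P i \<subseteq> U i \<inter> G" "P i \<in> sets borel" for i
    unfolding P_def using disjointed_subset[of "\<lambda>i. U i \<inter> G"] U(1)
      sets.range_disjointed_sets'[of "\<lambda>i. U i \<inter> G" borel] by (auto simp: image_subset_iff)
  have UP: "(\<Union>i. P i) = G"
    unfolding P_def UN_disjointed_eq using U(3) by auto
  have disj: "disjoint_family (\<lambda>i. E \<inter> P i)"
    using disjoint_family_disjointed[of "\<lambda>i. U i \<inter> G"] by (auto simp: P_def disjoint_family_on_def)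
  have sm: "small (P i)" for i using small_mono[OF U(2) P(1)] .
  have "orbit_count E c = (\<Sum>i. indicator (orb ` (E \<inter> P i \<inter> G)) c)" if c: "c \<in> cosets" for c
  proof -
    have "E \<inter> c = (\<Union>i. E \<inter> P i) \<inter> c" using in_coset_eq[OF c] UP by blast
    then have "orbit_count E c = orbit_count (\<Union>i. E \<inter> P i) c" by (simp add: orbit_count_def)
    also have "\<dots> = (\<Sum>i. indicator (orb ` (E \<inter> P i \<inter> G)) c)"
      unfolding orbit_count_UN[OF disj] orbit_count_le_1[OF sm c] ..
    finally show ?thesis .
  qed
  moreover have "orb ` (E \<inter> P i \<inter> G) \<in> sets \<nu>" for i
    unfolding sets_\<nu> using P(2) by (intro orb_image_in_coset_sets) auto
  then have "(\<lambda>c. \<Sum>i. indicator (orb ` (E \<inter> P i \<inter> G)) c :: ennreal) \<in> borel_measurable \<nu>"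
    by measurable
  ultimately show ?thesis by (subst measurable_cong) (auto simp: space_\<nu>)
qed

lemma sets_haar: "sets haar = sets borel"
  unfolding haar_def using sets.sigma_sets_eq[of borel] by (subst sets_measure_of) auto

lemma emeasure_haar:
  assumes "E \<in> sets borel"
  shows "emeasure haar E = (\<integral>\<^sup>+c. orbit_count E c \<partial>\<nu>)"
proof (rule emeasure_measure_of[OF haar_def])
  show "positive (sets haar) (\<lambda>E. \<integral>\<^sup>+c. orbit_count E c \<partial>\<nu>)"
    by (simp add: positive_def orbit_count_def)
  show "countably_additive (sets haar) (\<lambda>E. \<integral>\<^sup>+c. orbit_count E c \<partial>\<nu>)"
    unfolding countably_additive_def
  proof (intro allI impI)
    fix E :: "nat \<Rightarrow> (real^'n^'n) set" assume E: "range E \<subseteq> sets haar" "disjoint_family E"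
    have "(\<Sum>i. \<integral>\<^sup>+c. orbit_count (E i) c \<partial>\<nu>) = (\<integral>\<^sup>+c. (\<Sum>i. orbit_count (E i) c) \<partial>\<nu>)"
      using E by (intro nn_integral_suminf[symmetric] measurable_orbit_count) (auto simp: sets_haar)
    then show "(\<Sum>i. \<integral>\<^sup>+c. orbit_count (E i) c \<partial>\<nu>) = (\<integral>\<^sup>+c. orbit_count (\<Union> (range E)) c \<partial>\<nu>)"
      by (simp add: orbit_count_UN[OF E(2)])
  qed
qed (use assms sets_haar in auto)

lemma orbit_count_image:
  assumes "inj_on f (E \<inter> c)" "f ` (E \<inter> c) = E' \<inter> c'"
  shows "orbit_count E' c' = orbit_count E c"
proof -
  have "emeasure (count_space UNIV) (f ` (E \<inter> c)) = emeasure (count_space UNIV) (E \<inter> c)"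
    using assms(1) by (cases "finite (E \<inter> c)") (simp_all add: card_image finite_image_iff)
  then show ?thesis by (simp add: orbit_count_def assms(2))
qed

lemma emeasure_haar_small:
  assumes "P \<in> sets borel" "small P"
  shows "emeasure haar P \<le> emeasure \<nu> (space \<nu>)"
proof -
  have "emeasure haar P \<le> (\<integral>\<^sup>+c. 1 \<partial>\<nu>)"
    unfolding emeasure_haar[OF assms(1)]
    using orbit_count_le_1[OF assms(2), of _ UNIV]
    by (intro nn_integral_mono) (auto simp: space_\<nu> indicator_def)
  then show ?thesis by simp
qed

lemma emeasure_haar_fundamental:
  assumes F: "fundamental F"
  shows "emeasure haar F = emeasure \<nu> (space \<nu>)"
proof -
  have F': "F \<in> sets borel" "small F" "F \<subseteq> G" "sat F = G"
    using F by (auto simp: fundamental_def)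
  have "orb ` (UNIV \<inter> F \<inter> G) = cosets"
    using Union_orb_image[OF F'(3)] F' orb_image_Union[of "orb ` F"] cosets_eq
    by (auto simp: Int_absorb2 image_mono)
  then have "(\<integral>\<^sup>+c. orbit_count F c \<partial>\<nu>) = (\<integral>\<^sup>+c. 1 \<partial>\<nu>)"
    using orbit_count_le_1[OF F'(2), of _ UNIV] by (intro nn_integral_cong) (auto simp: space_\<nu>)
  then show ?thesis using emeasure_haar[OF F'(1)] by simp
qed

text \<open>Right multiplication by \<open>g\<close> carries the counted points of a coset c
  bijectively to the points of \<open>B\<close> on the coset c g, and \<open>\<nu>\<close> is
  invariant under the map from c to c g.\<close>

lemma emeasure_haar_translate:
  assumes g: "g \<in> G" and B [measurable]: "B \<in> sets borel" and BG: "B \<subseteq> G"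
  shows "emeasure haar {x \<in> G. x ** g \<in> B} = emeasure haar B"
proof -
  let ?R = "\<lambda>c. (\<lambda>x. x ** g) ` c"
  have "{x \<in> space borel. x \<in> G \<and> x ** g \<in> B} \<in> sets borel" by measurable
  then have m: "{x \<in> G. x ** g \<in> B} \<in> sets borel" by simp
  have vim: "?R -` A \<inter> space \<nu> = (\<lambda>c. (\<lambda>x. x ** matrix_inv g) ` c) ` A" if "A \<in> coset_sets" for A
  proof
    have A: "A \<subseteq> cosets" using coset_setsD that by blast
    show "?R -` A \<inter> space \<nu> \<subseteq> (\<lambda>c. (\<lambda>x. x ** matrix_inv g) ` c) ` A"
    proof
      fix c assume c: "c \<in> ?R -` A \<inter> space \<nu>"
      then have "c = (\<lambda>x. x ** matrix_inv g) ` ?R c"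
        using translate_cosets_inverse(1)[of c g] g by (simp add: space_\<nu>)
      then show "c \<in> (\<lambda>c. (\<lambda>x. x ** matrix_inv g) ` c) ` A" using c by blast
    qed
    show "(\<lambda>c. (\<lambda>x. x ** matrix_inv g) ` c) ` A \<subseteq> ?R -` A \<inter> space \<nu>"
    proof
      fix c' assume "c' \<in> (\<lambda>c. (\<lambda>x. x ** matrix_inv g) ` c) ` A"
      then obtain c where c: "c \<in> A" "c' = (\<lambda>x. x ** matrix_inv g) ` c" by blast
      then have "?R c' = c" "c' \<in> cosets"
        using A translate_cosets_inverse(2)[of c g] translate_in_cosets[of c "matrix_inv g"] g by auto
      then show "c' \<in> ?R -` A \<inter> space \<nu>" using c by (simp add: space_\<nu>)
    qed
  qed
  have R [measurable]: "?R \<in> measurable \<nu> \<nu>"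
  proof (rule measurableI)
    show "?R c \<in> space \<nu>" if "c \<in> space \<nu>" for c
      using that translate_in_cosets[of c g] g by (simp add: space_\<nu>)
    show "?R -` A \<inter> space \<nu> \<in> sets \<nu>" if "A \<in> sets \<nu>" for A
      using that vim[of A] translate_coset_sets[of A "matrix_inv g"] g by (simp add: sets_\<nu>)
  qed
  have distr: "distr \<nu> \<nu> ?R = \<nu>"
  proof (rule measure_eqI)
    fix A assume "A \<in> sets (distr \<nu> \<nu> ?R)"
    then have A: "A \<in> sets \<nu>" by simp
    then show "emeasure (distr \<nu> \<nu> ?R) A = emeasure \<nu> A"
      using vim[of A] emeasure_\<nu>_translate[of "matrix_inv g" A] g R by (simp add: emeasure_distr sets_\<nu>)
  qed simp
  have "(\<integral>\<^sup>+c. orbit_count {x \<in> G. x ** g \<in> B} c \<partial>\<nu>) = (\<integral>\<^sup>+c. orbit_count B (?R c) \<partial>\<nu>)"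
  proof (rule nn_integral_cong)
    fix c assume "c \<in> space \<nu>"
    then have c: "c \<in> cosets" by (simp add: space_\<nu>)
    show "orbit_count {x \<in> G. x ** g \<in> B} c = orbit_count B (?R c)"
    proof (rule orbit_count_image[symmetric, where f = "\<lambda>x. x ** g"])
      show "inj_on (\<lambda>x. x ** g) ({x \<in> G. x ** g \<in> B} \<inter> c)"
        using g by (intro inj_onI) (metis cancel(5))
      show "(\<lambda>x. x ** g) ` ({x \<in> G. x ** g \<in> B} \<inter> c) = B \<inter> ?R c"
        using in_coset_eq[OF c] by auto
    qed
  qed
  also have "\<dots> = (\<integral>\<^sup>+c. orbit_count B c \<partial>distr \<nu> \<nu> ?R)"
    by (rule nn_integral_distr[symmetric, OF R]) (simp add: measurable_orbit_count B)
  finally show ?thesis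
    by (simp add: emeasure_haar m B distr)
qed

text \<open>Left multiplication by an element of \<open>D\<close> permutes the points of every
  coset, so the counts agree coset by coset, already before integration.\<close>

lemma emeasure_haar_left:
  assumes \<gamma>: "\<gamma> \<in> D" and B [measurable]: "B \<in> sets borel" and BG: "B \<subseteq> G"
  shows "emeasure haar {x \<in> G. \<gamma> ** x \<in> B} = emeasure haar B"
proof -
  have "{x \<in> space borel. x \<in> G \<and> \<gamma> ** x \<in> B} \<in> sets borel" by measurable
  then have m: "{x \<in> G. \<gamma> ** x \<in> B} \<in> sets borel" by simp
  have "(\<integral>\<^sup>+c. orbit_count {x \<in> G. \<gamma> ** x \<in> B} c \<partial>\<nu>) = (\<integral>\<^sup>+c. orbit_count B c \<partial>\<nu>)"
  proof (rule nn_integral_cong)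
    fix c assume "c \<in> space \<nu>"
    then have c: "c \<in> cosets" by (simp add: space_\<nu>)
    show "orbit_count {x \<in> G. \<gamma> ** x \<in> B} c = orbit_count B c"
    proof (rule orbit_count_image[symmetric, where f = "\<lambda>x. \<gamma> ** x"])
      show "inj_on (\<lambda>x. \<gamma> ** x) ({x \<in> G. \<gamma> ** x \<in> B} \<inter> c)"
        using \<gamma> by (intro inj_onI) (metis D_in cancel(3))
      show "(\<lambda>x. \<gamma> ** x) ` ({x \<in> G. \<gamma> ** x \<in> B} \<inter> c) = B \<inter> c"
      proof
        show "B \<inter> c \<subseteq> (\<lambda>x. \<gamma> ** x) ` ({x \<in> G. \<gamma> ** x \<in> B} \<inter> c)"
        proof
          fix y assume y: "y \<in> B \<inter> c"
          then have "matrix_inv \<gamma> ** y \<in> c" using coset_translate[OF c] \<gamma> by simp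
          then show "y \<in> (\<lambda>x. \<gamma> ** x) ` ({x \<in> G. \<gamma> ** x \<in> B} \<inter> c)"
            using y \<gamma> BG by (intro image_eqI[of _ _ "matrix_inv \<gamma> ** y"]) auto
        qed
      qed (use coset_translate[OF c] \<gamma> in auto)
    qed
  qed
  then show ?thesis by (simp add: emeasure_haar m B)
qed

lemma haar_discrete_haar: "haar_discrete G haar D"
proof
  show "sets haar = sets borel" by (rule sets_haar)
  have "(\<integral>\<^sup>+c. orbit_count (- G) c \<partial>\<nu>) = (\<integral>\<^sup>+c. 0 \<partial>\<nu>)"
  proof (rule nn_integral_cong)
    fix c assume "c \<in> space \<nu>"
    then have "- G \<inter> c = {}" using in_coset_eq by (auto simp: space_\<nu>)
    then show "orbit_count (- G) c = 0" by (simp add: orbit_count_def)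
  qed
  then show "emeasure haar (- G) = 0" by (subst emeasure_haar) (simp_all add: borel_comp)
  \<comment> \<open>Finitely many small open sets cover the compact set, and each of them meets a
    coset at most once, so its measure is at most the total volume.\<close>
  show "emeasure haar (bounded_part k) < \<infinity>" for k
  proof -
    obtain U :: "nat \<Rightarrow> (real^'n^'n) set"
      where U: "\<And>i. open (U i)" "\<And>i. small (U i \<inter> G)" "G \<subseteq> (\<Union>i. U i)"
      using small_cover by blast
    have "bounded_part k \<subseteq> (\<Union>i. U i)" using U(3) bounded_part_subset by blast
    then obtain I where I: "finite I" "bounded_part k \<subseteq> (\<Union>i\<in>I. U i)"
      using compactE_image[OF compact_bounded_part, of UNIV U] U(1) by auto
    then have "bounded_part k \<subseteq> (\<Union>i\<in>I. U i \<inter> G)" using bounded_part_subset by blast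
    then have "emeasure haar (bounded_part k) \<le> emeasure haar (\<Union>i\<in>I. U i \<inter> G)"
      using U(1) I(1) by (intro emeasure_mono) (auto simp: sets_haar)
    also have "\<dots> \<le> (\<Sum>i\<in>I. emeasure haar (U i \<inter> G))"
      using U(1) I(1) by (intro emeasure_subadditive_finite) (auto simp: sets_haar)
    also have "\<dots> \<le> (\<Sum>i\<in>I. emeasure \<nu> (space \<nu>))"
      using U(1,2) by (intro sum_mono emeasure_haar_small) auto
    also have "\<dots> < \<infinity>" using finite by (simp add: ennreal_mult_less_top of_nat_less_top)
    finally show ?thesis .
  qed
  obtain F where F: "fundamental F" using ex_fundamental by blast
  have "emeasure haar F \<le> emeasure haar G"
    using F by (intro emeasure_mono) (auto simp: fundamental_def sets_haar)
  moreover have "emeasure haar F \<noteq> 0"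
    using volume by (simp add: emeasure_haar_fundamental[OF F] invariant_volume_def)
  ultimately show "emeasure haar G \<noteq> 0" by auto
qed (use emeasure_haar_translate emeasure_haar_left in auto)

lemma bi_haar_haar: "bi_haar G haar"
proof -
  interpret haar_discrete G haar D by (rule haar_discrete_haar)
  obtain F where F: "fundamental F" using ex_fundamental by blast
  have fin: "emeasure haar F < \<infinity>" using finite by (simp add: emeasure_haar_fundamental[OF F])
  show ?thesis
    by unfold_locales (rule left_invariant_if_finite_covolume[OF F fin])
qed

end

text \<open>\<open>infinite_covolume\<close> speaks of all invariant volumes, so one of finite mass
  has to be exhibited: a set of cosets receives the measure of its representatives in
  \<open>F\<close>.\<close>

lemma (in haar_discrete) finite_volume_if_fundamental:
  assumes F: "fundamental F" and fin: "emeasure \<mu> F < \<infinity>"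
  shows "\<not> infinite_covolume G D"
proof
  assume inf: "infinite_covolume G D"
  have F': "F \<in> sets borel" "F \<subseteq> G" using F by (auto simp: fundamental_def)
  define \<nu> where "\<nu> = measure_of cosets {U. openin (coset_topology G D) U} (\<lambda>A. emeasure \<mu> (F \<inter> \<Union>A))"
  have sub: "{U. openin (coset_topology G D) U} \<subseteq> Pow cosets" by (auto simp: openin_cosets)
  have sets: "sets \<nu> = coset_sets" and space: "space \<nu> = cosets"
    unfolding \<nu>_def coset_sets_def using sub by (simp_all add: sets_measure_of space_measure_of)
  have em: "emeasure \<nu> A = emeasure \<mu> (F \<inter> \<Union>A)" if "A \<in> coset_sets" for A
  proof (rule emeasure_measure_of[OF \<nu>_def sub])
    show "positive (sets \<nu>) (\<lambda>A. emeasure \<mu> (F \<inter> \<Union>A))" by (simp add: positive_def)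
    show "countably_additive (sets \<nu>) (\<lambda>A. emeasure \<mu> (F \<inter> \<Union>A))"
      unfolding countably_additive_def
    proof (intro allI impI)
      fix A :: "nat \<Rightarrow> (real^'n^'n) set set" assume A: "range A \<subseteq> sets \<nu>" "disjoint_family A"
      have A': "A i \<subseteq> cosets" "\<Union>(A i) \<in> sets borel" for i
        using A(1) coset_setsD[of "A i"] by (auto simp: sets image_subset_iff)
      have "disjoint_family (\<lambda>i. F \<inter> \<Union>(A i))"
        unfolding disjoint_family_on_def
      proof (intro ballI impI equals0I)
        fix i j x assume "i \<noteq> j" and x: "x \<in> F \<inter> \<Union>(A i) \<inter> (F \<inter> \<Union>(A j))"
        then have "x \<in> G" "x \<in> \<Union>(A i)" "x \<in> \<Union>(A j)" using F'(2) by auto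
        then have "orb x \<in> A i \<inter> A j" using Union_cosets_iff[OF A'(1)] by blast
        then show False using A(2) \<open>i \<noteq> j\<close> by (auto simp: disjoint_family_on_def)
      qed
      moreover have "range (\<lambda>i. F \<inter> \<Union>(A i)) \<subseteq> sets \<mu>" using A'(2) F'(1) by auto
      ultimately have "(\<Sum>i. emeasure \<mu> (F \<inter> \<Union>(A i))) = emeasure \<mu> (\<Union>i. F \<inter> \<Union>(A i))"
        by (intro suminf_emeasure)
      also have "(\<Union>i. F \<inter> \<Union>(A i)) = F \<inter> \<Union>(\<Union>i. A i)" by blast
      finally show "(\<Sum>i. emeasure \<mu> (F \<inter> \<Union>(A i))) = emeasure \<mu> (F \<inter> \<Union>(\<Union>i. A i))" .
    qed
  qed (use that sets in simp)
  interpret sigma_algebra cosets coset_sets by (rule sigma_algebra_coset_sets)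
  have "\<Union>cosets = G" using Union_orb_image[of G] subset_sat[of G] sat_subset[of G] by (simp add: cosets_eq)
  then have tot: "emeasure \<nu> cosets = emeasure \<mu> F" using em[OF top] F' by (simp add: Int_absorb2)
  have "invariant_volume G D \<nu>"
    unfolding invariant_volume_def r_coset_eq space
  proof (intro conjI allI impI ballI)
    show "sets \<nu> = sigma_sets (rcosets\<^bsub>grp G\<^esub> D) {U. openin (coset_topology G D) U}"
      by (simp add: sets coset_sets_def cosets_def)
    show "emeasure \<nu> cosets \<noteq> 0" using fundamental_nonnull[OF F] by (simp add: tot)
    show "emeasure \<nu> C < \<infinity>" for C
      using emeasure_space[of \<nu> C] fin tot by (simp add: space)
    fix g A assume g: "g \<in> G" and "A \<in> sets \<nu>"
    then have A: "A \<in> coset_sets" by (simp add: sets)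
    then have A': "A \<subseteq> cosets" "\<Union>A \<in> sets borel" using coset_setsD by auto
    show "emeasure \<nu> ((\<lambda>c. (\<lambda>x. x ** g) ` c) ` A) = emeasure \<nu> A"
      using emeasure_fundamental_translate[OF F A'(2) sat_Union[OF A'(1)] inv_in[OF g]]
      by (simp only: em A translate_coset_sets g Union_translate_cosets A')
  qed
  then have "emeasure \<nu> (space \<nu>) = \<infinity>" using inf by (simp add: infinite_covolume_def)
  then show False using fin tot by (simp add: space)
qed

section \<open>Chabauty limits\<close>

text \<open>Failures for infinitely many n would give counterexamples along a subsequence of
  indices. By compactness they can be thinned out to a sequence convergent in \<open>K\<close>, for
  which the premise finds an index without failure.\<close>

lemma eventually_all_in_compact:
  fixes K :: "'a::metric_space set"
  assumes K: "compact K"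
    and P: "\<And>r x l. strict_mono r \<Longrightarrow> (\<And>k. x k \<in> K) \<Longrightarrow> x \<longlonglongrightarrow> l \<Longrightarrow> l \<in> K \<Longrightarrow> \<exists>k :: nat. P (r k) (x k)"
  shows "\<forall>\<^sub>F n in sequentially. \<forall>x\<in>K. P n x"
proof (rule ccontr)
  assume "\<not> ?thesis"
  then have "infinite {n. \<not> (\<forall>x\<in>K. P n x)}"
    by (simp add: eventually_cofinite flip: cofinite_eq_sequentially)
  then obtain r :: "nat \<Rightarrow> nat" where r: "strict_mono r" "\<And>k. r k \<in> {n. \<not> (\<forall>x\<in>K. P n x)}"
    using infinite_enumerate by blast
  then have "\<forall>k. \<exists>x\<in>K. \<not> P (r k) x" by auto
  then obtain x where x: "\<And>k. x k \<in> K" "\<And>k. \<not> P (r k) (x k)" by metis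
  have "seq_compact K" using K by (simp add: compact_eq_seq_compact_metric)
  moreover have "\<forall>k. x k \<in> K" using x by blast
  ultimately obtain l s where l: "l \<in> K" "strict_mono s" "(x \<circ> s) \<longlonglongrightarrow> l"
    by (rule seq_compactE)
  have "\<exists>k. P ((r \<circ> s) k) ((x \<circ> s) k)"
    by (rule P[OF strict_mono_o[OF r(1) l(2)] _ l(3) l(1)]) (simp add: x)
  then show False using x by simp
qed

context linear_group
begin

lemma compact_translates:
  assumes "compact K" "compact Q" "K \<subseteq> G" "Q \<subseteq> G"
  shows "compact ((\<lambda>(x, q). x ** matrix_inv q) ` (K \<times> Q))"
proof (intro compact_continuous_image compact_Times assms)
  have "continuous_on (K \<times> Q) (\<lambda>z. matrix_inv (snd z))"
    by (rule continuous_on_compose2[OF continuous_on_matrix_inv])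
      (use assms invertible in \<open>auto intro!: continuous_intros\<close>)
  then show "continuous_on (K \<times> Q) (\<lambda>(x, q). x ** matrix_inv q)"
    unfolding case_prod_unfold by (intro continuous_intros)
qed

text \<open>As h tends to \<open>g\<close>, the inverse of g^-1 h tends to 1, and compactness of
  \<open>K\<close> makes this uniform. The lemma serves the continuity of the orbit of an indicator
  function: only the relative displacement g^-1 h enters there.\<close>

lemma eventually_translate_subset:
  fixes K :: "(real^'n^'n) set"
  assumes K: "compact K" and W: "open W" "K \<subseteq> W" and g: "g \<in> G"
  shows "\<forall>\<^sub>F h in at g within G. \<forall>x\<in>K. x ** matrix_inv (matrix_inv g ** h) \<in> W"
proof (rule sequentially_imp_eventually_within, intro allI impI)
  fix h assume h: "(\<forall>n :: nat. h n \<in> G \<and> h n \<noteq> g) \<and> h \<longlonglongrightarrow> g"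
  show "\<forall>\<^sub>F n in sequentially. \<forall>x\<in>K. x ** matrix_inv (matrix_inv g ** h n) \<in> W"
  proof (rule eventually_all_in_compact[OF K])
    fix r :: "nat \<Rightarrow> nat" and x l
    assume r: "strict_mono r" and x: "x \<longlonglongrightarrow> l" "l \<in> K"
    have "(\<lambda>k. h (r k)) \<longlonglongrightarrow> g" using h r LIMSEQ_subseq_LIMSEQ[of h g r] by (simp add: comp_def)
    then have "(\<lambda>k. matrix_inv g ** h (r k)) \<longlonglongrightarrow> matrix_inv g ** g"
      by (rule tendsto_matrix_mult[OF tendsto_const])
    then have "(\<lambda>k. matrix_inv (matrix_inv g ** h (r k))) \<longlonglongrightarrow> matrix_inv (matrix_inv g ** g)"
      by (rule tendsto_matrix_inv) (use g in \<open>simp only: invertible mult_in inv_in\<close>)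
    then have "(\<lambda>k. x k ** matrix_inv (matrix_inv g ** h (r k))) \<longlonglongrightarrow> l ** matrix_inv (matrix_inv g ** g)"
      by (rule tendsto_matrix_mult[OF x(1)])
    moreover have "l ** matrix_inv (matrix_inv g ** g) = l"
      using g matrix_inv_eqI[of "mat 1 :: real^'n^'n" "mat 1"] by simp
    ultimately have "\<forall>\<^sub>F k in sequentially. x k ** matrix_inv (matrix_inv g ** h (r k)) \<in> W"
      using W x by (auto intro: topological_tendstoD)
    then show "\<exists>k. x k ** matrix_inv (matrix_inv g ** h (r k)) \<in> W"
      by (rule eventually_happens'[OF sequentially_bot])
  qed
qed

end

locale chabauty_limit = linear_group G for G :: "(real^'n^'n) set" +
  fixes H :: "nat \<Rightarrow> (real^'n^'n) set" and L :: "(real^'n^'n) set"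
  assumes H: "discrete_linear_group G (H n)" and L: "discrete_linear_group G L"
    and converges: "chabauty_converges G H L"
begin

lemma members_converging_to:
  assumes "x \<in> L"
  obtains h where "\<And>n. h n \<in> H n" "h \<longlonglongrightarrow> x"
  using converges assms unfolding chabauty_converges_def by metis

lemma subsequence_limit:
  assumes r: "strict_mono r" and y: "\<And>k. y k \<in> H (r k)" and lim: "y \<longlonglongrightarrow> x" and x: "x \<in> G"
  shows "x \<in> L"
proof -
  \<comment> \<open>Chabauty convergence is stated for full sequences; the indices outside
    \<open>range r\<close> are filled with 1, which lies in every \<open>H n\<close>.\<close>
  define h where "h n = (if n \<in> range r then y (inv_into UNIV r n) else mat 1)" for n
  have inj: "inj r" using r by (rule strict_mono_imp_inj_on)
  have "h n \<in> H n" for n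
    using y discrete_linear_group.D_one[OF H] by (auto simp: h_def inv_f_f[OF inj])
  moreover have "(h \<circ> r) \<longlonglongrightarrow> x"
    using lim by (simp add: h_def comp_def inv_f_f[OF inj])
  ultimately show ?thesis
    using converges r x unfolding chabauty_converges_def by blast
qed

lemma eventually_disjoint:
  assumes C: "compact C" "C \<subseteq> G" "C \<inter> L = {}"
  shows "\<forall>\<^sub>F n in sequentially. \<forall>x\<in>C. x \<notin> H n"
proof (rule eventually_all_in_compact[OF C(1)])
  fix r :: "nat \<Rightarrow> nat" and x l
  assume r: "strict_mono r" and x: "x \<longlonglongrightarrow> l" "l \<in> C"
  show "\<exists>k. x k \<notin> H (r k)"
  proof (rule ccontr)
    assume "\<not> ?thesis"
    then have "l \<in> L" using x C by (intro subsequence_limit[OF r _ x(1)]) auto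
    then show False using x C by auto
  qed
qed

text \<open>A nontrivial element of \<open>H n\<close> too close to 1 produces, by repeated
  squaring, an element of \<open>H n\<close> in the annulus \<open>C\<close>. That annulus is
  compact and disjoint from \<open>L\<close>, so \<open>H n\<close> misses it for large
  \<open>n\<close>.\<close>

lemma uniformly_discrete:
  obtains r where "r > 0" "\<forall>\<^sub>F n in sequentially. \<forall>h\<in>H n. norm (h - mat 1) < r \<longrightarrow> h = mat 1"
proof -
  obtain r0 where r0: "r0 > 0" "\<And>r g (S :: (real^'n^'n) set). \<lbrakk>0 < r; r \<le> r0; \<And>h. h \<in> S \<Longrightarrow> h ** h \<in> S;
      g \<in> S; g \<noteq> mat 1; norm (g - mat 1) < r\<rbrakk> \<Longrightarrow> \<exists>h\<in>S. r \<le> norm (h - mat 1) \<and> norm (h - mat 1) \<le> 3 * r"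
    using no_small_subgroups by metis
  obtain r1 where r1: "r1 > 0" "\<And>\<gamma>. \<gamma> \<in> L \<Longrightarrow> norm (\<gamma> - mat 1) < r1 \<Longrightarrow> \<gamma> = mat 1"
    using discrete_linear_group.ball_one[OF L] by metis
  have "(mat 1 :: real^'n^'n) \<in> {A. invertible A}" using invertible[OF one_in] by simp
  then obtain e where e: "e > 0" "ball (mat 1 :: real^'n^'n) e \<subseteq> {A. invertible A}"
    using open_invertible by (meson open_contains_ball)
  \<comment> \<open>\<open>r \<le> r0\<close> makes squaring hit the annulus,
    \<open>3 * r < r1\<close> keeps the annulus free of elements of \<open>L\<close>, and
    \<open>3 * r < e\<close> keeps limits of its points invertible, so that it is closed.\<close>
  define r where "r = min r0 (min r1 e / 4)"
  have r: "r > 0" "r \<le> r0" "3 * r < r1" "3 * r < e" using r0 r1 e by (auto simp: r_def min_def)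
  define C where "C = {h \<in> G. r \<le> norm (h - mat 1) \<and> norm (h - mat 1) \<le> 3 * r}"
  have "closed C"
    unfolding closed_sequential_limits
  proof (intro allI impI, elim conjE)
    fix f A assume f: "\<forall>n :: nat. f n \<in> C" and lim: "f \<longlonglongrightarrow> A"
    have l: "(\<lambda>n. norm (f n - mat 1)) \<longlonglongrightarrow> norm (A - mat 1)" by (intro tendsto_intros lim)
    have "norm (A - mat 1) \<le> 3 * r"
      by (rule LIMSEQ_le_const2[OF l]) (use f in \<open>auto simp: C_def\<close>)
    moreover have "r \<le> norm (A - mat 1)"
      by (rule LIMSEQ_le_const[OF l]) (use f in \<open>auto simp: C_def\<close>)
    moreover have "A \<in> ball (mat 1) e"
      using calculation(1) r by (simp add: dist_norm norm_minus_commute)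
    then have "invertible A" using e by auto
    then have "A \<in> G" using f by (intro limit_in[OF _ lim]) (auto simp: C_def)
    ultimately show "A \<in> C" by (simp add: C_def)
  qed
  moreover have "C \<subseteq> cball (mat 1) (3 * r)" by (auto simp: C_def dist_norm norm_minus_commute)
  then have "bounded C" using bounded_cball bounded_subset by blast
  ultimately have "compact C" by (simp add: compact_eq_bounded_closed)
  moreover have "C \<subseteq> G" by (auto simp: C_def)
  moreover have "h \<notin> L" if "h \<in> C" for h
    using r1(2)[of h] that r by (auto simp: C_def)
  then have "C \<inter> L = {}" by blast
  ultimately have ev: "\<forall>\<^sub>F n in sequentially. \<forall>x\<in>C. x \<notin> H n" by (rule eventually_disjoint)
  have "\<forall>\<^sub>F n in sequentially. \<forall>h\<in>H n. norm (h - mat 1) < r \<longrightarrow> h = mat 1"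
    using ev
  proof eventually_elim
    fix n assume n: "\<forall>x\<in>C. x \<notin> H n"
    interpret Hn: discrete_linear_group G "H n" by (rule H)
    show "\<forall>h\<in>H n. norm (h - mat 1) < r \<longrightarrow> h = mat 1"
    proof (intro ballI impI, rule ccontr)
      fix h assume h: "h \<in> H n" "norm (h - mat 1) < r" "h \<noteq> mat 1"
      have "\<exists>h\<in>H n. r \<le> norm (h - mat 1) \<and> norm (h - mat 1) \<le> 3 * r"
        by (rule r0(2)[of r "H n" h]) (use r h in auto)
      then obtain h' where h': "h' \<in> H n" "r \<le> norm (h' - mat 1)" "norm (h' - mat 1) \<le> 3 * r"
        by blast
      then have "h' \<in> C" by (simp add: C_def Hn.D_in)
      then show False using n h' by blast
    qed
  qed
  then show ?thesis by (rule that[OF r(1)])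
qed

text \<open>An element that moves a point of \<open>K\<close> into \<open>K\<close> lies in K K^-1.
  Near 1, nontrivial elements are excluded by uniform discreteness; the remaining part
  \<open>C\<close> of K K^-1 is compact, and smallness of \<open>K\<close> with respect to
  \<open>L\<close> says that it contains no element of \<open>L\<close>.\<close>

lemma eventually_small:
  assumes K: "compact K" "K \<subseteq> G" and sm: "discrete_linear_group.small L K"
  shows "\<forall>\<^sub>F n in sequentially. discrete_linear_group.small (H n) K"
proof -
  interpret L: discrete_linear_group G L by (rule L)
  obtain r where r: "r > 0" "\<forall>\<^sub>F n in sequentially. \<forall>h\<in>H n. norm (h - mat 1) < r \<longrightarrow> h = mat 1"
    by (rule uniformly_discrete)
  define C where "C = (\<lambda>(x, q). x ** matrix_inv q) ` (K \<times> K) \<inter> {A. r \<le> norm (A - mat 1)}"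
  have "closed {A :: real^'n^'n. r \<le> norm (A - mat 1)}"
    by (intro closed_Collect_le continuous_intros)
  then have "compact C"
    unfolding C_def using K by (intro compact_Int_closed compact_translates)
  moreover have "C \<subseteq> G" using K by (auto simp: C_def subset_iff)
  moreover have "C \<inter> L = {}"
  proof (intro equals0I)
    fix \<gamma> assume "\<gamma> \<in> C \<inter> L"
    then obtain x y where xy: "x \<in> K" "y \<in> K" "\<gamma> = y ** matrix_inv x" "\<gamma> \<in> L" "r \<le> norm (\<gamma> - mat 1)"
      by (auto simp: C_def)
    then have "\<gamma> ** x = y" using K(2) by auto
    then have "\<gamma> = mat 1" using L.smallD[OF sm, of \<gamma> x] xy by simp
    then show False using xy r by simp
  qed
  ultimately have "\<forall>\<^sub>F n in sequentially. \<forall>x\<in>C. x \<notin> H n" by (rule eventually_disjoint)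
  with r(2) show ?thesis
  proof eventually_elim
    fix n assume n: "\<forall>h\<in>H n. norm (h - mat 1) < r \<longrightarrow> h = mat 1" "\<forall>x\<in>C. x \<notin> H n"
    interpret Hn: discrete_linear_group G "H n" by (rule H)
    show "Hn.small K"
      unfolding Hn.small_def
    proof (intro ballI impI, rule ccontr)
      fix \<gamma> x assume \<gamma>: "\<gamma> \<in> H n" "x \<in> K" "\<gamma> ** x \<in> K" "\<gamma> \<noteq> mat 1"
      have "\<gamma> = (\<gamma> ** x) ** matrix_inv x" using \<gamma> K by auto
      then have "\<gamma> \<in> (\<lambda>(x, q). x ** matrix_inv q) ` (K \<times> K)"
        using \<gamma> by (intro image_eqI[of _ _ "(\<gamma> ** x, x)"]) auto
      moreover have "r \<le> norm (\<gamma> - mat 1)" using n(1) \<gamma> by force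
      ultimately have "\<gamma> \<in> C" by (simp add: C_def)
      then show False using n(2) \<gamma> by blast
    qed
  qed
qed

text \<open>This rests on the other half of convergence: an element \<gamma> of \<open>L\<close>
  with \<gamma> l in \<open>W\<close> is a limit of elements h_n of \<open>H n\<close>, and since
  \<open>W\<close> is open, h_n x lies in \<open>W\<close> for large n and x close to l.\<close>

lemma eventually_subset_sat:
  assumes K: "compact K" and W: "open W" and sub: "K \<subseteq> discrete_linear_group.sat G L W"
  shows "\<forall>\<^sub>F n in sequentially. K \<subseteq> discrete_linear_group.sat G (H n) W"
proof -
  interpret L: discrete_linear_group G L by (rule L)
  have "\<forall>\<^sub>F n in sequentially. \<forall>x\<in>K. \<exists>\<gamma>\<in>H n. \<gamma> ** x \<in> W"
  proof (rule eventually_all_in_compact[OF K])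
    fix r :: "nat \<Rightarrow> nat" and x l
    assume r: "strict_mono r" and x: "x \<longlonglongrightarrow> l" "l \<in> K"
    then obtain \<gamma> where \<gamma>: "\<gamma> \<in> L" "\<gamma> ** l \<in> W" using sub by (auto simp: L.sat_def)
    then obtain h where h: "\<And>n. h n \<in> H n" "h \<longlonglongrightarrow> \<gamma>" by (metis members_converging_to)
    have "(\<lambda>k. h (r k)) \<longlonglongrightarrow> \<gamma>" using h(2) r LIMSEQ_subseq_LIMSEQ[of h \<gamma> r] by (simp add: comp_def)
    then have "(\<lambda>k. h (r k) ** x k) \<longlonglongrightarrow> \<gamma> ** l" by (intro tendsto_intros x)
    then have "\<forall>\<^sub>F k in sequentially. h (r k) ** x k \<in> W"
      using W \<gamma> by (auto intro: topological_tendstoD)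
    then obtain k where "h (r k) ** x k \<in> W"
      using eventually_happens'[OF sequentially_bot] by blast
    then show "\<exists>k. \<exists>\<gamma>\<in>H (r k). \<gamma> ** x k \<in> W" using h(1) by blast
  qed
  then show ?thesis
  proof eventually_elim
    fix n assume n: "\<forall>x\<in>K. \<exists>\<gamma>\<in>H n. \<gamma> ** x \<in> W"
    interpret Hn: discrete_linear_group G "H n" by (rule H)
    show "K \<subseteq> Hn.sat W" using n sub L.sat_subset by (auto simp: Hn.sat_def)
  qed
qed

end

section \<open>Regularity of the Haar measure\<close>

text \<open>The measure may be infinite, so outer regularity of finite measures is applied inside
  open sets \<open>V k\<close> of finite measure that cover \<open>G\<close>, to the pieces
  \<open>P k\<close> of \<open>B\<close>, with errors that add up to \<open>\<eta>\<close>.\<close>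

lemma (in right_haar) outer_regular_finite:
  assumes B: "B \<in> sets borel" "B \<subseteq> G" and \<eta>: "\<eta> > 0"
  obtains W where "open W" "B \<subseteq> W" "emeasure \<mu> W \<le> emeasure \<mu> B + ennreal \<eta>"
proof -
  define V where "V k =
    (\<lambda>A :: real^'n^'n. max (norm A) (norm (matrix_inv A))) -` {..<real k} \<inter> {A. invertible A}" for k
  have V: "open (V k)" for k
  proof -
    have "continuous_on {A. invertible A} (\<lambda>A :: real^'n^'n. max (norm A) (norm (matrix_inv A)))"
      by (intro continuous_intros continuous_on_matrix_inv)
    then have "open ((\<lambda>A :: real^'n^'n. max (norm A) (norm (matrix_inv A))) -` {..<real k} \<inter> {A. invertible A})"
      unfolding continuous_on_open_vimage[OF open_invertible] by simp
    then show ?thesis by (simp add: V_def)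
  qed
  have VG: "V k \<inter> G \<subseteq> bounded_part k" for k by (auto simp: V_def bounded_part_def)
  have fin: "emeasure \<mu> (V k) < \<infinity>" for k
  proof -
    have "emeasure \<mu> (V k) = emeasure \<mu> (V k \<inter> G)" using V by (intro emeasure_Int_G[symmetric]) auto
    also have "\<dots> \<le> emeasure \<mu> (bounded_part k)" by (rule emeasure_mono[OF VG]) simp
    also have "\<dots> < \<infinity>" by (rule finite_bounded)
    finally show ?thesis .
  qed
  have UV: "G \<subseteq> (\<Union>k. V k)"
  proof
    fix A assume A: "A \<in> G"
    obtain k where "max (norm A) (norm (matrix_inv A)) < real k" using reals_Archimedean2 by blast
    then show "A \<in> (\<Union>k. V k)" using invertible[OF A] by (auto simp: V_def)
  qed
  define P where "P k = B \<inter> disjointed V k" for k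
  have P: "P k \<in> sets borel" "P k \<subseteq> V k" for k
  proof -
    have "disjointed V k \<in> sets borel"
      using sets.range_disjointed_sets'[of V borel] V by (auto simp: image_subset_iff)
    then show "P k \<in> sets borel" using B by (simp add: P_def)
    show "P k \<subseteq> V k" using disjointed_subset[of V k] by (auto simp: P_def)
  qed
  have UP: "(\<Union>k. P k) = B"
  proof -
    have "(\<Union>k. P k) = B \<inter> (\<Union>k. disjointed V k)" by (auto simp: P_def)
    then show ?thesis using UV B(2) by (auto simp: UN_disjointed_eq)
  qed
  have disj: "disjoint_family P"
    using disjoint_family_disjointed[of V] by (auto simp: P_def disjoint_family_on_def)
  have "\<exists>U. open U \<and> P k \<subseteq> U \<and> emeasure \<mu> (U \<inter> V k) \<le> emeasure \<mu> (P k) + ennreal (\<eta> * (1/2)^Suc k)" for k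
  proof -
    define M where "M = density \<mu> (indicator (V k))"
    have M: "sets M = sets borel" "space M = UNIV" by (simp_all add: M_def)
    have eM: "emeasure M A = emeasure \<mu> (A \<inter> V k)" if "A \<in> sets borel" for A
      using that V[of k] by (simp add: M_def emeasure_restricted Int_commute)
    have "emeasure M (space M) \<noteq> \<infinity>" using fin[of k] by (simp add: eM M)
    from outer_regular[OF M(1) this P(1)]
    have inf: "emeasure M (P k) = (INF U \<in> {U. P k \<subseteq> U \<and> open U}. emeasure M U)" .
    have "emeasure M (P k) = emeasure \<mu> (P k)" using P by (simp add: eM Int_absorb2)
    moreover have "emeasure M (P k) < \<infinity>" using eM[OF P(1)[of k]] fin[of k] emeasure_mono[of "P k \<inter> V k" "V k" \<mu>] V[of k]
      by (auto intro: le_less_trans)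
    ultimately have "emeasure M (P k) < emeasure \<mu> (P k) + ennreal (\<eta> * (1/2)^Suc k)"
      using \<eta> ennreal_add_left_cancel_less[of "emeasure \<mu> (P k)" 0 "ennreal (\<eta> * (1/2)^Suc k)"]
      by (simp add: less_top)
    then obtain U where "P k \<subseteq> U" "open U" "emeasure M U < emeasure \<mu> (P k) + ennreal (\<eta> * (1/2)^Suc k)"
      unfolding inf INF_less_iff by auto
    then show ?thesis using eM[of U] by (auto intro!: exI[of _ U] less_imp_le)
  qed
  then obtain U where U: "\<And>k. open (U k)" "\<And>k. P k \<subseteq> U k"
    "\<And>k. emeasure \<mu> (U k \<inter> V k) \<le> emeasure \<mu> (P k) + ennreal (\<eta> * (1/2)^Suc k)" by metis
  show ?thesis
  proof (rule that[of "\<Union>k. U k \<inter> V k"])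
    show "open (\<Union>k. U k \<inter> V k)" by (intro open_UN ballI open_Int U V)
    show "B \<subseteq> (\<Union>k. U k \<inter> V k)"
      unfolding UP[symmetric] using U(2) P(2) by (intro UN_mono) auto
    have "(\<lambda>k. \<eta> * (1/2)^Suc k) sums (\<eta> * 1)" by (intro sums_mult power_half_series)
    then have geom: "(\<Sum>k. ennreal (\<eta> * (1/2)^Suc k)) = ennreal \<eta>"
      using \<eta> by (subst suminf_ennreal2) (auto simp: sums_iff)
    have "emeasure \<mu> (\<Union>k. U k \<inter> V k) \<le> (\<Sum>k. emeasure \<mu> (U k \<inter> V k))"
      using U(1) V by (intro emeasure_subadditive_countably) (simp add: image_subset_iff)
    also have "\<dots> \<le> (\<Sum>k. emeasure \<mu> (P k) + ennreal (\<eta> * (1/2)^Suc k))"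
      by (intro suminf_le U) auto
    also have "\<dots> = (\<Sum>k. emeasure \<mu> (P k)) + (\<Sum>k. ennreal (\<eta> * (1/2)^Suc k))"
      by (intro suminf_add[symmetric]) auto
    also have "(\<Sum>k. emeasure \<mu> (P k)) = emeasure \<mu> B"
      using suminf_emeasure[of P \<mu>] P(1) disj UP by auto
    also have "(\<Sum>k. ennreal (\<eta> * (1/2)^Suc k)) = ennreal \<eta>" by (rule geom)
    finally show "emeasure \<mu> (\<Union>k. U k \<inter> V k) \<le> emeasure \<mu> B + ennreal \<eta>" .
  qed
qed

lemma (in right_haar) inner_regular_finite:
  assumes B: "B \<in> sets borel" and fin: "emeasure \<mu> B < \<infinity>" and a: "a < emeasure \<mu> B"
  obtains K where "compact K" "K \<subseteq> B" "a < emeasure \<mu> K"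
proof -
  define M where "M = density \<mu> (indicator B)"
  have M: "sets M = sets borel" "space M = UNIV" by (simp_all add: M_def)
  have eM: "emeasure M A = emeasure \<mu> (A \<inter> B)" if "A \<in> sets borel" for A
    using that B by (simp add: M_def emeasure_restricted Int_commute)
  have "emeasure M (space M) \<noteq> \<infinity>" using fin by (simp add: eM M)
  from inner_regular[OF M(1) this B]
  have "a < (SUP K \<in> {K. K \<subseteq> B \<and> compact K}. emeasure M K)" using a B by (simp add: eM)
  then obtain K where "K \<subseteq> B" "compact K" "a < emeasure M K" by (auto simp: less_SUP_iff)
  then show ?thesis using that[of K] eM[of K] by (simp add: Int_absorb2 borel_compact)
qed

section \<open>Almost invariant indicator functions\<close>

context discrete_linear_group
begin

text \<open>The representative in \<open>F\<close> of the coset of \<open>x\<close>. The constant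
  value outside \<open>G\<close> keeps the map Borel on all matrices.\<close>

definition proj :: "(real^'n^'n) set \<Rightarrow> real^'n^'n \<Rightarrow> real^'n^'n" where
  "proj F x = (if x \<in> G then (THE y. y \<in> F \<inter> orb x) else mat 1)"

lemma fundamental_unique:
  assumes "fundamental F" "x \<in> F" "\<gamma> \<in> D" "\<gamma> ** x \<in> F"
  shows "\<gamma> ** x = x"
  using smallD[of F \<gamma> x] assms by (simp add: fundamental_def)

lemma proj_eqI:
  assumes F: "fundamental F" and x: "x \<in> G" and y: "y \<in> F" "y \<in> orb x"
  shows "proj F x = y"
proof -
  have "(THE y. y \<in> F \<inter> orb x) = y"
  proof (rule the_equality)
    fix z assume z: "z \<in> F \<inter> orb x"
    have "z \<in> orb y" using z orb_eq[OF x y(2)] by simp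
    then obtain \<gamma> where "\<gamma> \<in> D" "z = \<gamma> ** y" by (auto simp: orb_def)
    then show "z = y" using fundamental_unique[OF F y(1), of \<gamma>] z by simp
  qed (use y in simp)
  then show ?thesis using x by (simp add: proj_def)
qed

lemma proj_in:
  assumes F: "fundamental F" and x: "x \<in> G"
  shows "proj F x \<in> F" "proj F x \<in> orb x"
proof -
  have "x \<in> sat F" using F x by (simp add: fundamental_def)
  then obtain \<gamma> where \<gamma>: "\<gamma> \<in> D" "\<gamma> ** x \<in> F" by (auto simp: sat_def)
  then have "\<gamma> ** x \<in> orb x" by (simp add: orb_def)
  then have "proj F x = \<gamma> ** x" using proj_eqI[OF F x \<gamma>(2)] by simp
  then show "proj F x \<in> F" "proj F x \<in> orb x" using \<gamma> \<open>\<gamma> ** x \<in> orb x\<close> by simp_all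
qed

lemma proj_id: "fundamental F \<Longrightarrow> x \<in> F \<Longrightarrow> proj F x = x"
  using proj_eqI[of F x x] in_orb_self by (auto simp: fundamental_def)

lemma proj_translate:
  assumes F: "fundamental F" and x: "x \<in> G" and \<gamma>: "\<gamma> \<in> D"
  shows "proj F (\<gamma> ** x) = proj F x"
proof (rule proj_eqI[OF F])
  have "\<gamma> ** x \<in> orb x" using \<gamma> by (simp add: orb_def)
  then show "proj F x \<in> orb (\<gamma> ** x)" using orb_eq[OF x] proj_in(2)[OF F x] by simp
qed (use x \<gamma> proj_in[OF F x] in simp_all)

lemma proj_in_iff:
  assumes F: "fundamental F" and x: "x \<in> G" and A: "sat A = A"
  shows "proj F x \<in> A \<longleftrightarrow> x \<in> A"
proof -
  obtain \<gamma> where "\<gamma> \<in> D" "proj F x = \<gamma> ** x" using proj_in(2)[OF F x] by (auto simp: orb_def)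
  then show ?thesis using sat_translate[of \<gamma> x A] A by simp
qed

lemma proj_vimage:
  assumes F: "fundamental F" and x: "x \<in> G"
  shows "proj F x \<in> E \<longleftrightarrow> x \<in> sat (F \<inter> E)"
proof
  assume E: "proj F x \<in> E"
  obtain \<gamma> where "\<gamma> \<in> D" "proj F x = \<gamma> ** x" using proj_in(2)[OF F x] by (auto simp: orb_def)
  then show "x \<in> sat (F \<inter> E)" using E x proj_in(1)[OF F x] by (auto simp: sat_def)
next
  assume "x \<in> sat (F \<inter> E)"
  then obtain \<gamma> where \<gamma>: "\<gamma> \<in> D" "\<gamma> ** x \<in> F" "\<gamma> ** x \<in> E" by (auto simp: sat_def)
  then have "proj F x = \<gamma> ** x" using x by (intro proj_eqI[OF F]) (auto simp: orb_def)
  then show "proj F x \<in> E" using \<gamma> by simp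
qed

lemma measurable_proj:
  assumes F: "fundamental F"
  shows "proj F \<in> borel_measurable borel"
proof (rule borel_measurableI)
  fix S :: "(real^'n^'n) set" assume "open S"
  have "proj F -` S \<inter> space borel = sat (F \<inter> S) \<union> (if mat 1 \<in> S then - G else {})"
    using proj_vimage[OF F, of _ S] sat_subset[of "F \<inter> S"] by (auto simp: proj_def split: if_splits)
  also have "\<dots> \<in> sets borel"
    using F \<open>open S\<close> by (intro sets.Un borel_sat) (auto simp: fundamental_def borel_comp)
  finally show "proj F -` S \<inter> space borel \<in> sets borel" .
qed

end

context haar_discrete
begin

definition coset_measure :: "(real^'n^'n) set \<Rightarrow> (real^'n^'n) measure" where
  "coset_measure F = density \<mu> (indicator F)"

text \<open>The action of \<open>G\<close> on cosets by right translation, transported to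
  \<open>F\<close>: translate, then return to \<open>F\<close> along the coset.\<close>

definition act :: "(real^'n^'n) set \<Rightarrow> real^'n^'n \<Rightarrow> real^'n^'n \<Rightarrow> real^'n^'n" where
  "act F g x = proj F (x ** g)"

lemma sets_coset_measure [measurable_cong, simp]: "sets (coset_measure F) = sets borel"
  and space_coset_measure [simp]: "space (coset_measure F) = UNIV"
  by (simp_all add: coset_measure_def)

lemma emeasure_coset_measure:
  "fundamental F \<Longrightarrow> A \<in> sets borel \<Longrightarrow> emeasure (coset_measure F) A = emeasure \<mu> (F \<inter> A)"
  by (simp add: coset_measure_def emeasure_restricted fundamental_def)

lemma AE_coset_measure:
  assumes "fundamental F"
  shows "(AE x in coset_measure F. P x) \<longleftrightarrow> (AE x in \<mu>. x \<in> F \<longrightarrow> P x)"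
proof -
  have "F \<in> sets \<mu>" using assms by (simp add: fundamental_def)
  then have "(indicator F :: _ \<Rightarrow> ennreal) \<in> borel_measurable \<mu>" by (rule borel_measurable_indicator)
  note AE_density[OF this, of P]
  moreover have "(0 :: ennreal) < indicator F x \<longleftrightarrow> x \<in> F" for x
    by (simp add: indicator_def)
  ultimately show ?thesis unfolding coset_measure_def by presburger
qed

lemma AE_coset_measure_in: "fundamental F \<Longrightarrow> AE x in coset_measure F. x \<in> F"
  by (simp add: AE_coset_measure)

lemma measurable_act:
  assumes F: "fundamental F"
  shows "act F g \<in> borel_measurable borel"
  unfolding act_def using measurable_compose[OF _ measurable_proj[OF F], of "\<lambda>x. x ** g" borel] by simp

lemma emeasure_translate_coset_measure:
  assumes F: "fundamental F" and A: "A \<in> sets borel" "sat A = A" and g: "g \<in> G"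
  shows "emeasure (coset_measure F) {x \<in> G. x ** g \<in> A} = emeasure (coset_measure F) A"
proof -
  note [measurable] = A(1)
  have "{x \<in> space borel. x \<in> G \<and> x ** g \<in> A} \<in> sets borel" by measurable
  then show ?thesis
    using emeasure_fundamental_translate[OF F A g] by (simp add: emeasure_coset_measure F A)
qed

text \<open>Within \<open>F\<close> the preimage of \<open>E\<close> under \<open>act F g\<close> is
  the translate by g^-1 of the union of cosets \<open>sat (F \<inter> E)\<close>, so the invariance
  of the induced measure on cosets applies.\<close>

lemma measure_preserving_act:
  assumes F: "fundamental F"
  shows "measure_preserving_action G (coset_measure F) (act F)"
proof unfold_locales
  have F': "F \<in> sets borel" "F \<subseteq> G" "sat F = G" using F by (auto simp: fundamental_def)
  fix g assume g: "g \<in> G"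
  show "act F g \<in> measurable (coset_measure F) (coset_measure F)"
    using measurable_act[OF F] by (simp add: measurable_cong_sets[OF sets_coset_measure sets_coset_measure])
  show "distr (coset_measure F) (coset_measure F) (act F g) = coset_measure F"
  proof (rule measure_eqI)
    fix E assume "E \<in> sets (distr (coset_measure F) (coset_measure F) (act F g))"
    then have E: "E \<in> sets borel" by simp
    have vim: "act F g -` E \<in> sets borel"
      using measurable_sets[OF measurable_act[OF F] E] by simp
    have FE: "sat (F \<inter> E) \<in> sets borel" using F' E by (intro borel_sat) auto
    have "emeasure (distr (coset_measure F) (coset_measure F) (act F g)) E =
        emeasure (coset_measure F) (act F g -` E)"
      using measurable_act[OF F] E
      by (subst emeasure_distr) (simp_all add: measurable_cong_sets[OF sets_coset_measure sets_coset_measure])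
    also have "\<dots> = emeasure \<mu> (F \<inter> act F g -` E)" by (simp add: emeasure_coset_measure F vim)
    also have "F \<inter> act F g -` E = F \<inter> {x \<in> G. x ** g \<in> sat (F \<inter> E)}"
      using F'(2) g proj_vimage[OF F] by (auto simp: act_def)
    also have "emeasure \<mu> \<dots> = emeasure \<mu> (F \<inter> sat (F \<inter> E))"
      by (rule emeasure_fundamental_translate[OF F FE sat_sat g])
    also have "F \<inter> sat (F \<inter> E) = F \<inter> E"
    proof (intro equalityI subsetI)
      fix x assume x: "x \<in> F \<inter> sat (F \<inter> E)"
      then have "x \<in> G" using F'(2) by auto
      then show "x \<in> F \<inter> E" using x proj_vimage[OF F, of x E] proj_id[OF F, of x] by simp
    qed (use subset_sat[of "F \<inter> E"] F'(2) in auto)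
    finally show "emeasure (distr (coset_measure F) (coset_measure F) (act F g)) E = emeasure (coset_measure F) E"
      by (simp add: emeasure_coset_measure F E)
  qed simp
  fix h assume h: "h \<in> G"
  show "AE x in coset_measure F. act F h (act F g x) = act F (g ** h) x"
    using AE_coset_measure_in[OF F]
  proof eventually_elim
    fix x assume "x \<in> F"
    then have xg: "x ** g \<in> G" using F' g by auto
    obtain \<gamma> where \<gamma>: "\<gamma> \<in> D" "proj F (x ** g) = \<gamma> ** (x ** g)"
      using proj_in(2)[OF F xg] by (auto simp: orb_def)
    have "proj F (\<gamma> ** ((x ** g) ** h)) = proj F ((x ** g) ** h)"
      by (rule proj_translate[OF F]) (use xg h \<gamma> in auto)
    then show "act F h (act F g x) = act F (g ** h) x"
      by (simp add: act_def \<gamma> matrix_mul_assoc)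
  qed
next
  show "AE x in coset_measure F. act F (mat 1) x = x"
    using AE_coset_measure_in[OF F] by eventually_elim (simp add: act_def proj_id[OF F])
qed

lemma sat_Int_G: "sat (W \<inter> G) = sat W"
  by (auto simp: sat_def)

definition coset_indicator :: "(real^'n^'n) set \<Rightarrow> real^'n^'n \<Rightarrow> complex" where
  "coset_indicator K x = (if x \<in> sat K then 1 else 0)"

lemma emeasure_coset_measure_sat:
  assumes F: "fundamental F" and K: "compact K" "K \<subseteq> G" "small K"
  shows "emeasure (coset_measure F) (sat K) = emeasure \<mu> K"
  using K by (simp add: emeasure_coset_measure F borel_sat borel_compact emeasure_fundamental_sat)

lemma integral_coset_indicator:
  assumes F: "fundamental F" and K: "compact K" "K \<subseteq> G" "small K" and fin: "emeasure \<mu> K < \<infinity>"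
  shows "sq_integrable (coset_measure F) (coset_indicator K)"
    "(\<integral>x. (cmod (coset_indicator K x))\<^sup>2 \<partial>coset_measure F) = measure \<mu> K"
proof -
  have [measurable]: "sat K \<in> sets borel" using K by (simp add: borel_sat borel_compact)
  have eq: "(\<lambda>x. (cmod (coset_indicator K x))\<^sup>2) = indicator (sat K)"
    by (auto simp: coset_indicator_def fun_eq_iff)
  have em: "emeasure (coset_measure F) (sat K) = emeasure \<mu> K"
    by (rule emeasure_coset_measure_sat[OF F K])
  have "coset_indicator K \<in> borel_measurable (coset_measure F)"
    unfolding coset_indicator_def by measurable
  moreover have "integrable (coset_measure F) (indicator (sat K) :: _ \<Rightarrow> real)"
    using fin em by (intro integrable_real_indicator) simp_all
  ultimately show "sq_integrable (coset_measure F) (coset_indicator K)"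
    by (simp add: sq_integrable_def eq)
  show "(\<integral>x. (cmod (coset_indicator K x))\<^sup>2 \<partial>coset_measure F) = measure \<mu> K"
    unfolding eq using em by (simp add: measure_def)
qed

text \<open>The integrand is the indicator of the symmetric difference of \<open>B h\<close> and
  \<open>B g\<close>. Each has measure \<mu> K and their union has measure at most \<open>w\<close>,
  so each is missed by at most w - \<mu> K. The lemma serves twice: for continuity, with
  \<open>W\<close> close to \<open>K\<close>, and for almost invariance, with \<open>g\<close> = 1
  and \<open>W\<close> close to a fundamental domain of the limit group.\<close>

lemma coset_indicator_dist_le:
  assumes F: "fundamental F" and K: "compact K" "K \<subseteq> G" "small K"
    and W: "open W" and w: "emeasure \<mu> W \<le> ennreal w" "0 \<le> w"
    and g: "g \<in> G" and h: "h \<in> G" and KW: "K \<subseteq> sat W"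
    and tr: "\<And>x. x \<in> K \<Longrightarrow> x ** matrix_inv (matrix_inv g ** h) \<in> sat W"
  shows "(\<integral>x. (cmod (coset_indicator K (act F h x) - coset_indicator K (act F g x)))\<^sup>2 \<partial>coset_measure F)
    \<le> 2 * (w - measure \<mu> K)"
proof -
  let ?M = "coset_measure F"
  define A where "A = sat K"
  define B where "B k = {x \<in> G. x ** k \<in> A}" for k
  have F': "F \<subseteq> G" using F by (simp add: fundamental_def)
  have A [measurable]: "A \<in> sets borel" and satA: "sat A = A" and AG: "A \<subseteq> G"
    using K by (simp_all add: A_def borel_sat borel_compact sat_sat sat_subset)
  have mB [measurable]: "B k \<in> sets borel" for k
  proof -
    have "{x \<in> space borel. x \<in> G \<and> x ** k \<in> A} \<in> sets borel" by measurable
    then show ?thesis by (simp add: B_def)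
  qed
  have satB: "sat (B k) = B k" if "k \<in> G" for k
  proof
    show "sat (B k) \<subseteq> B k"
    proof
      fix x assume "x \<in> sat (B k)"
      then obtain \<gamma> where "\<gamma> \<in> D" "x \<in> G" "(\<gamma> ** x) ** k \<in> A" by (auto simp: sat_def B_def)
      then show "x \<in> B k" using sat_translate[of \<gamma> "x ** k" A] satA by (simp add: B_def matrix_mul_assoc)
    qed
    show "B k \<subseteq> sat (B k)" by (rule subset_sat) (auto simp: B_def)
  qed
  define k where "k = matrix_inv g ** h"
  have k: "k \<in> G" "g ** k = h" using g h by (auto simp: k_def)
  have W': "W \<inter> G \<in> sets borel" using W by simp
  have subW: "A \<union> B k \<subseteq> sat W"
  proof
    fix x assume "x \<in> A \<union> B k"
    then show "x \<in> sat W"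
    proof
      assume "x \<in> A"
      then obtain \<gamma> where "\<gamma> \<in> D" "\<gamma> ** x \<in> K" by (auto simp: A_def sat_def)
      then show ?thesis using KW sat_translate[of \<gamma> x W] by blast
    next
      assume x: "x \<in> B k"
      then obtain \<gamma> where \<gamma>: "\<gamma> \<in> D" "\<gamma> ** (x ** k) \<in> K" by (auto simp: A_def B_def sat_def)
      then have "(\<gamma> ** (x ** k)) ** matrix_inv k \<in> sat W" unfolding k_def by (intro tr)
      then show ?thesis using sat_translate[OF \<gamma>(1), of x W] k(1) by (simp add: matrix_mul_assoc)
    qed
  qed
  \<comment> \<open>With h = g k, the union of \<open>B h\<close> and \<open>B g\<close> is the
    translate by g^-1 of \<open>A \<union> B k\<close>, which lies over \<open>W\<close>;
    translation does not change the measure on cosets.\<close>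
  have eU: "emeasure ?M (B h \<union> B g) \<le> ennreal w"
  proof -
    have "B h \<union> B g = {x \<in> G. x ** g \<in> A \<union> B k}"
      using g k AG by (auto simp: B_def matrix_mul_assoc[symmetric])
    moreover have "emeasure ?M {x \<in> G. x ** g \<in> A \<union> B k} = emeasure ?M (A \<union> B k)"
    proof (rule emeasure_translate_coset_measure[OF F _ _ g])
      have "sat (A \<union> B k) = sat A \<union> sat (B k)" by (auto simp: sat_def)
      then show "sat (A \<union> B k) = A \<union> B k" using satA satB[OF k(1)] by simp
    qed simp
    moreover have "emeasure ?M (A \<union> B k) \<le> emeasure ?M (sat (W \<inter> G))"
      using subW borel_sat[OF W'] by (intro emeasure_mono) (simp_all add: sat_Int_G)
    moreover have "emeasure ?M (sat (W \<inter> G)) \<le> emeasure \<mu> (W \<inter> G)"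
      using W' by (simp add: emeasure_coset_measure F borel_sat emeasure_fundamental_sat_le)
    moreover have "emeasure \<mu> (W \<inter> G) = emeasure \<mu> W" using W by (intro emeasure_Int_G) simp
    ultimately show ?thesis using w(1) by (metis order_trans)
  qed
  have eK: "emeasure ?M A = emeasure \<mu> K"
    unfolding A_def by (rule emeasure_coset_measure_sat[OF F K])
  have eB: "emeasure ?M (B l) = emeasure \<mu> K" if "l \<in> G" for l
    unfolding B_def using emeasure_translate_coset_measure[OF F A satA that] eK by simp
  have fin: "emeasure ?M (B h \<union> B g) < \<infinity>" using eU by (rule le_less_trans) simp
  have finB: "emeasure ?M (B h) < \<infinity>" "emeasure ?M (B g) < \<infinity>"
    using fin emeasure_mono[of "B h" "B h \<union> B g" ?M] emeasure_mono[of "B g" "B h \<union> B g" ?M]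
    by (auto intro: le_less_trans)
  have U: "measure ?M (B h \<union> B g) \<le> w"
    using eU w(2) fin by (simp add: emeasure_eq_ennreal_measure less_top)
  let ?S = "((B h \<union> B g) - B h) \<union> ((B h \<union> B g) - B g)"
  have "AE x in ?M. (cmod (coset_indicator K (act F h x) - coset_indicator K (act F g x)))\<^sup>2 = indicator ?S x"
    using AE_coset_measure_in[OF F]
  proof eventually_elim
    fix x assume "x \<in> F"
    then have x: "x \<in> G" "x ** h \<in> G" "x ** g \<in> G" using F' g h by auto
    have "act F l x \<in> sat K \<longleftrightarrow> x \<in> B l" if "l \<in> {g, h}" for l
      using proj_in_iff[OF F _ satA, of "x ** l"] x that by (auto simp: act_def B_def A_def)
    then show "(cmod (coset_indicator K (act F h x) - coset_indicator K (act F g x)))\<^sup>2 = indicator ?S x"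
      by (auto simp: coset_indicator_def indicator_def)
  qed
  moreover have "coset_indicator K \<in> borel_measurable borel"
    unfolding coset_indicator_def A_def[symmetric] by measurable
  then have "(\<lambda>x. coset_indicator K (act F l x)) \<in> borel_measurable borel" for l
    using measurable_compose[OF measurable_act[OF F]] by blast
  then have "(\<lambda>x. (cmod (coset_indicator K (act F h x) - coset_indicator K (act F g x)))\<^sup>2) \<in> borel_measurable ?M"
    by (simp add: measurable_cong_sets[OF sets_coset_measure refl])
  ultimately have "(\<integral>x. (cmod (coset_indicator K (act F h x) - coset_indicator K (act F g x)))\<^sup>2 \<partial>?M)
      = (\<integral>x. indicator ?S x \<partial>?M)"
    by (intro integral_cong_AE) (auto intro!: borel_measurable_indicator simp: measurable_cong_sets[OF sets_coset_measure refl])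
  also have "\<dots> = measure ?M ?S" by simp
  also have "\<dots> \<le> measure ?M ((B h \<union> B g) - B h) + measure ?M ((B h \<union> B g) - B g)"
    by (intro measure_Un_le) auto
  also have "\<dots> = 2 * measure ?M (B h \<union> B g) - measure ?M (B h) - measure ?M (B g)"
    using fin finB by (simp add: measure_Diff less_top fmeasurable_def)
  also have "\<dots> \<le> 2 * (w - measure \<mu> K)"
    using U eB[OF g] eB[OF h] by (simp add: measure_def)
  finally show ?thesis .
qed

end

section \<open>From property (T) to a finite covolume\<close>

lemma (in bi_haar) haar_discreteI: "discrete_linear_group G D \<Longrightarrow> haar_discrete G \<mu> D"
proof -
  assume "discrete_linear_group G D"
  then interpret D: discrete_linear_group G D .
  show ?thesis by unfold_locales (simp add: left_invariant)
qed

text \<open>Property (T) turns the almost invariant indicator function of the image of \<open>K\<close> in the coset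
  space into a nonzero invariant square integrable function. By Fubini it is a constant, so
  the coset space has finite volume.\<close>

lemma (in bi_haar) finite_covolume_if_almost_invariant:
  fixes D K Q W :: "(real^'n^'n) set"
  assumes D: "discrete_linear_group G D"
    and T: "\<And>(V :: ((real^'n^'n \<Rightarrow> complex) set) hilbert) \<pi>. hilbert_space V \<Longrightarrow> unitary_rep G V \<pi> \<Longrightarrow>
      has_almost_invariant_vector Q \<epsilon> V \<pi> \<Longrightarrow> has_invariant_vector G V \<pi>"
    and Q: "Q \<subseteq> G" and \<epsilon>: "\<epsilon> > 0"
    and K: "compact K" "K \<subseteq> G" "discrete_linear_group.small D K" and finK: "emeasure \<mu> K < \<infinity>"
    and posK: "measure \<mu> K > 0"
    and W: "open W" "emeasure \<mu> W \<le> ennreal w" "0 \<le> w"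
    and KW: "K \<subseteq> discrete_linear_group.sat G D W"
    and KQ: "\<And>x q. x \<in> K \<Longrightarrow> q \<in> Q \<Longrightarrow> x ** matrix_inv q \<in> discrete_linear_group.sat G D W"
    and less: "2 * (w - measure \<mu> K) < \<epsilon>\<^sup>2 * measure \<mu> K"
  shows "\<not> infinite_covolume G D"
proof -
  interpret D: haar_discrete G \<mu> D by (rule haar_discreteI[OF D])
  obtain F where F: "D.fundamental F" using D.ex_fundamental by blast
  have F': "F \<in> sets borel" "F \<subseteq> G" "D.sat F = G" using F by (auto simp: D.fundamental_def)
  let ?M = "D.coset_measure F" and ?\<tau> = "D.act F" and ?f = "D.coset_indicator K"
  interpret A: measure_preserving_action G ?M ?\<tau> by (rule D.measure_preserving_act[OF F])
  note f = D.integral_coset_indicator[OF F K finK]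
  have "\<exists>s. sq_integrable ?M s \<and> \<not> (AE x in ?M. s x = 0) \<and> (\<forall>g\<in>G. AE x in ?M. s (?\<tau> g x) = s x)"
  proof (rule A.invariant_function[OF T f(1) _ _ Q \<epsilon>])
    show "0 < (\<integral>x. (cmod (?f x))\<^sup>2 \<partial>?M)" using posK f(2) by simp
  next
    fix g assume g: "g \<in> G"
    show "((\<lambda>h. \<integral>x. (cmod (?f (?\<tau> h x) - ?f (?\<tau> g x)))\<^sup>2 \<partial>?M) \<longlongrightarrow> 0) (at g within G)"
    proof (rule order_tendstoI)
      fix e :: real assume e: "0 < e"
      \<comment> \<open>For continuity the neighbourhood is close to \<open>K\<close> itself: the
        distance estimate then gives at most 2 (e / 4), which is less than \<open>e\<close>.\<close>
      obtain W' where W': "open W'" "K \<subseteq> W'" "emeasure \<mu> W' \<le> emeasure \<mu> K + ennreal (e / 4)"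
        using outer_regular_finite[of K "e / 4"] K e by (auto simp: borel_compact)
      have w': "emeasure \<mu> W' \<le> ennreal (measure \<mu> K + e / 4)"
        using W'(3) finK e by (simp add: emeasure_eq_ennreal_measure less_top ennreal_plus)
      have sub: "W' \<inter> G \<subseteq> D.sat W'" using D.subset_sat[of "W' \<inter> G"] D.sat_Int_G[of W'] by auto
      have "\<forall>\<^sub>F h in at g within G. h \<in> G" by (simp add: eventually_at_filter)
      with eventually_translate_subset[OF K(1) W'(1,2) g]
      show "\<forall>\<^sub>F h in at g within G. (\<integral>x. (cmod (?f (?\<tau> h x) - ?f (?\<tau> g x)))\<^sup>2 \<partial>?M) < e"
      proof eventually_elim
        fix h assume h: "\<forall>x\<in>K. x ** matrix_inv (matrix_inv g ** h) \<in> W'" "h \<in> G"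
        have "(\<integral>x. (cmod (?f (?\<tau> h x) - ?f (?\<tau> g x)))\<^sup>2 \<partial>?M) \<le> 2 * ((measure \<mu> K + e / 4) - measure \<mu> K)"
        proof (rule D.coset_indicator_dist_le[OF F K W'(1) w' _ g h(2)])
          show "0 \<le> measure \<mu> K + e / 4" using e by simp
          show "K \<subseteq> D.sat W'" using sub K(2) W'(2) by blast
          show "x ** matrix_inv (matrix_inv g ** h) \<in> D.sat W'" if "x \<in> K" for x
            using h g that K(2) sub by (auto intro!: subsetD[OF sub])
        qed
        then show "(\<integral>x. (cmod (?f (?\<tau> h x) - ?f (?\<tau> g x)))\<^sup>2 \<partial>?M) < e" using e by simp
      qed
    next
      fix e :: real assume "e < 0"
      then show "\<forall>\<^sub>F h in at g within G. e < (\<integral>x. (cmod (?f (?\<tau> h x) - ?f (?\<tau> g x)))\<^sup>2 \<partial>?M)"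
        by (intro always_eventually allI less_le_trans[OF _ Bochner_Integration.integral_nonneg]) auto
    qed
  next
    fix q assume q: "q \<in> Q"
    have inv1: "matrix_inv (mat 1 :: real^'n^'n) = mat 1" by (rule matrix_inv_eqI) simp
    have "(\<integral>x. (cmod (?f (?\<tau> q x) - ?f x))\<^sup>2 \<partial>?M) = (\<integral>x. (cmod (?f (?\<tau> q x) - ?f (?\<tau> (mat 1) x)))\<^sup>2 \<partial>?M)"
    proof (rule integral_cong_AE)
      have s: "sq_integrable ?M (\<lambda>x. ?f (?\<tau> l x))" if "l \<in> G" for l
        by (rule A.sq_integrable_comp[OF that f(1)])
      note [measurable] = sq_integrable_measurable[OF f(1)] sq_integrable_measurable[OF s]
      have qG: "q \<in> G" using q Q by auto
      show "(\<lambda>x. (cmod (?f (?\<tau> q x) - ?f x))\<^sup>2) \<in> borel_measurable ?M"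
        "(\<lambda>x. (cmod (?f (?\<tau> q x) - ?f (?\<tau> (mat 1) x)))\<^sup>2) \<in> borel_measurable ?M"
        using sq_integrable_measurable[OF f(1)] sq_integrable_measurable[OF s[OF qG]]
          sq_integrable_measurable[OF s[OF one_in]] by simp_all
      show "AE x in ?M. (cmod (?f (?\<tau> q x) - ?f x))\<^sup>2 = (cmod (?f (?\<tau> q x) - ?f (?\<tau> (mat 1) x)))\<^sup>2"
        using A.\<tau>_one by eventually_elim simp
    qed
    \<comment> \<open>The estimate compares two translates of the indicator, which is why the
      untranslated function was first rewritten as its translate by 1.\<close>
    also have "\<dots> \<le> 2 * (w - measure \<mu> K)"
      by (rule D.coset_indicator_dist_le[OF F K W one_in _ KW]) (use q Q KQ inv1 in auto)
    finally show "(\<integral>x. (cmod (?f (?\<tau> q x) - ?f x))\<^sup>2 \<partial>?M) < \<epsilon>\<^sup>2 * (\<integral>x. (cmod (?f x))\<^sup>2 \<partial>?M)"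
      using less f(2) by simp
  qed
  then obtain s where s: "sq_integrable ?M s" "\<not> (AE x in ?M. s x = 0)"
    "\<And>g. g \<in> G \<Longrightarrow> AE x in ?M. s (?\<tau> g x) = s x" by blast
  have ms [measurable]: "s \<in> borel_measurable borel"
    using sq_integrable_measurable[OF s(1)] by (simp add: measurable_cong_sets[OF D.sets_coset_measure refl])
  \<comment> \<open>The invariant function, known on \<open>F\<close>, is extended to a function on
    \<open>G\<close> that is constant on cosets, to which ergodicity on the group applies.\<close>
  define t where "t x = s (D.proj F x)" for x
  have t [measurable]: "t \<in> borel_measurable borel"
    unfolding t_def by (rule measurable_compose[OF D.measurable_proj[OF F] ms])
  have "AE x in \<mu>. t (x ** g) = t x" if g: "g \<in> G" for g
  proof -
    \<comment> \<open>The exceptional set is a union of cosets and null inside \<open>F\<close>; by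
      the unfolding formula it is null in \<open>G\<close>.\<close>
    define B where "B = {x \<in> G. t (x ** g) \<noteq> t x}"
    have "{x \<in> space borel. x \<in> G \<and> t (x ** g) \<noteq> t x} \<in> sets borel" by measurable
    then have B: "B \<in> sets borel" by (simp add: B_def)
    have tD: "t (\<gamma> ** x) = t x" if "\<gamma> \<in> D" "x \<in> G" for \<gamma> x
      using D.proj_translate[OF F that(2,1)] by (simp add: t_def)
    have "\<gamma> ** x \<in> B \<longleftrightarrow> x \<in> B" if "\<gamma> \<in> D" "x \<in> G" for \<gamma> x
      using that tD[of \<gamma> x] tD[of \<gamma> "x ** g"] g by (simp add: B_def flip: matrix_mul_assoc)
    then have sub: "{y \<in> F. matrix_inv \<gamma> ** y \<in> B} = F \<inter> B" if "\<gamma> \<in> D" for \<gamma>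
      using that F'(2) by auto
    have "AE x in \<mu>. x \<notin> F \<inter> B"
      using s(3)[OF g] unfolding D.AE_coset_measure[OF F]
    proof eventually_elim
      fix x assume "x \<in> F \<longrightarrow> s (?\<tau> g x) = s x"
      then show "x \<notin> F \<inter> B" by (auto simp: B_def t_def D.act_def D.proj_id[OF F])
    qed
    then have "emeasure \<mu> (F \<inter> B) = 0"
      using emeasure_eq_0_AE[of "\<lambda>x. x \<in> F \<inter> B" \<mu>] by (simp add: Int_def)
    then have "emeasure \<mu> B = 0"
      using D.emeasure_fundamental_sat_aux[OF F B] sub
      by (auto simp: B_def nn_integral_0_iff_AE AE_count_space)
    then have "AE x in \<mu>. x \<notin> B" using B by (intro AE_not_in null_setsI) auto
    with AE_in show ?thesis by eventually_elim (simp add: B_def)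
  qed
  then obtain c where c: "AE x in \<mu>. t x = c" using AE_const_if_right_invariant[OF t] by blast
  have sc: "AE x in ?M. s x = c"
    unfolding D.AE_coset_measure[OF F] using c by eventually_elim (auto simp: t_def D.proj_id[OF F])
  have "c \<noteq> 0" using s(2) sc by auto
  \<comment> \<open>A nonzero constant has a finite square integral over \<open>F\<close> only if
    \<open>F\<close> has finite measure.\<close>
  have "(\<integral>\<^sup>+x. ennreal ((cmod (s x))\<^sup>2) \<partial>?M) = (\<integral>\<^sup>+x. ennreal ((cmod c)\<^sup>2) \<partial>?M)"
    using sc by (intro nn_integral_cong_AE) (auto elim: eventually_mono)
  also have "\<dots> = ennreal ((cmod c)\<^sup>2) * emeasure \<mu> F"
    using D.emeasure_coset_measure[OF F, of UNIV] by simp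
  finally have "ennreal ((cmod c)\<^sup>2) * emeasure \<mu> F < \<infinity>"
    using nn_integral_sq_integrable[OF s(1)] by (metis ennreal_less_top infinity_ennreal_def)
  then have "emeasure \<mu> F < \<infinity>" using \<open>c \<noteq> 0\<close> by (auto simp: ennreal_mult_less_top)
  then show ?thesis by (rule D.finite_volume_if_fundamental[OF F])
qed

lemma (in chabauty_limit) ex_finite_covolume:
  assumes T: "property_T G" and \<nu>: "invariant_volume G L \<nu>" "emeasure \<nu> (space \<nu>) < \<infinity>"
  shows "\<exists>n. \<not> infinite_covolume G (H n)"
proof -
  interpret L: discrete_linear_group G L by (rule L)
  interpret V: finite_covolume G L \<nu> using \<nu> by unfold_locales
  define \<mu> where "\<mu> = V.haar"
  interpret bi_haar G \<mu> unfolding \<mu>_def by (rule V.bi_haar_haar)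
  obtain Q \<epsilon> where Q: "compact Q" "Q \<subseteq> G" and \<epsilon>: "\<epsilon> > 0"
    and T': "\<And>(V :: ((real^'n^'n \<Rightarrow> complex) set) hilbert) \<pi>. hilbert_space V \<Longrightarrow> unitary_rep G V \<pi> \<Longrightarrow>
      has_almost_invariant_vector Q \<epsilon> V \<pi> \<Longrightarrow> has_invariant_vector G V \<pi>"
    using T unfolding property_T_def by blast
  obtain F where F: "L.fundamental F" using L.ex_fundamental by blast
  have F': "F \<in> sets borel" "F \<subseteq> G" "L.sat F = G" "L.small F" using F by (auto simp: L.fundamental_def)
  define c where "c = measure \<mu> F"
  have finF: "emeasure \<mu> F < \<infinity>"
    using V.emeasure_haar_fundamental[OF F] \<nu>(2) by (simp add: \<mu>_def)
  then have c: "emeasure \<mu> F = ennreal c" by (simp add: c_def emeasure_eq_ennreal_measure less_top)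
  have "emeasure \<mu> F \<noteq> 0"
    using V.emeasure_haar_fundamental[OF F] \<nu>(1) by (simp add: \<mu>_def invariant_volume_def)
  then have "c > 0" using c measure_nonneg[of \<mu> F] by (auto simp: c_def zero_less_measure_iff order_less_le)
  \<comment> \<open>With \<mu> K > c - \<eta> and \<mu> W \<le> c + \<eta> the error 2 (\<mu> W -
    \<mu> K) is below 4 \<eta>, and 4 \<eta> < \<epsilon>^2 (c - \<eta>) is wanted. This means
    \<eta> < \<epsilon>^2 c / (4 + \<epsilon>^2); half of that bound is taken.\<close>
  define \<eta> where "\<eta> = \<epsilon>\<^sup>2 * c / (2 * (4 + \<epsilon>\<^sup>2))"
  have d: "2 * (4 + \<epsilon>\<^sup>2) > 0" by (simp add: add_pos_nonneg)
  have \<eta>: "\<eta> > 0" "\<eta> < c" "4 * \<eta> < \<epsilon>\<^sup>2 * (c - \<eta>)"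
  proof -
    show "\<eta> > 0" using \<epsilon> \<open>c > 0\<close> d by (simp add: \<eta>_def)
    have *: "(4 + \<epsilon>\<^sup>2) * \<eta> = \<epsilon>\<^sup>2 * c / 2" using d by (simp add: \<eta>_def field_simps)
    have "\<epsilon>\<^sup>2 * c > 0" using \<epsilon> \<open>c > 0\<close> by simp
    with * have "(4 + \<epsilon>\<^sup>2) * \<eta> < \<epsilon>\<^sup>2 * c" by linarith
    then show "4 * \<eta> < \<epsilon>\<^sup>2 * (c - \<eta>)" by (simp add: algebra_simps)
    then have "0 < \<epsilon>\<^sup>2 * (c - \<eta>)" using \<open>\<eta> > 0\<close> by linarith
    then show "\<eta> < c" using \<epsilon> by (simp add: zero_less_mult_iff)
  qed
  have "ennreal (c - \<eta>) < emeasure \<mu> F" using \<eta> by (simp add: c ennreal_less_iff)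
  then obtain K where K: "compact K" "K \<subseteq> F" "ennreal (c - \<eta>) < emeasure \<mu> K"
    using inner_regular_finite[OF F'(1) finF] by blast
  have KG: "K \<subseteq> G" using K F' by blast
  have finK: "emeasure \<mu> K < \<infinity>"
    using emeasure_mono[of K F \<mu>] K F' finF by (auto intro: le_less_trans)
  have mK: "c - \<eta> < measure \<mu> K"
    using K(3) finK \<eta> by (simp add: emeasure_eq_ennreal_measure less_top ennreal_less_iff)
  obtain W where W: "open W" "F \<subseteq> W" "emeasure \<mu> W \<le> emeasure \<mu> F + ennreal \<eta>"
    using outer_regular_finite[OF F'(1,2) \<eta>(1)] by blast
  have w: "emeasure \<mu> W \<le> ennreal (c + \<eta>)" using W(3) \<open>c > 0\<close> \<eta> by (simp add: c ennreal_plus)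
  \<comment> \<open>Almost invariance is needed for all elements of the Kazhdan set \<open>Q\<close>
    at once. Joining \<open>K\<close> and K Q^-1 into one compact set gives a single
    \<open>n\<close> for which the translates of \<open>W\<close> under \<open>H n\<close> cover
    both.\<close>
  define K' where "K' = K \<union> (\<lambda>(x, q). x ** matrix_inv q) ` (K \<times> Q)"
  have K': "compact K'" "K' \<subseteq> G"
    unfolding K'_def using K KG Q by (auto intro!: compact_Un compact_translates simp: subset_iff)
  have "K' \<subseteq> L.sat W" using K'(2) F'(3) L.sat_mono[OF W(2)] by auto
  then have ev1: "\<forall>\<^sub>F n in sequentially. K' \<subseteq> discrete_linear_group.sat G (H n) W"
    by (rule eventually_subset_sat[OF K'(1) W(1)])
  have ev2: "\<forall>\<^sub>F n in sequentially. discrete_linear_group.small (H n) K"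
    using K KG F'(4) by (intro eventually_small) (auto intro: L.small_mono)
  obtain n where n: "K' \<subseteq> discrete_linear_group.sat G (H n) W" "discrete_linear_group.small (H n) K"
    using eventually_happens'[OF sequentially_bot eventually_conj[OF ev1 ev2]] by blast
  have "\<not> infinite_covolume G (H n)"
  proof (rule finite_covolume_if_almost_invariant[OF H T' Q(2) \<epsilon> K(1) KG n(2) finK _ W(1) w])
    show "measure \<mu> K > 0" using mK \<eta> by simp
    show "0 \<le> c + \<eta>" using \<open>c > 0\<close> \<eta> by simp
    show "K \<subseteq> discrete_linear_group.sat G (H n) W" using n(1) by (simp add: K'_def)
    show "x ** matrix_inv q \<in> discrete_linear_group.sat G (H n) W" if "x \<in> K" "q \<in> Q" for x q
    proof (rule subsetD[OF n(1)])
      show "x ** matrix_inv q \<in> K'"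
        unfolding K'_def using that by (intro UnI2 image_eqI[of _ _ "(x, q)"]) auto
    qed
    have "2 * ((c + \<eta>) - measure \<mu> K) < 4 * \<eta>" using mK by simp
    also have "\<dots> < \<epsilon>\<^sup>2 * (c - \<eta>)" by (rule \<eta>(3))
    also have "\<dots> \<le> \<epsilon>\<^sup>2 * measure \<mu> K" using mK by (intro mult_left_mono) auto
    finally show "2 * ((c + \<eta>) - measure \<mu> K) < \<epsilon>\<^sup>2 * measure \<mu> K" .
  qed
  then show ?thesis by blast
qed

theorem corollary8p5:
  fixes G :: "(real^'n^'n) set"
    and \<Gamma> :: "nat \<Rightarrow> (real^'n^'n) set"
    and \<Gamma>_lim :: "(real^'n^'n) set"
  assumes "connected_algebraic_group G"
    and "semisimple_group G"
    and "finite (group_center G)"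
    and "no_compact_factors G"
    and "property_T G"
    and "\<And>n. discrete_subgroup G (\<Gamma> n)"
    and "\<And>n. zariski_dense_in G (\<Gamma> n)"
    and "\<And>n. infinite_covolume G (\<Gamma> n)"
    and "discrete_subgroup G \<Gamma>_lim"
    and "zariski_dense_in G \<Gamma>_lim"
    and "chabauty_converges G \<Gamma> \<Gamma>_lim"
  shows "infinite_covolume G \<Gamma>_lim"
proof (rule ccontr)
  assume "\<not> infinite_covolume G \<Gamma>_lim"
  then obtain \<nu> where \<nu>: "invariant_volume G \<Gamma>_lim \<nu>" "emeasure \<nu> (space \<nu>) < \<infinity>"
    unfolding infinite_covolume_def by (auto simp: less_top)
  have G: "linear_group G" by (rule linear_group_connected_algebraic) fact
  interpret chabauty_limit G \<Gamma> \<Gamma>_lim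
    by (intro chabauty_limit.intro chabauty_limit_axioms.intro G discrete_linear_groupI assms(6,9,11))
  show False
    using ex_finite_covolume[OF \<open>property_T G\<close> \<nu>] assms(8) by blast
qed

end
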